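(* Assume that $f_0$, $f_1$, $f_2$ do not depend on the control variable $u_{12}$. Let $(u_1^*,u_2^*,u_{12}^* )$ be an optimal control, i.e. an admissible control that minimizes $J$ over all admissible controls, let $y^*$ be the corresponding solution of the state equation, and let $(\psi_0^*,\psi_1^*,\psi_2^*,\psi_{12}^* )$ be the associated co-state. Then, at every point $(s,t)\in(0,A)\times(0,B)$ such that $u_1^*$ is continuous at $s$, $u_2^*$ is continuous at $t$ and $u_{12}^*$ is continuous at $(s,t)$, the value $u_{12}^*(s,t)$ minimizes the function $$u_{12}\mapsto h_{12}\big(s,t,y^*(s,t),u_1^*(s),u_2^*(t),u_{12},\psi_0^*,\psi_1^*(\cdot),\psi_2^*(\cdot),\psi_{12}^*(\cdot,\cdot)\big)$$ over all $u_{12}\in U_{12}$.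
   Context: **State equation.** Let $A,B>0$. The state $y(s,t)\in\mathbb{R}^n$, $(s,t)\in[0,A]\times[0,B]$, solves $$y(s,t)=f_0(s,t,u_1(s),u_2(t),u_{12}(s,t))+\int_0^s f_1(s,t,\sigma,y(\sigma,t),u_1(\sigma),u_2(t),u_{12}(\sigma,t))\,d\sigma$$ $$+\int_0^t f_2(s,t,\tau,y(s,\tau),u_1(s),u_2(\tau),u_{12}(s,\tau))\,d\tau+\int_0^s\!\int_0^t f_{12}(s,t,\sigma,\tau,y(\sigma,\tau),u_1(\sigma),u_2(\tau),u_{12}(\sigma,\tau))\,d\tau\,d\sigma .$$ The values $y(A,t)$, $y(s,B)$, $y(A,B)$ are those given by this equation, using the boundary values of the controls described below. **Cost functional.** $$J=F_0(y(A,B),u_1(A),u_2(B),u_{12}(A,B))+\int_0^A F_1(s,y(s,B),u_1(s),u_2(B),u_{12}(s,B))\,ds$$ $$+\int_0^B F_2(t,y(A,t),u_1(A),u_2(t),u_{12}(A,t))\,dt+\int_0^A\!\int_0^B F_{12}(s,t,y(s,t),u_1(s),u_2(t),u_{12}(s,t))\,dt\,ds,$$ with real-valued $F_0,F_1,F_2,F_{12}$. **Admissible controls.** $u_1,u_2,u_{12}$ are bounded measurable functions on $[0,A]$, $[0,B]$, $[0,A]\times[0,B]$ with values in given compact subsets $U_1,U_2,U_{12}$ of Euclidean spaces. The admissible class is one (fixed) of the following two. (a) The limits $u_{12}(A,\cdot)=\lim_{s\to A^-}u_{12}(s,\cdot)$ and $u_{12}(\cdot,B)=\lim_{t\to B^-}u_{12}(\cdot,t)$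 exist in $L^\infty([0,B])$ and $L^\infty([0,A])$ respectively; the limits $u_1(A)=\lim_{s\to A^-}u_1(s)$ and $u_2(B)=\lim_{t\to B^-}u_2(t)$ exist; and $\lim_{t\to B^-}u_{12}(A,t)=\lim_{s\to A^-}u_{12}(s,B)=\lim_{(s,t)\to(A,B)}u_{12}(s,t)=u_{12}(A,B)$. (b) (Piecewise continuous controls.) There are finitely many piecewise $C^1$ curves in $[0,A]\times[0,B]$ dividing it into open subdomains $G_i$ such that $u_{12}$ is continuous on each $G_i$ and its restriction to $G_i$ extends continuously to $\overline{G_i}$; the limits $u_{12}(A,t)=\lim_{s\to A^-}u_{12}(s,t)$ and $u_{12}(s,B)=\lim_{t\to B^-}u_{12}(s,t)$ exist for all but finitely many $t$, respectively $s$, uniformly, and define piecewise continuous functions of one variable (finitely many jump discontinuities with finite one-sided limits); $\lim_{(s,t)\to(A^-,B^-)}u_{12}(s,t)=\lim_{t\to B^-}u_{12}(A,t)=\lim_{s\to A^-}u_{12}(s,B)=u_{12}(A,B)$; and $u_1,u_2$ are piecewise continuous with $\lim_{s\to A^-}u_1(s)=u_1(A)$ and $\lim_{t\to B^-}u_2(t)=u_2(B)$. **Regularity.** All functions $f_0,f_1,f_2,f_{12},F_0,F_1,F_2,F_{12}$ are continuous in all their arguments and continuously differentiable with respect to $y$ and the control variables (with derivatives continuous in all arguments); $f_1,f_2,f_{12}$ are bounded and Lipschitz in $y$, uniformly in the other variables. Then the state equation has a unique bounded measurable solution for each admissible control. **Co-state.** $\nabla_y$ denotes the Jacobian in $y$;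 gradients of real-valued functions are row vectors, and $\psi_0,\psi_1(s),\psi_2(t),\psi_{12}(s,t)$ are $n$-dimensional row vectors. Along a control $(u_1,u_2,u_{12})$ and its state $y$, abbreviate $[s,t]=(y(s,t),u_1(s),u_2(t),u_{12}(s,t))$ for all $(s,t)\in[0,A]\times[0,B]$ (including $s=A$ or $t=B$). The co-state is the bounded measurable solution of $$\psi_0=\nabla_yF_0([A,B]),$$ $$\psi_1(s)=\nabla_yF_1(s,[s,B])+\psi_0\nabla_yf_1(A,B,s,[s,B])+\int_s^A\psi_1(\sigma)\nabla_yf_1(\sigma,B,s,[s,B])\,d\sigma,$$ $$\psi_2(t)=\nabla_yF_2(t,[A,t])+\psi_0\nabla_yf_2(A,B,t,[A,t])+\int_t^B\psi_2(\tau)\nabla_yf_2(A,\tau,t,[A,t])\,d\tau,$$ $$\psi_{12}(s,t)=\nabla_yF_{12}(s,t,[s,t])+\psi_1(s)\nabla_yf_2(s,B,t,[s,t])+\psi_2(t)\nabla_yf_1(A,t,s,[s,t])+\psi_0\nabla_yf_{12}(A,B,s,t,[s,t])$$ $$+\int_s^A\big[\psi_{12}(\sigma,t)\nabla_yf_1(\sigma,t,s,[s,t])+\psi_1(\sigma)\nabla_yf_{12}(\sigma,B,s,t,[s,t])\big]d\sigma$$ $$+\int_t^B\big[\psi_{12}(s,\tau)\nabla_yf_2(s,\tau,t,[s,t])+\psi_2(\tau)\nabla_yf_{12}(A,\tau,s,t,[s,t])\big]d\tau+\int_s^A\!\int_t^B\psi_{12}(\sigma,\tau)\nabla_yf_{12}(\sigma,\tau,s,t,[s,t])\,d\tau\,d\sigma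 .$$ **Hamiltonian.** With $v=(y,u_1,u_2,u_{12})$, $$h_{12}(s,t,y,u_1,u_2,u_{12},\psi_0,\psi_1(\cdot),\psi_2(\cdot),\psi_{12}(\cdot,\cdot))=F_{12}(s,t,v)+\psi_0f_{12}(A,B,s,t,v)+\psi_1(s)f_2(s,B,t,v)+\psi_2(t)f_1(A,t,s,v)$$ $$+\int_s^A\big[\psi_{12}(\sigma,t)f_1(\sigma,t,s,v)+\psi_1(\sigma)f_{12}(\sigma,B,s,t,v)\big]d\sigma+\int_t^B\big[\psi_{12}(s,\tau)f_2(s,\tau,t,v)+\psi_2(\tau)f_{12}(A,\tau,s,t,v)\big]d\tau$$ $$+\int_s^A\!\int_t^B\psi_{12}(\sigma,\tau)f_{12}(\sigma,\tau,s,t,v)\,d\tau\,d\sigma .$$ *)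

theory Defs
  imports "HOL-Analysis.Analysis" "HOL-Probability.Essential_Supremum"
begin

section \<open>Problem data\<close>

text \<open>
  The state lives in \<open>real^'n\<close>; the control variables live in Euclidean spaces \<open>'a\<close>, \<open>'b\<close>, \<open>'c\<close>.
  The functions take the bundled argument \<open>v = (y, u\<^sub>1, u\<^sub>2, u\<^sub>1\<^sub>2)\<close> last
  (for \<open>f0\<close>: \<open>(u\<^sub>1, u\<^sub>2, u\<^sub>1\<^sub>2)\<close>).
  Order of the scalar arguments: \<open>f0 s t\<close>, \<open>f1 s t \<sigma>\<close>, \<open>f2 s t \<tau>\<close>, \<open>f12 s t \<sigma> \<tau>\<close>,
  \<open>F1 s\<close>, \<open>F2 t\<close>, \<open>F12 s t\<close>.
\<close>

type_synonym ('n, 'a, 'b, 'c) point = "(real^'n) \<times> 'a \<times> 'b \<times> 'c"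

record ('n, 'a, 'b, 'c) problem =
  endA :: real
  endB :: real
  U1 :: "'a set"
  U2 :: "'b set"
  U12 :: "'c set"
  f0 :: "real \<Rightarrow> real \<Rightarrow> 'a \<times> 'b \<times> 'c \<Rightarrow> real^'n"
  f1 :: "real \<Rightarrow> real \<Rightarrow> real \<Rightarrow> ('n, 'a, 'b, 'c) point \<Rightarrow> real^'n"
  f2 :: "real \<Rightarrow> real \<Rightarrow> real \<Rightarrow> ('n, 'a, 'b, 'c) point \<Rightarrow> real^'n"
  f12 :: "real \<Rightarrow> real \<Rightarrow> real \<Rightarrow> real \<Rightarrow> ('n, 'a, 'b, 'c) point \<Rightarrow> real^'n"
  F0 :: "('n, 'a, 'b, 'c) point \<Rightarrow> real"
  F1 :: "real \<Rightarrow> ('n, 'a, 'b, 'c) point \<Rightarrow> real"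
  F2 :: "real \<Rightarrow> ('n, 'a, 'b, 'c) point \<Rightarrow> real"
  F12 :: "real \<Rightarrow> real \<Rightarrow> ('n, 'a, 'b, 'c) point \<Rightarrow> real"

definition rect :: "('n::finite, 'a, 'b, 'c) problem \<Rightarrow> (real \<times> real) set" where
  "rect P = {0..endA P} \<times> {0..endB P}"

text \<open>Since \<open>\<sigma>\<close> and \<open>\<tau>\<close> are integrated up to \<open>s\<close> and \<open>t\<close>, the
  functions \<open>f1\<close>, \<open>f2\<close>, \<open>f12\<close> matter only for \<open>\<sigma> \<le> s\<close> and \<open>\<tau> \<le> t\<close>.\<close>

definition dom1 :: "('n::finite, 'a, 'b, 'c) problem \<Rightarrow> (real \<times> real \<times> real) set" where
  "dom1 P = {(s, t, \<sigma>). 0 \<le> \<sigma> \<and> \<sigma> \<le> s \<and> s \<le> endA P \<and> 0 \<le> t \<and> t \<le> endB P}"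

definition dom2 :: "('n::finite, 'a, 'b, 'c) problem \<Rightarrow> (real \<times> real \<times> real) set" where
  "dom2 P = {(s, t, \<tau>). 0 \<le> s \<and> s \<le> endA P \<and> 0 \<le> \<tau> \<and> \<tau> \<le> t \<and> t \<le> endB P}"

definition dom12 :: "('n::finite, 'a, 'b, 'c) problem \<Rightarrow> (real \<times> real \<times> real \<times> real) set" where
  "dom12 P = {(s, t, \<sigma>, \<tau>). 0 \<le> \<sigma> \<and> \<sigma> \<le> s \<and> s \<le> endA P \<and> 0 \<le> \<tau> \<and> \<tau> \<le> t \<and> t \<le> endB P}"

definition controls :: "('n::finite, 'a, 'b, 'c) problem \<Rightarrow> ('a \<times> 'b \<times> 'c) set" where
  "controls P = U1 P \<times> U2 P \<times> U12 P"


section \<open>Regularity\<close>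

text \<open>
  \<open>g p v\<close> is jointly continuous for \<open>(p, v) \<in> T \<times> V\<close> and continuously differentiable in \<open>v\<close>,
  with derivative jointly continuous in \<open>(p, v)\<close>.  Derivatives are taken within \<open>V\<close>, because the
  control variables range over arbitrary compact sets; this holds in particular for the restriction
  of a function that is continuously differentiable in \<open>v\<close> on an open neighbourhood of \<open>V\<close>.
\<close>

definition C1_in ::
  "'p::topological_space set \<Rightarrow> 'v::real_normed_vector set \<Rightarrow>
   ('p \<Rightarrow> 'v \<Rightarrow> 'w::real_normed_vector) \<Rightarrow> bool" where
  "C1_in T V g \<longleftrightarrow>
     continuous_on (T \<times> V) (\<lambda>(p, v). g p v) \<and>
     (\<exists>D :: 'p \<Rightarrow> 'v \<Rightarrow> 'v \<Rightarrow>\<^sub>L 'w.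
        continuous_on (T \<times> V) (\<lambda>(p, v). D p v) \<and>
        (\<forall>p\<in>T. \<forall>v\<in>V. (g p has_derivative blinfun_apply (D p v)) (at v within V)))"

definition bounded_lipschitz_in_state ::
  "'p set \<Rightarrow> 'u set \<Rightarrow> ('p \<Rightarrow> 'y::real_normed_vector \<times> 'u \<Rightarrow> 'w::real_normed_vector) \<Rightarrow> bool" where
  "bounded_lipschitz_in_state T U g \<longleftrightarrow>
     bounded ((\<lambda>(p, v). g p v) ` (T \<times> (UNIV \<times> U))) \<and>
     (\<exists>L. \<forall>p\<in>T. \<forall>u\<in>U. L-lipschitz_on UNIV (\<lambda>y. g p (y, u)))"

definition regular_problem ::
  "('n::finite, 'a::euclidean_space, 'b::euclidean_space, 'c::euclidean_space) problem \<Rightarrow> bool" where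
  "regular_problem P \<longleftrightarrow>
     0 < endA P \<and> 0 < endB P \<and>
     compact (U1 P) \<and> compact (U2 P) \<and> compact (U12 P) \<and>
     C1_in (rect P) (controls P) (\<lambda>(s, t). f0 P s t) \<and>
     C1_in (dom1 P) (UNIV \<times> controls P) (\<lambda>(s, t, \<sigma>). f1 P s t \<sigma>) \<and>
     C1_in (dom2 P) (UNIV \<times> controls P) (\<lambda>(s, t, \<tau>). f2 P s t \<tau>) \<and>
     C1_in (dom12 P) (UNIV \<times> controls P) (\<lambda>(s, t, \<sigma>, \<tau>). f12 P s t \<sigma> \<tau>) \<and>
     C1_in {0::real} (UNIV \<times> controls P) (\<lambda>_. F0 P) \<and>
     C1_in {0..endA P} (UNIV \<times> controls P) (F1 P) \<and>
     C1_in {0..endB P} (UNIV \<times> controls P) (F2 P) \<and>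
     C1_in (rect P) (UNIV \<times> controls P) (\<lambda>(s, t). F12 P s t) \<and>
     bounded_lipschitz_in_state (dom1 P) (controls P) (\<lambda>(s, t, \<sigma>). f1 P s t \<sigma>) \<and>
     bounded_lipschitz_in_state (dom2 P) (controls P) (\<lambda>(s, t, \<tau>). f2 P s t \<tau>) \<and>
     bounded_lipschitz_in_state (dom12 P) (controls P) (\<lambda>(s, t, \<sigma>, \<tau>). f12 P s t \<sigma> \<tau>)"

definition f0_f1_f2_indep_u12 :: "('n::finite, 'a, 'b, 'c) problem \<Rightarrow> bool" where
  "f0_f1_f2_indep_u12 P \<longleftrightarrow>
     (\<forall>a\<in>U1 P. \<forall>b\<in>U2 P. \<forall>c\<in>U12 P. \<forall>c'\<in>U12 P.
        (\<forall>(s, t)\<in>rect P. f0 P s t (a, b, c) = f0 P s t (a, b, c')) \<and>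
        (\<forall>(s, t, \<sigma>)\<in>dom1 P. \<forall>y. f1 P s t \<sigma> (y, a, b, c) = f1 P s t \<sigma> (y, a, b, c')) \<and>
        (\<forall>(s, t, \<tau>)\<in>dom2 P. \<forall>y. f2 P s t \<tau> (y, a, b, c) = f2 P s t \<tau> (y, a, b, c')))"


section \<open>Admissible controls\<close>

text \<open>
  Controls are functions on the closed intervals and the closed rectangle, so their boundary values
  \<open>u1 A\<close>, \<open>u2 B\<close>, \<open>u12 A t\<close>, \<open>u12 s B\<close>, \<open>u12 A B\<close> are part of the data, tied to the
  interior values by the limit conditions below.  Measurable means Borel measurable, so that
  every section of a function on the rectangle is measurable.  Boundedness follows
  from compactness of the control sets.
\<close>

definition measurable_controls ::
  "('n::finite, 'a::euclidean_space, 'b::euclidean_space, 'c::euclidean_space) problem \<Rightarrow>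
   (real \<Rightarrow> 'a) \<Rightarrow> (real \<Rightarrow> 'b) \<Rightarrow> (real \<Rightarrow> real \<Rightarrow> 'c) \<Rightarrow> bool" where
  "measurable_controls P u1 u2 u12 \<longleftrightarrow>
     u1 \<in> borel_measurable (restrict_space borel {0..endA P}) \<and>
     u2 \<in> borel_measurable (restrict_space borel {0..endB P}) \<and>
     (\<lambda>(s, t). u12 s t) \<in> borel_measurable (restrict_space borel (rect P)) \<and>
     (\<forall>s\<in>{0..endA P}. u1 s \<in> U1 P) \<and>
     (\<forall>t\<in>{0..endB P}. u2 t \<in> U2 P) \<and>
     (\<forall>s\<in>{0..endA P}. \<forall>t\<in>{0..endB P}. u12 s t \<in> U12 P)"

definition Linf_tendsto ::
  "real \<Rightarrow> ('i \<Rightarrow> real \<Rightarrow> 'c::euclidean_space) \<Rightarrow> (real \<Rightarrow> 'c) \<Rightarrow> 'i filter \<Rightarrow> bool" where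
  "Linf_tendsto b g l F \<longleftrightarrow>
     ((\<lambda>i. esssup (lebesgue_on {0..b}) (\<lambda>x. ereal (norm (g i x - l x)))) \<longlongrightarrow> 0) F"

definition corner_limits :: "real \<Rightarrow> real \<Rightarrow> (real \<Rightarrow> real \<Rightarrow> 'c::euclidean_space) \<Rightarrow> bool" where
  "corner_limits A B u12 \<longleftrightarrow>
     ((\<lambda>t. u12 A t) \<longlongrightarrow> u12 A B) (at_left B) \<and>
     ((\<lambda>s. u12 s B) \<longlongrightarrow> u12 A B) (at_left A) \<and>
     ((\<lambda>(s, t). u12 s t) \<longlongrightarrow> u12 A B) (at (A, B) within {0..<A} \<times> {0..<B})"

definition admissible_Linf ::
  "('n::finite, 'a::euclidean_space, 'b::euclidean_space, 'c::euclidean_space) problem \<Rightarrow>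
   (real \<Rightarrow> 'a) \<Rightarrow> (real \<Rightarrow> 'b) \<Rightarrow> (real \<Rightarrow> real \<Rightarrow> 'c) \<Rightarrow> bool" where
  "admissible_Linf P u1 u2 u12 \<longleftrightarrow>
     measurable_controls P u1 u2 u12 \<and>
     Linf_tendsto (endB P) (\<lambda>s t. u12 s t) (\<lambda>t. u12 (endA P) t) (at_left (endA P)) \<and>
     Linf_tendsto (endA P) (\<lambda>t s. u12 s t) (\<lambda>s. u12 s (endB P)) (at_left (endB P)) \<and>
     (u1 \<longlongrightarrow> u1 (endA P)) (at_left (endA P)) \<and>
     (u2 \<longlongrightarrow> u2 (endB P)) (at_left (endB P)) \<and>
     corner_limits (endA P) (endB P) u12"

definition piecewise_continuous :: "real \<Rightarrow> real \<Rightarrow> (real \<Rightarrow> 'd::euclidean_space) \<Rightarrow> bool" where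
  "piecewise_continuous a b g \<longleftrightarrow>
     (\<exists>S. finite S \<and> continuous_on ({a..b} - S) g) \<and>
     (\<forall>x\<in>{a<..b}. \<exists>l. (g \<longlongrightarrow> l) (at_left x)) \<and>
     (\<forall>x\<in>{a..<b}. \<exists>l. (g \<longlongrightarrow> l) (at_right x))"

text \<open>The subdomains are the connected components of the open rectangle minus the curves;
  values on the curves themselves are not constrained.\<close>

definition piecewise_continuous_2d ::
  "real \<Rightarrow> real \<Rightarrow> (real \<Rightarrow> real \<Rightarrow> 'c::euclidean_space) \<Rightarrow> bool" where
  "piecewise_continuous_2d A B u \<longleftrightarrow>
     (\<exists>C :: (real \<Rightarrow> real \<times> real) set. finite C \<and>
        (\<forall>\<gamma>\<in>C. valid_path \<gamma> \<and> path_image \<gamma> \<subseteq> {0..A} \<times> {0..B}) \<and>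
        (\<forall>G\<in>components ({0<..<A} \<times> {0<..<B} - (\<Union>\<gamma>\<in>C. path_image \<gamma>)).
           continuous_on G (\<lambda>(s, t). u s t) \<and>
           (\<exists>g. continuous_on (closure G) g \<and> (\<forall>(s, t)\<in>G. g (s, t) = u s t))))"

definition admissible_pc ::
  "('n::finite, 'a::euclidean_space, 'b::euclidean_space, 'c::euclidean_space) problem \<Rightarrow>
   (real \<Rightarrow> 'a) \<Rightarrow> (real \<Rightarrow> 'b) \<Rightarrow> (real \<Rightarrow> real \<Rightarrow> 'c) \<Rightarrow> bool" where
  "admissible_pc P u1 u2 u12 \<longleftrightarrow>
     measurable_controls P u1 u2 u12 \<and>
     piecewise_continuous_2d (endA P) (endB P) u12 \<and>
     (\<exists>S. finite S \<and>
        uniform_limit ({0..endB P} - S) (\<lambda>s t. u12 s t) (\<lambda>t. u12 (endA P) t) (at_left (endA P))) \<and>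
     (\<exists>S. finite S \<and>
        uniform_limit ({0..endA P} - S) (\<lambda>t s. u12 s t) (\<lambda>s. u12 s (endB P)) (at_left (endB P))) \<and>
     piecewise_continuous 0 (endB P) (\<lambda>t. u12 (endA P) t) \<and>
     piecewise_continuous 0 (endA P) (\<lambda>s. u12 s (endB P)) \<and>
     corner_limits (endA P) (endB P) u12 \<and>
     piecewise_continuous 0 (endA P) u1 \<and>
     piecewise_continuous 0 (endB P) u2 \<and>
     (u1 \<longlongrightarrow> u1 (endA P)) (at_left (endA P)) \<and>
     (u2 \<longlongrightarrow> u2 (endB P)) (at_left (endB P))"

datatype control_class = Linf_Limits | Piecewise_Cont

fun admissible ::
  "control_class \<Rightarrow>
   ('n::finite, 'a::euclidean_space, 'b::euclidean_space, 'c::euclidean_space) problem \<Rightarrow>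
   (real \<Rightarrow> 'a) \<Rightarrow> (real \<Rightarrow> 'b) \<Rightarrow> (real \<Rightarrow> real \<Rightarrow> 'c) \<Rightarrow> bool" where
  "admissible Linf_Limits P u1 u2 u12 = admissible_Linf P u1 u2 u12"
| "admissible Piecewise_Cont P u1 u2 u12 = admissible_pc P u1 u2 u12"


section \<open>State, cost, optimality\<close>

definition along ::
  "(real \<Rightarrow> real \<Rightarrow> real^'n) \<Rightarrow> (real \<Rightarrow> 'a) \<Rightarrow> (real \<Rightarrow> 'b) \<Rightarrow> (real \<Rightarrow> real \<Rightarrow> 'c) \<Rightarrow>
   real \<Rightarrow> real \<Rightarrow> ('n::finite, 'a, 'b, 'c) point" where
  "along y u1 u2 u12 s t = (y s t, u1 s, u2 t, u12 s t)"

definition is_state ::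
  "('n::finite, 'a, 'b, 'c) problem \<Rightarrow>
   (real \<Rightarrow> 'a) \<Rightarrow> (real \<Rightarrow> 'b) \<Rightarrow> (real \<Rightarrow> real \<Rightarrow> 'c) \<Rightarrow> (real \<Rightarrow> real \<Rightarrow> real^'n) \<Rightarrow> bool" where
  "is_state P u1 u2 u12 y \<longleftrightarrow>
     (\<lambda>(s, t). y s t) \<in> borel_measurable (restrict_space borel (rect P)) \<and>
     bounded ((\<lambda>(s, t). y s t) ` rect P) \<and>
     (\<forall>s\<in>{0..endA P}. \<forall>t\<in>{0..endB P}.
        y s t = f0 P s t (u1 s, u2 t, u12 s t)
          + (LBINT \<sigma>:{0..s}. f1 P s t \<sigma> (along y u1 u2 u12 \<sigma> t))
          + (LBINT \<tau>:{0..t}. f2 P s t \<tau> (along y u1 u2 u12 s \<tau>))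
          + (LBINT \<sigma>:{0..s}. LBINT \<tau>:{0..t}. f12 P s t \<sigma> \<tau> (along y u1 u2 u12 \<sigma> \<tau>)))"

definition cost ::
  "('n::finite, 'a, 'b, 'c) problem \<Rightarrow>
   (real \<Rightarrow> 'a) \<Rightarrow> (real \<Rightarrow> 'b) \<Rightarrow> (real \<Rightarrow> real \<Rightarrow> 'c) \<Rightarrow> (real \<Rightarrow> real \<Rightarrow> real^'n) \<Rightarrow> real" where
  "cost P u1 u2 u12 y =
     (let A = endA P; B = endB P; v = along y u1 u2 u12 in
        F0 P (v A B)
        + (LBINT s:{0..A}. F1 P s (v s B))
        + (LBINT t:{0..B}. F2 P t (v A t))
        + (LBINT s:{0..A}. LBINT t:{0..B}. F12 P s t (v s t)))"

text \<open>Each admissible control has exactly one state (up to values outside the rectangle), so it is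
  immaterial that the states are quantified universally here.\<close>

definition optimal_control ::
  "control_class \<Rightarrow>
   ('n::finite, 'a::euclidean_space, 'b::euclidean_space, 'c::euclidean_space) problem \<Rightarrow>
   (real \<Rightarrow> 'a) \<Rightarrow> (real \<Rightarrow> 'b) \<Rightarrow> (real \<Rightarrow> real \<Rightarrow> 'c) \<Rightarrow> bool" where
  "optimal_control cls P u1 u2 u12 \<longleftrightarrow>
     admissible cls P u1 u2 u12 \<and>
     (\<forall>y w1 w2 w12 z.
        is_state P u1 u2 u12 y \<longrightarrow> admissible cls P w1 w2 w12 \<longrightarrow> is_state P w1 w2 w12 z \<longrightarrow>
        cost P u1 u2 u12 y \<le> cost P w1 w2 w12 z)"


section \<open>Co-state and Hamiltonian\<close>

text \<open>Row vectors are elements of \<open>real^'n\<close>: a row vector times a matrix is \<open>v*\<close>, and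
  a row vector times a column vector is the inner product.\<close>

definition jac_y :: "((real^'n::finite) \<times> 'u \<Rightarrow> real^'m::finite) \<Rightarrow> (real^'n) \<times> 'u \<Rightarrow> real^'n^'m" where
  "jac_y g v = jacobian (\<lambda>y. g (y, snd v)) (at (fst v))"

definition grad_y :: "((real^'n::finite) \<times> 'u \<Rightarrow> real) \<Rightarrow> (real^'n) \<times> 'u \<Rightarrow> real^'n" where
  "grad_y g v = (\<chi> i. frechet_derivative (\<lambda>y. g (y, snd v)) (at (fst v)) (axis i 1))"

definition is_costate ::
  "('n::finite, 'a, 'b, 'c) problem \<Rightarrow>
   (real \<Rightarrow> 'a) \<Rightarrow> (real \<Rightarrow> 'b) \<Rightarrow> (real \<Rightarrow> real \<Rightarrow> 'c) \<Rightarrow> (real \<Rightarrow> real \<Rightarrow> real^'n) \<Rightarrow>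
   real^'n \<Rightarrow> (real \<Rightarrow> real^'n) \<Rightarrow> (real \<Rightarrow> real^'n) \<Rightarrow> (real \<Rightarrow> real \<Rightarrow> real^'n) \<Rightarrow> bool" where
  "is_costate P u1 u2 u12 y \<psi>0 \<psi>1 \<psi>2 \<psi>12 \<longleftrightarrow>
     (let A = endA P; B = endB P; v = along y u1 u2 u12 in
        \<psi>1 \<in> borel_measurable (restrict_space borel {0..A}) \<and> bounded (\<psi>1 ` {0..A}) \<and>
        \<psi>2 \<in> borel_measurable (restrict_space borel {0..B}) \<and> bounded (\<psi>2 ` {0..B}) \<and>
        (\<lambda>(s, t). \<psi>12 s t) \<in> borel_measurable (restrict_space borel (rect P)) \<and>
        bounded ((\<lambda>(s, t). \<psi>12 s t) ` rect P) \<and>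
        \<psi>0 = grad_y (F0 P) (v A B) \<and>
        (\<forall>s\<in>{0..A}.
           \<psi>1 s = grad_y (F1 P s) (v s B) + \<psi>0 v* jac_y (f1 P A B s) (v s B)
             + (LBINT \<sigma>:{s..A}. \<psi>1 \<sigma> v* jac_y (f1 P \<sigma> B s) (v s B))) \<and>
        (\<forall>t\<in>{0..B}.
           \<psi>2 t = grad_y (F2 P t) (v A t) + \<psi>0 v* jac_y (f2 P A B t) (v A t)
             + (LBINT \<tau>:{t..B}. \<psi>2 \<tau> v* jac_y (f2 P A \<tau> t) (v A t))) \<and>
        (\<forall>s\<in>{0..A}. \<forall>t\<in>{0..B}.
           \<psi>12 s t = grad_y (F12 P s t) (v s t)
             + \<psi>1 s v* jac_y (f2 P s B t) (v s t)
             + \<psi>2 t v* jac_y (f1 P A t s) (v s t)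
             + \<psi>0 v* jac_y (f12 P A B s t) (v s t)
             + (LBINT \<sigma>:{s..A}. \<psi>12 \<sigma> t v* jac_y (f1 P \<sigma> t s) (v s t)
                               + \<psi>1 \<sigma> v* jac_y (f12 P \<sigma> B s t) (v s t))
             + (LBINT \<tau>:{t..B}. \<psi>12 s \<tau> v* jac_y (f2 P s \<tau> t) (v s t)
                               + \<psi>2 \<tau> v* jac_y (f12 P A \<tau> s t) (v s t))
             + (LBINT \<sigma>:{s..A}. LBINT \<tau>:{t..B}. \<psi>12 \<sigma> \<tau> v* jac_y (f12 P \<sigma> \<tau> s t) (v s t))))"

definition h12 ::
  "('n::finite, 'a, 'b, 'c) problem \<Rightarrow> real \<Rightarrow> real \<Rightarrow> ('n, 'a, 'b, 'c) point \<Rightarrow>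
   real^'n \<Rightarrow> (real \<Rightarrow> real^'n) \<Rightarrow> (real \<Rightarrow> real^'n) \<Rightarrow> (real \<Rightarrow> real \<Rightarrow> real^'n) \<Rightarrow> real" where
  "h12 P s t v \<psi>0 \<psi>1 \<psi>2 \<psi>12 =
     (let A = endA P; B = endB P in
        F12 P s t v
        + \<psi>0 \<bullet> f12 P A B s t v
        + \<psi>1 s \<bullet> f2 P s B t v
        + \<psi>2 t \<bullet> f1 P A t s v
        + (LBINT \<sigma>:{s..A}. \<psi>12 \<sigma> t \<bullet> f1 P \<sigma> t s v + \<psi>1 \<sigma> \<bullet> f12 P \<sigma> B s t v)
        + (LBINT \<tau>:{t..B}. \<psi>12 s \<tau> \<bullet> f2 P s \<tau> t v + \<psi>2 \<tau> \<bullet> f12 P A \<tau> s t v)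
        + (LBINT \<sigma>:{s..A}. LBINT \<tau>:{t..B}. \<psi>12 \<sigma> \<tau> \<bullet> f12 P \<sigma> \<tau> s t v))"

end

theory Submission
  imports Defs
begin

text \<open>
  The theorem is proved by a needle variation.  Let \<open>w \<in> U12 P\<close>, and replace \<open>u12\<close> by \<open>w\<close> on a small
  square \<open>Q\<close> of area \<open>m\<close> around \<open>(s, t)\<close>.  As \<open>f0\<close>, \<open>f1\<close> and \<open>f2\<close> do not see \<open>u12\<close>, the state equation
  changes only through the double integral over \<open>Q\<close>, so that the state moves by \<open>O(m)\<close>, uniformly on the
  whole rectangle (\<open>needle_state_estimate\<close>).  Line integrals across \<open>Q\<close>, which would be of the larger
  order \<open>sqrt m\<close>, do not occur; hence the remainder of a first-order expansion is \<open>o(m)\<close>.  The linear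
  part is evaluated by testing the linearized state equation against the co-state, which is Fubini's
  theorem (\<open>adjoint_identity\<close>).  The result is that the cost changes by the integral over \<open>Q\<close> of the
  increment \<open>hvar\<close> of the Hamiltonian, up to \<open>o(m)\<close> (\<open>cost_variation\<close>, \<open>hvar_eq_h12_diff\<close>).

  The increment is continuous at \<open>(s, t)\<close> although \<open>\<psi>1\<close> and \<open>\<psi>2\<close> need not be continuous at \<open>s\<close> and
  \<open>t\<close>: their values at these points multiply \<open>f2\<close> and \<open>f1\<close> and cancel in the increment, and
  everywhere else the co-state stands under an integral (\<open>hvar_tendsto\<close>).  So a negative
  increment at \<open>(s, t)\<close> would make the cost smaller for all small squares, against optimality
  (\<open>hvar_nonneg\<close>).

  To avoid treating points, edges and the interior of the rectangle separately, the interval \<open>[0, a]\<close>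
  is enlarged by \<open>[-1, 0)\<close>, a set of mass 1.  A negative coordinate of the integration
  variable \<open>\<omega>\<close> stands for a coordinate that is not integrated.  In the state equation it then takes the value
  of the current point, in the cost the value of the end point (\<open>src\<close>).  In this way
  \<open>f0\<close>, \<open>f1\<close>, \<open>f2\<close>, \<open>f12\<close> become a single kernel \<open>kern\<close>, the four parts of the cost a single integrand \<open>fcost\<close>,
  the four co-states a single function \<open>Psi\<close>, and the state equation reads
  \<open>z x = (\<integral>\<omega>. kern P (x, \<omega>) (z (src x \<omega>), U (src x \<omega>)) \<partial>plane P)\<close>.

  The right-hand side of this equation is a contraction for the weight \<open>exp (lam * (s + t))\<close>
  (\<open>volterra_contraction\<close>).  This gives existence of the perturbed state and its Lipschitz dependence on the
  perturbation.  It also gives continuity of the state at \<open>(s, t)\<close>: every closed property that the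
  iteration preserves is inherited by the solution (\<open>volterra_fixpoint\<close>, \<open>fixpoint_state_continuous\<close>).
\<close>

section \<open>Bounded Borel functions and the enlarged interval\<close>

definition bounded_borel :: "('x::topological_space \<Rightarrow> 'e::euclidean_space) \<Rightarrow> bool" where
  "bounded_borel f \<longleftrightarrow> f \<in> borel_measurable borel \<and> bounded (range f)"

lemma bounded_borelI:
  assumes "f \<in> borel_measurable borel" "\<And>x. norm (f x) \<le> C"
  shows "bounded_borel f"
  using assms unfolding bounded_borel_def bounded_iff by auto

lemma bounded_borelE:
  assumes "bounded_borel f"
  obtains C where "C \<ge> 0" "\<And>x. norm (f x) \<le> C"
proof -
  obtain C where "\<And>x. norm (f x) \<le> C"
    using assms unfolding bounded_borel_def bounded_iff by auto
  then show thesis using that[of C] norm_ge_zero[of "f undefined"] order_trans by blast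
qed

lemma bounded_borel_measurable: "bounded_borel f \<Longrightarrow> f \<in> borel_measurable borel"
  by (simp add: bounded_borel_def)

lemma integrable_bounded_borel:
  assumes "finite_measure M" "sets M = sets borel" "bounded_borel f"
  shows "integrable M f"
proof -
  obtain C where "\<And>x. norm (f x) \<le> C" using bounded_borelE assms(3) by metis
  then show ?thesis
    using assms bounded_borel_measurable[OF assms(3)]
    by (intro finite_measure.integrable_const_bound[of M f C])
       (auto simp: measurable_cong_sets[OF assms(2) refl])
qed

text \<open>
  Lebesgue measure on \<open>[0, a]\<close> together with a mass 1.  The mass is spread over \<open>[-1, 0)\<close> rather than put into
  one point, so that null sets and Fubini's theorem are those of Lebesgue measure; functions on the
  enlarged interval will be constant on its negative part.
\<close>

definition ext_lebesgue :: "real \<Rightarrow> real measure" where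
  "ext_lebesgue a = density lborel (indicator {-1..a})"

lemma sets_ext_lebesgue [simp, measurable_cong]: "sets (ext_lebesgue a) = sets borel"
  and space_ext_lebesgue [simp]: "space (ext_lebesgue a) = UNIV"
  by (simp_all add: ext_lebesgue_def)

lemma emeasure_ext_lebesgue:
  assumes "X \<in> sets borel" shows "emeasure (ext_lebesgue a) X = emeasure lborel (X \<inter> {-1..a})"
proof -
  have "emeasure (ext_lebesgue a) X = (\<integral>\<^sup>+ x. indicator {-1..a} x * indicator X x \<partial>lborel)"
    using assms unfolding ext_lebesgue_def by (intro emeasure_density) auto
  also have "\<dots> = (\<integral>\<^sup>+ x. indicator (X \<inter> {-1..a}) x \<partial>lborel)"
    by (intro nn_integral_cong) (auto simp: indicator_def)
  also have "\<dots> = emeasure lborel (X \<inter> {-1..a})"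
    using assms by (intro nn_integral_indicator) auto
  finally show ?thesis .
qed

lemma finite_measure_ext_lebesgue [simp]: "finite_measure (ext_lebesgue a)"
proof (rule finite_measureI)
  have "emeasure lborel {-1..a} \<noteq> \<infinity>"
    using emeasure_compact_finite[of "{-1..a}"] by auto
  then show "emeasure (ext_lebesgue a) (space (ext_lebesgue a)) \<noteq> \<infinity>"
    by (simp add: emeasure_ext_lebesgue)
qed

lemma AE_ext_lebesgue:
  assumes "AE x in lborel. P x" shows "AE x in ext_lebesgue a. x \<in> {-1..a} \<and> P x"
proof -
  have "AE x in lborel. 0 < (indicator {-1..a} x :: ennreal) \<longrightarrow> x \<in> {-1..a} \<and> P x"
    using assms by (rule eventually_mono) (auto simp: indicator_def)
  then show ?thesis unfolding ext_lebesgue_def by (subst AE_density) auto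
qed

definition ext_plane :: "real \<Rightarrow> real \<Rightarrow> (real \<times> real) measure" where
  "ext_plane a b = ext_lebesgue a \<Otimes>\<^sub>M ext_lebesgue b"

lemma sets_ext_plane [simp, measurable_cong]: "sets (ext_plane a b) = sets borel"
  unfolding ext_plane_def by (subst borel_prod[symmetric], rule sets_pair_measure_cong) auto

lemma space_ext_plane [simp]: "space (ext_plane a b) = UNIV"
  unfolding ext_plane_def by (simp add: space_pair_measure)

lemma finite_measure_ext_plane [simp]: "finite_measure (ext_plane a b)"
  unfolding ext_plane_def by (intro finite_measure_pair_measure) auto

lemma pair_sigma_finite_ext: "pair_sigma_finite (ext_lebesgue a) (ext_lebesgue b)"
  unfolding pair_sigma_finite_def by (simp add: finite_measure.axioms(1))

lemma integral_ext_plane: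
  fixes f :: "real \<times> real \<Rightarrow> 'e::euclidean_space"
  assumes "bounded_borel f"
  shows "(\<integral>p. f p \<partial>ext_plane a b) = (\<integral>\<sigma>. (\<integral>\<tau>. f (\<sigma>, \<tau>) \<partial>ext_lebesgue b) \<partial>ext_lebesgue a)"
proof -
  have "integrable (ext_lebesgue a \<Otimes>\<^sub>M ext_lebesgue b) f"
    using integrable_bounded_borel[OF finite_measure_ext_plane sets_ext_plane assms]
    by (simp add: ext_plane_def)
  from pair_sigma_finite.integral_fst'[OF pair_sigma_finite_ext this] show ?thesis
    by (simp add: ext_plane_def)
qed

lemma integral_ext_plane':
  fixes f :: "real \<times> real \<Rightarrow> 'e::euclidean_space"
  assumes "bounded_borel f"
  shows "(\<integral>p. f p \<partial>ext_plane a b) = (\<integral>\<tau>. (\<integral>\<sigma>. f (\<sigma>, \<tau>) \<partial>ext_lebesgue a) \<partial>ext_lebesgue b)"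
proof -
  have "integrable (ext_lebesgue a \<Otimes>\<^sub>M ext_lebesgue b) (\<lambda>(x, y). f (x, y))"
    using integrable_bounded_borel[OF finite_measure_ext_plane sets_ext_plane assms]
    by (simp add: ext_plane_def)
  from pair_sigma_finite.integral_snd[OF pair_sigma_finite_ext this] show ?thesis
    by (simp add: ext_plane_def)
qed

lemma AE_ext_planeI:
  assumes [measurable]: "Measurable.pred borel P" "Measurable.pred borel Q"
    and "AE x in lborel. P x" "AE x in lborel. Q x"
  shows "AE p in ext_plane a b. p \<in> {-1..a} \<times> {-1..b} \<and> P (fst p) \<and> Q (snd p)"
proof -
  interpret pair_sigma_finite "ext_lebesgue a" "ext_lebesgue b" by (rule pair_sigma_finite_ext)
  have y: "AE y in ext_lebesgue b. y \<in> {-1..b} \<and> Q y" by (rule AE_ext_lebesgue[OF assms(4)])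
  have "AE x in ext_lebesgue a. AE y in ext_lebesgue b. (x \<in> {-1..a} \<and> P x) \<and> (y \<in> {-1..b} \<and> Q y)"
    using AE_ext_lebesgue[OF assms(3), of a]
  proof (rule eventually_mono)
    fix x assume x: "x \<in> {-1..a} \<and> P x"
    show "AE y in ext_lebesgue b. (x \<in> {-1..a} \<and> P x) \<and> (y \<in> {-1..b} \<and> Q y)"
      using y by (rule eventually_mono) (use x in blast)
  qed
  then have "AE p in ext_lebesgue a \<Otimes>\<^sub>M ext_lebesgue b.
      (fst p \<in> {-1..a} \<and> P (fst p)) \<and> (snd p \<in> {-1..b} \<and> Q (snd p))"
    by (intro AE_pair_measure, unfold fst_conv snd_conv) measurable
  then show ?thesis unfolding ext_plane_def by (rule eventually_mono) auto
qed

lemma set_integrable_bounded_borel: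
  fixes f :: "real \<Rightarrow> 'e::euclidean_space"
  assumes "bounded_borel f" "X \<subseteq> {l..u}" "X \<in> sets borel"
  shows "set_integrable lborel X f"
proof -
  obtain C where C: "\<And>x. norm (f x) \<le> C" "C \<ge> 0" using bounded_borelE assms(1) by metis
  have [measurable]: "f \<in> borel_measurable borel" "X \<in> sets borel"
    using bounded_borel_measurable[OF assms(1)] assms(3) by auto
  have "emeasure lborel {l..u} < \<infinity>"
    using emeasure_compact_finite[of "{l..u}"] by auto
  then show ?thesis unfolding set_integrable_def
    using assms(2) C
    by (intro integrableI_bounded_set[where A="{l..u}" and B=C])
       (auto simp: indicator_def intro!: AE_I2)
qed

lemma integral_ext_lebesgue:
  fixes f :: "real \<Rightarrow> 'e::euclidean_space"
  assumes f: "bounded_borel f" and c: "\<And>\<sigma>. \<sigma> < 0 \<Longrightarrow> f \<sigma> = f (-1)" and a: "0 \<le> a"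
  shows "(\<integral>\<sigma>. f \<sigma> \<partial>ext_lebesgue a) = f (-1) + (LBINT \<sigma>:{0..a}. f \<sigma>)"
proof -
  have [measurable]: "f \<in> borel_measurable borel" using f by (rule bounded_borel_measurable)
  have si: "set_integrable lborel X f" if "X \<subseteq> {-1..a}" "X \<in> sets borel" for X
    by (rule set_integrable_bounded_borel[OF f that])
  have "(\<integral>\<sigma>. f \<sigma> \<partial>ext_lebesgue a) = (\<integral>\<sigma>. indicator {-1..a} \<sigma> *\<^sub>R f \<sigma> \<partial>lborel)"
  proof -
    have "ext_lebesgue a = density lborel (\<lambda>x. ennreal (indicator {-1..a} x))"
      by (simp add: ext_lebesgue_def ennreal_indicator)
    then show ?thesis by (simp add: integral_density)
  qed
  also have "\<dots> = (LBINT \<sigma>:{-1..<0} \<union> {0..a}. f \<sigma>)"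
  proof -
    have "{-1..a} = {-1..<0} \<union> {0..a}" using a by auto
    then show ?thesis by (simp add: set_lebesgue_integral_def)
  qed
  also have "\<dots> = (LBINT \<sigma>:{-1..<0}. f \<sigma>) + (LBINT \<sigma>:{0..a}. f \<sigma>)"
  proof (rule set_integral_Un)
    show "set_integrable lborel {-1..<0} f" using a by (intro si) auto
    show "set_integrable lborel {0..a} f" by (intro si) auto
  qed auto
  also have "(LBINT \<sigma>:{-1..<0}. f \<sigma>) = (LBINT \<sigma>:{-1..<(0::real)}. f (-1))"
    unfolding set_lebesgue_integral_def
  proof (rule Bochner_Integration.integral_cong[OF refl])
    show "indicator {-1..<0} \<sigma> *\<^sub>R f \<sigma> = indicator {-1..<0} \<sigma> *\<^sub>R f (-1)" for \<sigma>
      by (cases "\<sigma> < 0") (use c[of \<sigma>] in \<open>simp only:\<close>, simp add: indicator_def)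
  qed
  also have "\<dots> = f (-1)"
    by (simp add: set_lebesgue_integral_def)
  finally show ?thesis .
qed

lemma set_integral_shrink:
  assumes "\<And>x. x \<in> Y \<Longrightarrow> x \<in> X \<and> f x = g x" "\<And>x. x \<in> X - Y \<Longrightarrow> f x = 0"
  shows "(LINT x:X|M. f x) = (LINT x:Y|M. g x)"
  unfolding set_lebesgue_integral_def
  using assms by (intro Bochner_Integration.integral_cong refl) (auto simp: indicator_def)

lemma bounded_borel_compose:
  assumes "bounded_borel f" "g \<in> borel_measurable borel"
  shows "bounded_borel (\<lambda>x. f (g x))"
proof -
  obtain C where C: "\<And>x. norm (f x) \<le> C" using bounded_borelE assms(1) by metis
  show ?thesis
    by (rule bounded_borelI[where C=C])
       (rule measurable_compose[OF assms(2) bounded_borel_measurable[OF assms(1)]], rule C)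
qed

lemma bounded_borel_section1: "bounded_borel f \<Longrightarrow> bounded_borel (\<lambda>\<sigma>. f (\<sigma>, \<tau>))"
  and bounded_borel_section2: "bounded_borel f \<Longrightarrow> bounded_borel (\<lambda>\<tau>. f (\<sigma>, \<tau>))"
  for f :: "'x::euclidean_space \<times> 'z::euclidean_space \<Rightarrow> 'e::euclidean_space"
  by (erule bounded_borel_compose, intro borel_measurable_continuous_onI continuous_intros)+

lemma norm_integral_le_const:
  fixes f :: "'x \<Rightarrow> 'e::euclidean_space"
  assumes "finite_measure M" "\<And>x. x \<in> space M \<Longrightarrow> norm (f x) \<le> C" "0 \<le> C"
  shows "norm (integral\<^sup>L M f) \<le> C * measure M (space M)"
proof (cases "integrable M f")
  case True
  show ?thesis
  proof -
    interpret finite_measure M by fact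
    have "norm (integral\<^sup>L M f) \<le> (\<integral>x. norm (f x) \<partial>M)" by (rule integral_norm_bound)
    also have "\<dots> \<le> (\<integral>x. C \<partial>M)" using True assms(2) by (intro integral_mono) auto
    also have "\<dots> = C * measure M (space M)" by (simp add: mult.commute)
    finally show ?thesis .
  qed
qed (use assms in \<open>auto simp: not_integrable_integral_eq\<close>)

lemma bounded_borel_integral:
  fixes f :: "'x::euclidean_space \<times> 'z::euclidean_space \<Rightarrow> 'e::euclidean_space"
  assumes f: "bounded_borel f" and M: "finite_measure M" "sets M = sets borel"
  shows "bounded_borel (\<lambda>x. \<integral>\<omega>. f (x, \<omega>) \<partial>M)"
proof -
  obtain C where C: "\<And>x. norm (f x) \<le> C" "C \<ge> 0" using bounded_borelE f by metis
  interpret finite_measure M by fact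
  have "sets (borel \<Otimes>\<^sub>M M) = sets (borel :: ('x \<times> 'z) measure)"
    by (subst borel_prod[symmetric], rule sets_pair_measure_cong) (auto simp: M)
  from measurable_cong_sets[OF this refl] have "f \<in> borel_measurable (borel \<Otimes>\<^sub>M M)"
    using bounded_borel_measurable[OF f] by blast
  then have "(\<lambda>x. \<integral>\<omega>. f (x, \<omega>) \<partial>M) \<in> borel_measurable borel"
    by (intro borel_measurable_lebesgue_integral) simp
  then show ?thesis
    using norm_integral_le_const[OF M(1) C(1) C(2)] by (rule bounded_borelI)
qed

text \<open>
  The four terms are the shape of the state equation, the cost and the Hamiltonian: a value, two line
  integrals and a double integral.  It is through this lemma that they become integrals over the
  enlarged rectangle.
\<close>

lemma integral_ext_plane_split:
  fixes f :: "real \<times> real \<Rightarrow> 'e::euclidean_space"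
  assumes f: "bounded_borel f" and a: "0 \<le> a" and b: "0 \<le> b"
    and 1: "\<And>\<sigma> \<tau>. \<sigma> < 0 \<Longrightarrow> f (\<sigma>, \<tau>) = f (-1, \<tau>)"
    and 2: "\<And>\<sigma> \<tau>. \<tau> < 0 \<Longrightarrow> f (\<sigma>, \<tau>) = f (\<sigma>, -1)"
  shows "(\<integral>p. f p \<partial>ext_plane a b) =
     f (-1, -1) + (LBINT \<sigma>:{0..a}. f (\<sigma>, -1)) + (LBINT \<tau>:{0..b}. f (-1, \<tau>))
     + (LBINT \<sigma>:{0..a}. LBINT \<tau>:{0..b}. f (\<sigma>, \<tau>))"
proof -
  let ?g = "\<lambda>\<sigma>. \<integral>\<tau>. f (\<sigma>, \<tau>) \<partial>ext_lebesgue b"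
  have g: "bounded_borel ?g" by (rule bounded_borel_integral[OF f]) auto
  have geq: "?g \<sigma> = f (\<sigma>, -1) + (LBINT \<tau>:{0..b}. f (\<sigma>, \<tau>))" for \<sigma>
    by (rule integral_ext_lebesgue[OF bounded_borel_section2[OF f] _ b]) (rule 2)
  have s1: "bounded_borel (\<lambda>\<sigma>. f (\<sigma>, -1))" by (rule bounded_borel_section1[OF f])
  have si: "set_integrable lborel {0..a} h" if "bounded_borel h" for h :: "real \<Rightarrow> 'e"
    by (rule set_integrable_bounded_borel[OF that]) auto
  have "(\<integral>p. f p \<partial>ext_plane a b) = (\<integral>\<sigma>. ?g \<sigma> \<partial>ext_lebesgue a)" by (rule integral_ext_plane[OF f])
  also have "\<dots> = ?g (-1) + (LBINT \<sigma>:{0..a}. ?g \<sigma>)"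
    by (rule integral_ext_lebesgue[OF g _ a], rule Bochner_Integration.integral_cong[OF refl])
       (rule 1)
  also have "(LBINT \<sigma>:{0..a}. ?g \<sigma>) = (LBINT \<sigma>:{0..a}. f (\<sigma>, -1)) + (LBINT \<sigma>:{0..a}. ?g \<sigma> - f (\<sigma>, -1))"
    by (subst set_integral_diff(2)[OF si[OF g] si[OF s1]]) simp
  finally show ?thesis by (simp add: geq add_ac)
qed

section \<open>Contractions in a weighted supremum norm\<close>

text \<open>
  The set \<open>S\<close> is a parameter so that a fixed point can be found inside any class that \<open>T\<close> preserves and that is
  closed under uniform limits: below, the bounded Borel functions, and those among them with a
  continuity property.
\<close>

lemma weighted_contraction_fixpoint:
  fixes T :: "('x \<Rightarrow> 'e::banach) \<Rightarrow> 'x \<Rightarrow> 'e"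
  assumes q: "0 \<le> q" "q < 1" and w: "\<And>x. 1 \<le> w x" "\<And>x. w x \<le> W"
    and S: "g0 \<in> S" "\<And>f. f \<in> S \<Longrightarrow> T f \<in> S" "\<And>f. f \<in> S \<Longrightarrow> bounded (range f)"
    and lim: "\<And>F f. (\<And>n. F n \<in> S) \<Longrightarrow> uniform_limit UNIV F f sequentially \<Longrightarrow> f \<in> S"
    and contr: "\<And>f g c x. f \<in> S \<Longrightarrow> g \<in> S \<Longrightarrow> 0 \<le> c \<Longrightarrow> (\<And>x. norm (f x - g x) \<le> c * w x)
       \<Longrightarrow> norm (T f x - T g x) \<le> q * c * w x"
  obtains z where "z \<in> S" "T z = z"
proof -
  define F where "F n = (T ^^ n) g0" for n
  have F0: "F 0 = g0" and FS: "F (Suc n) = T (F n)" for n by (auto simp: F_def)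
  have FinS: "F n \<in> S" for n by (induction n) (auto simp: F0 FS S)
  obtain b0 b1 where b: "\<And>x. norm (F 0 x) \<le> b0" "\<And>x. norm (F 1 x) \<le> b1"
    using S(3)[OF FinS[of 0]] S(3)[OF FinS[of 1]] unfolding bounded_iff by auto
  define c where "c = b0 + b1"
  have c0: "0 \<le> c" using b(1)[of undefined] b(2)[of undefined] norm_ge_zero
    unfolding c_def by (meson add_nonneg_nonneg order_trans)
  have step: "norm (F (Suc n) x - F n x) \<le> q ^ n * c * w x" for n x
  proof (induction n arbitrary: x)
    case 0
    have "norm (F (Suc 0) x - F 0 x) \<le> c"
      using norm_triangle_ineq4[of "F 1 x" "F 0 x"] b(1)[of x] b(2)[of x] by (simp add: c_def)
    also have "\<dots> \<le> c * w x" using mult_left_mono[OF w(1)[of x] c0] by simp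
    finally show ?case by simp
  next
    case (Suc n)
    have "norm (T (F (Suc n)) x - T (F n) x) \<le> q * (q ^ n * c) * w x"
      by (rule contr) (use FinS Suc q c0 in auto)
    then show ?case by (simp add: FS mult_ac)
  qed
  have "uniform_limit UNIV (\<lambda>n x. \<Sum>i<n. F (Suc i) x - F i x) (\<lambda>x. suminf (\<lambda>i. F (Suc i) x - F i x)) sequentially"
  proof (rule Weierstrass_m_test)
    show "norm (F (Suc n) x - F n x) \<le> q ^ n * (c * W)" for n x
    proof -
      have "q ^ n * c * w x \<le> q ^ n * c * W" using w(2)[of x] q c0 by (intro mult_left_mono) auto
      then show ?thesis using step[of n x] by (simp add: mult_ac)
    qed
    show "summable (\<lambda>n. q ^ n * (c * W))" using q by (intro summable_mult2 summable_geometric) auto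
  qed
  then have "uniform_limit UNIV (\<lambda>n x. F 0 x + (\<Sum>i<n. F (Suc i) x - F i x))
     (\<lambda>x. F 0 x + suminf (\<lambda>i. F (Suc i) x - F i x)) sequentially"
    by (intro uniform_limit_intros)
  moreover have "F 0 x + (\<Sum>i<n. F (Suc i) x - F i x) = F n x" for n x
    by (subst sum_lessThan_telescope) simp
  ultimately obtain z where z: "uniform_limit UNIV F z sequentially" by auto
  have zS: "z \<in> S" by (rule lim[OF FinS z])
  have "T z x = z x" for x
  proof -
    have "norm (T z x - z x) \<le> e" if "e > 0" for e
    proof -
      have W: "1 \<le> W" using w order_trans by blast
      define d where "d = e / (2 * W)"
      have d: "d > 0" using that W by (simp add: d_def)
      from z[unfolded uniform_limit_iff, rule_format, OF d] obtain N where
        N: "\<And>n x. n \<ge> N \<Longrightarrow> dist (F n x) (z x) < d"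
        by (auto simp: eventually_sequentially)
      have "norm (T z x - T (F N) x) \<le> q * d * w x"
      proof (rule contr)
        fix x
        have "norm (z x - F N x) \<le> d" using N[of N x] by (simp add: dist_norm norm_minus_commute)
        also have "\<dots> \<le> d * w x" using mult_left_mono[OF w(1)[of x]] d by simp
        finally show "norm (z x - F N x) \<le> d * w x" .
      qed (use zS FinS d in auto)
      also have "\<dots> \<le> 1 * d * W" using q d w(1)[of x] w(2)[of x] by (intro mult_mono) auto
      finally have "norm (T z x - F (Suc N) x) \<le> d * W" by (simp add: FS)
      moreover have "norm (F (Suc N) x - z x) \<le> d" using N[of "Suc N" x] by (simp add: dist_norm)
      moreover have "d \<le> d * W" using d W by simp
      moreover have "d * W = e / 2" using W by (simp add: d_def)
      ultimately show ?thesis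
        using norm_triangle_ineq[of "T z x - F (Suc N) x" "F (Suc N) x - z x"] by simp
    qed
    then have "norm (T z x - z x) \<le> 0" by (rule field_le_epsilon) simp
    then show ?thesis by simp
  qed
  then show thesis using that zS by blast
qed

lemma weighted_contraction_stability:
  fixes T :: "('x \<Rightarrow> 'e::real_normed_vector) \<Rightarrow> 'x \<Rightarrow> 'e"
  assumes q: "0 \<le> q" "q < 1" and w: "\<And>x. 1 \<le> w x" and c: "0 \<le> c"
    and bdd: "bounded (range f)" "bounded (range g)"
    and contr: "\<And>c x. 0 \<le> c \<Longrightarrow> (\<And>x. norm (f x - g x) \<le> c * w x)
       \<Longrightarrow> norm (T f x - T g x) \<le> q * c * w x"
    and f: "T f = f" and g: "\<And>x. norm (T g x - g x) \<le> c"
  shows "norm (f x - g x) \<le> c / (1 - q) * w x"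
proof -
  have wp: "w x > 0" for x using w[of x] by simp
  define r where "r x = norm (f x - g x) / w x" for x
  obtain b where b: "\<And>x. norm (f x) \<le> b" using bdd(1) unfolding bounded_iff by auto
  obtain b' where b': "\<And>x. norm (g x) \<le> b'" using bdd(2) unfolding bounded_iff by auto
  have "r x \<le> b + b'" for x
  proof -
    have "r x \<le> norm (f x - g x) / 1" unfolding r_def using w[of x] by (intro divide_left_mono) auto
    then show ?thesis using norm_triangle_ineq4[of "f x" "g x"] b[of x] b'[of x] by simp
  qed
  then have bdd: "bdd_above (range r)" by (auto intro!: bdd_aboveI)
  define K where "K = (SUP x. r x)"
  have rK: "r x \<le> K" for x unfolding K_def by (rule cSUP_upper[OF _ bdd]) simp
  have K0: "0 \<le> K" using rK[of undefined] wp[of undefined] unfolding r_def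
    by (meson divide_nonneg_pos norm_ge_zero order_trans)
  have le: "norm (f x - g x) \<le> K * w x" for x
    using rK[of x] wp[of x] by (simp add: r_def field_simps)
  have "r x \<le> q * K + c" for x
  proof -
    have "norm (f x - g x) \<le> norm (T f x - T g x) + norm (T g x - g x)"
      using norm_triangle_ineq[of "T f x - T g x" "T g x - g x"] by (simp add: f)
    also have "\<dots> \<le> q * K * w x + c" by (intro add_mono contr K0 le g)
    also have "\<dots> \<le> q * K * w x + c * w x" using mult_left_mono[OF w[of x] c] by simp
    finally show ?thesis using wp[of x] by (simp add: r_def field_simps)
  qed
  then have "K \<le> q * K + c" unfolding K_def by (intro cSUP_least) auto
  then have "K \<le> c / (1 - q)" using q by (simp add: field_simps)
  then have "K * w x \<le> c / (1 - q) * w x" using wp[of x] by (intro mult_right_mono) auto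
  then show ?thesis using le[of x] by simp
qed

section \<open>Families that are continuously differentiable in the state\<close>

text \<open>
  The derivative as a function of its direction, which serves the Jacobian \<open>jac_y\<close> of vector-valued
  and the gradient \<open>grad_y\<close> of real-valued functions at once.
\<close>

definition state_deriv :: "((real^'n::finite) \<times> 'u \<Rightarrow> 'w::euclidean_space) \<Rightarrow> (real^'n) \<times> 'u \<Rightarrow> real^'n \<Rightarrow> 'w" where
  "state_deriv g v = frechet_derivative (\<lambda>\<eta>. g (\<eta>, snd v)) (at (fst v))"

text \<open>
  What the variational argument needs of the data, in a form that survives case distinctions on the
  index.  Continuity in the index is lost when kernels are extended by zero outside their domain, so
  only Borel measurability is asked for; in exchange the bounds and the first-order remainder are
  uniform in the index and in the control, which is what compactness of domains and control sets provides.
\<close>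

definition C1_family ::
  "('i::euclidean_space \<Rightarrow> (real^'n::finite) \<times> 'u::euclidean_space \<Rightarrow> 'w::euclidean_space) \<Rightarrow> bool" where
  "C1_family \<Phi> \<longleftrightarrow>
     (\<lambda>(i, v). \<Phi> i v) \<in> borel_measurable borel \<and>
     (\<lambda>(i, v, h). state_deriv (\<Phi> i) v h) \<in> borel_measurable borel \<and>
     (\<forall>i v. linear (state_deriv (\<Phi> i) v)) \<and>
     (\<forall>R. \<exists>C\<ge>0. \<forall>i v. norm (fst v) \<le> R \<longrightarrow>
        norm (\<Phi> i v) \<le> C \<and> (\<forall>h. norm (state_deriv (\<Phi> i) v h) \<le> C * norm h)) \<and>
     (\<forall>R. \<forall>e>0. \<exists>d>0. \<forall>i v h. norm (fst v) \<le> R \<longrightarrow> norm h \<le> d \<longrightarrow>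
        norm (\<Phi> i (fst v + h, snd v) - \<Phi> i v - state_deriv (\<Phi> i) v h) \<le> e * norm h)"

lemma C1_family_measurable: "C1_family \<Phi> \<Longrightarrow> (\<lambda>(i, v). \<Phi> i v) \<in> borel_measurable borel"
  and C1_family_deriv_measurable:
    "C1_family \<Phi> \<Longrightarrow> (\<lambda>(i, v, h). state_deriv (\<Phi> i) v h) \<in> borel_measurable borel"
  and C1_family_linear: "C1_family \<Phi> \<Longrightarrow> linear (state_deriv (\<Phi> i) v)"
  unfolding C1_family_def by blast+

lemma C1_family_bounded:
  assumes "C1_family \<Phi>"
  obtains C where "C \<ge> 0" "\<And>i v. norm (fst v) \<le> R \<Longrightarrow> norm (\<Phi> i v) \<le> C"
    "\<And>i v h. norm (fst v) \<le> R \<Longrightarrow> norm (state_deriv (\<Phi> i) v h) \<le> C * norm h"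
  using assms unfolding C1_family_def by meson

lemma C1_family_remainder:
  assumes "C1_family \<Phi>" "e > 0"
  obtains d where "d > 0" "\<And>i v h. norm (fst v) \<le> R \<Longrightarrow> norm h \<le> d \<Longrightarrow>
        norm (\<Phi> i (fst v + h, snd v) - \<Phi> i v - state_deriv (\<Phi> i) v h) \<le> e * norm h"
  using assms unfolding C1_family_def by meson

lemma state_deriv_zero [simp]: "state_deriv (\<lambda>v. 0) v = (\<lambda>h. 0)"
  unfolding state_deriv_def by (simp add: frechet_derivative_const)

lemma state_deriv_eqI:
  assumes "\<And>\<eta>. g (\<eta>, snd v) = g' (\<eta>, snd v)"
  shows "state_deriv g v = state_deriv g' v"
  using assms by (simp add: state_deriv_def)

text \<open>
  Derivatives within \<open>UNIV \<times> U\<close> need not be unique in the control directions, but the state ranges over a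
  whole space, so the partial derivative in the state is an ordinary one.
\<close>

lemma C1_in_state_derivative:
  fixes g :: "'i::topological_space \<Rightarrow> (real^'n::finite) \<times> 'u::euclidean_space \<Rightarrow> 'w::euclidean_space"
  assumes "\<And>v. v \<in> UNIV \<times> U \<Longrightarrow> (g i has_derivative blinfun_apply (D v)) (at v within UNIV \<times> U)"
    and "u \<in> U"
  shows "((\<lambda>\<eta>. g i (\<eta>, u)) has_derivative (\<lambda>h. D (\<eta>, u) (h, 0))) (at \<eta>)"
proof -
  have "(g i has_derivative blinfun_apply (D (\<eta>, u))) (at (\<eta>, u) within range (\<lambda>\<eta>. (\<eta>, u)))"
    using assms by (intro has_derivative_subset[OF assms(1)]) auto
  moreover have "((\<lambda>\<eta>. (\<eta>, u)) has_derivative (\<lambda>h. (h, 0))) (at \<eta>)"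
    by (auto intro!: derivative_eq_intros)
  ultimately show ?thesis by (rule has_derivative_in_compose[rotated])
qed

text \<open>
  The uniform remainder comes from the mean value inequality along the segment from \<open>\<eta>\<close> to \<open>\<eta> + h\<close>
  and from the uniform continuity of the derivative on a compact set; the ball of radius \<open>R + 1\<close> leaves
  room for that segment.
\<close>

lemma C1_family_restrict:
  fixes g :: "'i::euclidean_space \<Rightarrow> (real^'n::finite) \<times> 'u::euclidean_space \<Rightarrow> 'w::euclidean_space"
  assumes g: "C1_in T (UNIV \<times> U) g" and T: "compact T" and U: "compact U"
  shows "C1_family (\<lambda>i v. if i \<in> T \<and> snd v \<in> U then g i v else 0)" (is "C1_family ?\<Phi>")
proof -
  from g obtain D :: "'i \<Rightarrow> (real^'n) \<times> 'u \<Rightarrow> ((real^'n) \<times> 'u) \<Rightarrow>\<^sub>L 'w" where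
    gc: "continuous_on (T \<times> (UNIV \<times> U)) (\<lambda>(p, v). g p v)"
    and Dc: "continuous_on (T \<times> (UNIV \<times> U)) (\<lambda>(p, v). D p v)"
    and D: "\<And>p v. p \<in> T \<Longrightarrow> v \<in> UNIV \<times> U \<Longrightarrow>
        (g p has_derivative blinfun_apply (D p v)) (at v within UNIV \<times> U)"
    unfolding C1_in_def by blast
  have der: "((\<lambda>\<eta>. g p (\<eta>, u)) has_derivative (\<lambda>h. D p (\<eta>, u) (h, 0))) (at \<eta>)"
    if "p \<in> T" "u \<in> U" for p u \<eta>
    using C1_in_state_derivative[of U g p "D p", OF D] that by blast
  have sd: "state_deriv (?\<Phi> i) v = (if i \<in> T \<and> snd v \<in> U then (\<lambda>h. D i v (h, 0)) else (\<lambda>h. 0))" for i v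
  proof (cases "i \<in> T \<and> snd v \<in> U")
    case True
    then show ?thesis
      using frechet_derivative_at[OF der[of i "snd v" "fst v"]] by (simp add: state_deriv_def)
  next
    case False
    then have "state_deriv (?\<Phi> i) v = state_deriv (\<lambda>v. 0) v" by (intro state_deriv_eqI) auto
    then show ?thesis using False by auto
  qed
  have cT: "closed T" and cU: "closed U" using T U compact_imp_closed by auto
  have 1: "(\<lambda>(i, v). ?\<Phi> i v) \<in> borel_measurable borel"
  proof -
    have "(\<lambda>x. if x \<in> T \<times> (UNIV \<times> U) then (case x of (i, v) \<Rightarrow> g i v) else 0) \<in> borel_measurable borel"
      by (intro borel_measurable_continuous_on_if gc continuous_on_const borel_closed closed_Times cT cU) auto
    also have "(\<lambda>x. if x \<in> T \<times> (UNIV \<times> U) then (case x of (i, v) \<Rightarrow> g i v) else 0) = (\<lambda>(i, v). ?\<Phi> i v)"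
      by (auto simp: fun_eq_iff)
    finally show ?thesis .
  qed
  have 2: "(\<lambda>(i, v, h). state_deriv (?\<Phi> i) v h) \<in> borel_measurable borel"
  proof -
    let ?X = "T \<times> (UNIV \<times> U) \<times> (UNIV :: (real^'n) set)"
    have "continuous_on ?X (\<lambda>x. (\<lambda>(p, v). D p v) (fst x, fst (snd x)) (snd (snd x), 0))"
      by (intro continuous_intros continuous_on_compose2[OF Dc]) auto
    then have "(\<lambda>x. if x \<in> ?X then (\<lambda>(p, v). D p v) (fst x, fst (snd x)) (snd (snd x), 0) else 0) \<in> borel_measurable borel"
      by (intro borel_measurable_continuous_on_if continuous_on_const borel_closed closed_Times cT cU) auto
    also have "(\<lambda>x. if x \<in> ?X then (\<lambda>(p, v). D p v) (fst x, fst (snd x)) (snd (snd x), 0) else 0) = (\<lambda>(i, v, h). state_deriv (?\<Phi> i) v h)"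
      by (auto simp: fun_eq_iff sd)
    finally show ?thesis .
  qed
  have 3: "linear (state_deriv (?\<Phi> i) v)" for i v
    by (auto simp: sd linear_iff blinfun.bilinear_simps simp flip: blinfun.add_right blinfun.scaleR_right)
  have comp: "compact (T \<times> (cball (0::real^'n) R \<times> U))" for R :: real
    by (intro compact_Times T U compact_cball)
  have 4: "\<exists>C\<ge>0. \<forall>i v. norm (fst v) \<le> R \<longrightarrow>
        norm (?\<Phi> i v) \<le> C \<and> (\<forall>h. norm (state_deriv (?\<Phi> i) v h) \<le> C * norm h)" for R
  proof -
    let ?K = "T \<times> (cball (0::real^'n) R \<times> U)"
    have "compact ((\<lambda>(p, v). g p v) ` ?K)" "compact ((\<lambda>(p, v). D p v) ` ?K)"
      by (intro compact_continuous_image[OF _ comp] continuous_on_subset[OF gc] continuous_on_subset[OF Dc]; auto)+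
    then obtain C1 C2 where C1: "\<And>p v. (p, v) \<in> ?K \<Longrightarrow> norm (g p v) \<le> C1"
       and C2: "\<And>p v. (p, v) \<in> ?K \<Longrightarrow> norm (D p v) \<le> C2"
      by (force dest!: compact_imp_bounded simp: bounded_iff)
    define C where "C = max 0 (max C1 C2)"
    have "norm (?\<Phi> i v) \<le> C \<and> (\<forall>h. norm (state_deriv (?\<Phi> i) v h) \<le> C * norm h)"
      if v: "norm (fst v) \<le> R" for i v
    proof (cases "i \<in> T \<and> snd v \<in> U")
      case True
      then have K: "(i, v) \<in> ?K" using v by (auto simp: mem_Times_iff)
      have "norm (D i v (h, 0)) \<le> C * norm h" for h
      proof -
        have "norm (D i v (h, 0)) \<le> norm (D i v) * norm h"
          using norm_blinfun[of "D i v" "(h, 0)"] by (simp add: norm_Pair)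
        also have "\<dots> \<le> C * norm h" using C2[OF K] by (intro mult_right_mono) (auto simp: C_def)
        finally show ?thesis .
      qed
      then show ?thesis unfolding sd using True C1[OF K] by (auto simp: C_def)
    qed (auto simp: sd C_def)
    then show ?thesis by (intro exI[of _ C]) (auto simp: C_def)
  qed
  have 5: "\<exists>d>0. \<forall>i v h. norm (fst v) \<le> R \<longrightarrow> norm h \<le> d \<longrightarrow>
        norm (?\<Phi> i (fst v + h, snd v) - ?\<Phi> i v - state_deriv (?\<Phi> i) v h) \<le> e * norm h"
    if e: "e > 0" for R e :: real
  proof -
    let ?K = "T \<times> (cball (0::real^'n) (R + 1) \<times> U)"
    have "uniformly_continuous_on ?K (\<lambda>(p, v). D p v)"
      by (intro compact_uniformly_continuous[OF continuous_on_subset[OF Dc]] comp) auto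
    then obtain d where d: "d > 0" and ud: "\<And>x x'. x \<in> ?K \<Longrightarrow> x' \<in> ?K \<Longrightarrow> dist x' x < d \<Longrightarrow>
        dist ((\<lambda>(p, v). D p v) x') ((\<lambda>(p, v). D p v) x) < e"
      using e unfolding uniformly_continuous_on_def by meson
    define d' where "d' = min (d / 2) 1"
    have d': "0 < d'" "d' < d" "d' \<le> 1" using d by (auto simp: d'_def)
    have "norm (?\<Phi> i (fst v + h, snd v) - ?\<Phi> i v - state_deriv (?\<Phi> i) v h) \<le> e * norm h"
      if v: "norm (fst v) \<le> R" and h: "norm h \<le> d'" for i v h
    proof (cases "i \<in> T \<and> snd v \<in> U")
      case True
      obtain \<eta> u where vv: "v = (\<eta>, u)" by (cases v)
      let ?f = "\<lambda>\<eta>. g i (\<eta>, u)" and ?f' = "\<lambda>x h. D i (x, u) (h, 0)"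
      have "norm (?f (\<eta> + h) - ?f \<eta> - ?f' \<eta> (\<eta> + h - \<eta>)) \<le> norm (\<eta> + h - \<eta>) * e"
      proof (rule differentiable_bound_linearization[where S="cball \<eta> d'" and f'="?f'"])
        show "\<eta> + t *\<^sub>R (\<eta> + h - \<eta>) \<in> cball \<eta> d'" if "t \<in> {0..1}" for t
          using that h mult_left_le_one_le[of "norm h" t] by (simp add: dist_norm)
        show "(?f has_derivative ?f' x) (at x within cball \<eta> d')" if "x \<in> cball \<eta> d'" for x
          using der[of i u x] True vv by (auto intro: has_derivative_at_withinI)
        show "onorm (?f' x - ?f' \<eta>) \<le> e" if x: "x \<in> cball \<eta> d'" for x
        proof -
          have "norm x \<le> R + 1"
            using x v vv d' norm_triangle_ineq[of "x - \<eta>" \<eta>] by (simp add: dist_norm norm_minus_commute)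
          then have "dist (D i (x, u)) (D i (\<eta>, u)) < e"
            using ud[of "(i, \<eta>, u)" "(i, x, u)"] x d' True v vv
            by (auto simp: dist_Pair_Pair dist_commute)
          then have ne: "norm (D i (x, u) - D i (\<eta>, u)) \<le> e" by (simp add: dist_norm)
          show "onorm (?f' x - ?f' \<eta>) \<le> e"
            unfolding fun_diff_def
          proof (rule onorm_le)
            fix k
            have "norm (?f' x k - ?f' \<eta> k) = norm ((D i (x, u) - D i (\<eta>, u)) (k, 0))"
              by (simp add: blinfun.diff_left)
            also have "\<dots> \<le> norm (D i (x, u) - D i (\<eta>, u)) * norm k"
              using norm_blinfun[of "D i (x, u) - D i (\<eta>, u)" "(k, 0)"] by (simp add: norm_Pair)
            also have "\<dots> \<le> e * norm k" using ne by (intro mult_right_mono) auto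
            finally show "norm (?f' x k - ?f' \<eta> k) \<le> e * norm k" .
          qed
        qed
      qed (use d' in auto)
      then show ?thesis unfolding sd using True by (auto simp: vv mult.commute)
    qed (use e in \<open>auto simp: sd\<close>)
    then show ?thesis using d' by blast
  qed
  show ?thesis unfolding C1_family_def using 1 2 3 4 5 by blast
qed

lemma C1_family_reindex:
  fixes \<Phi> :: "'i::euclidean_space \<Rightarrow> (real^'n::finite) \<times> 'u::euclidean_space \<Rightarrow> 'w::euclidean_space"
    and \<phi> :: "'j::euclidean_space \<Rightarrow> 'i"
  assumes \<Phi>: "C1_family \<Phi>" and \<phi>: "\<phi> \<in> borel \<rightarrow>\<^sub>M borel"
  shows "C1_family (\<lambda>j. \<Phi> (\<phi> j))"
proof -
  have m1: "(\<lambda>(i, v). \<Phi> i v) \<in> borel_measurable borel"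
    and m2: "(\<lambda>(i, v, h). state_deriv (\<Phi> i) v h) \<in> borel_measurable borel"
    using \<Phi> by (auto simp: C1_family_def)
  have "(\<lambda>x::'j \<times> (real^'n) \<times> 'u. (\<phi> (fst x), snd x)) \<in> borel \<rightarrow>\<^sub>M borel"
    by (intro borel_measurable_Pair measurable_compose[OF _ \<phi>] borel_measurable_continuous_onI continuous_intros)
  note 1 = measurable_compose[OF this m1]
  have "(\<lambda>x::'j \<times> ((real^'n) \<times> 'u) \<times> (real^'n). (\<phi> (fst x), snd x)) \<in> borel \<rightarrow>\<^sub>M borel"
    by (intro borel_measurable_Pair measurable_compose[OF _ \<phi>] borel_measurable_continuous_onI continuous_intros)
  note 2 = measurable_compose[OF this m2]
  from 1 2 \<Phi> show ?thesis unfolding C1_family_def by (simp add: case_prod_unfold) meson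
qed

lemma C1_family_if:
  fixes \<Phi> :: "'i::euclidean_space \<Rightarrow> (real^'n::finite) \<times> 'u::euclidean_space \<Rightarrow> 'w::euclidean_space"
  assumes "C1_family \<Phi>" "C1_family \<Psi>" and c: "Measurable.pred borel c"
  shows "C1_family (\<lambda>j v. if c j then \<Phi> j v else \<Psi> j v)"
proof -
  have sd: "state_deriv (\<lambda>v. if c j then \<Phi> j v else \<Psi> j v) v =
     (if c j then state_deriv (\<Phi> j) v else state_deriv (\<Psi> j) v)" for j v by simp
  have m: "(\<lambda>(i, v). \<Phi> i v) \<in> borel_measurable borel" "(\<lambda>(i, v). \<Psi> i v) \<in> borel_measurable borel"
    "(\<lambda>(i, v, h). state_deriv (\<Phi> i) v h) \<in> borel_measurable borel"
    "(\<lambda>(i, v, h). state_deriv (\<Psi> i) v h) \<in> borel_measurable borel"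
    using assms(1,2) by (auto simp: C1_family_def)
  have c1: "{x \<in> space borel. c (fst x)} \<in> sets (borel :: ('i \<times> (real^'n) \<times> 'u) measure)"
    and c2: "{x \<in> space borel. c (fst x)} \<in> sets (borel :: ('i \<times> ((real^'n) \<times> 'u) \<times> (real^'n)) measure)"
    unfolding pred_def[symmetric]
    by (rule measurable_compose[OF _ c], intro borel_measurable_continuous_onI continuous_intros)+
  have 1: "(\<lambda>(i, v). if c i then \<Phi> i v else \<Psi> i v) \<in> borel_measurable borel"
    using measurable_If[OF m(1,2) c1] by (simp add: case_prod_unfold cong: if_cong)
  have 2: "(\<lambda>(i, v, h). (if c i then state_deriv (\<Phi> i) v else state_deriv (\<Psi> i) v) h) \<in> borel_measurable borel"
    using measurable_If[OF m(3,4) c2] by (simp add: case_prod_unfold if_distribR cong: if_cong)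
  have 4: "\<exists>C\<ge>0. \<forall>i v. norm (fst v) \<le> R \<longrightarrow>
        norm (if c i then \<Phi> i v else \<Psi> i v) \<le> C \<and>
        (\<forall>h. norm ((if c i then state_deriv (\<Phi> i) v else state_deriv (\<Psi> i) v) h) \<le> C * norm h)" for R
  proof -
    obtain C1 where C1: "C1 \<ge> 0" "\<And>i v. norm (fst v) \<le> R \<Longrightarrow> norm (\<Phi> i v) \<le> C1"
      "\<And>i v h. norm (fst v) \<le> R \<Longrightarrow> norm (state_deriv (\<Phi> i) v h) \<le> C1 * norm h"
      using assms(1) unfolding C1_family_def by meson
    obtain C2 where C2: "C2 \<ge> 0" "\<And>i v. norm (fst v) \<le> R \<Longrightarrow> norm (\<Psi> i v) \<le> C2"
      "\<And>i v h. norm (fst v) \<le> R \<Longrightarrow> norm (state_deriv (\<Psi> i) v h) \<le> C2 * norm h"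
      using assms(2) unfolding C1_family_def by meson
    have "C1 * norm h \<le> max C1 C2 * norm h" "C2 * norm h \<le> max C1 C2 * norm h" for h :: "real^'n"
      by (auto intro!: mult_right_mono)
    with C1 C2 show ?thesis
      by (intro exI[of _ "max C1 C2"]) (fastforce intro: order_trans)
  qed
  have 5: "\<exists>d>0. \<forall>i v h. norm (fst v) \<le> R \<longrightarrow> norm h \<le> d \<longrightarrow>
        norm ((if c i then \<Phi> i (fst v + h, snd v) else \<Psi> i (fst v + h, snd v)) - (if c i then \<Phi> i v else \<Psi> i v)
          - (if c i then state_deriv (\<Phi> i) v else state_deriv (\<Psi> i) v) h) \<le> e * norm h"
    if e: "e > 0" for R e :: real
  proof -
    obtain d1 where d1: "d1 > 0" "\<And>i v h. norm (fst v) \<le> R \<Longrightarrow> norm h \<le> d1 \<Longrightarrow>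
        norm (\<Phi> i (fst v + h, snd v) - \<Phi> i v - state_deriv (\<Phi> i) v h) \<le> e * norm h"
      using assms(1) e unfolding C1_family_def by meson
    obtain d2 where d2: "d2 > 0" "\<And>i v h. norm (fst v) \<le> R \<Longrightarrow> norm h \<le> d2 \<Longrightarrow>
        norm (\<Psi> i (fst v + h, snd v) - \<Psi> i v - state_deriv (\<Psi> i) v h) \<le> e * norm h"
      using assms(2) e unfolding C1_family_def by meson
    show ?thesis using d1 d2 by (intro exI[of _ "min d1 d2"]) auto
  qed
  have 3: "linear (if c i then state_deriv (\<Phi> i) v else state_deriv (\<Psi> i) v)" for i v
    using C1_family_linear[OF assms(1), of i v] C1_family_linear[OF assms(2), of i v] by simp
  show ?thesis unfolding C1_family_def sd using 1 2 3 4 5 by blast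
qed

lemma C1_family_compose:
  fixes \<Phi> :: "'i::euclidean_space \<Rightarrow> (real^'n::finite) \<times> 'u::euclidean_space \<Rightarrow> 'w::euclidean_space"
    and z :: "'x::euclidean_space \<Rightarrow> real^'n" and U :: "'x \<Rightarrow> 'u"
    and \<phi> :: "'p::euclidean_space \<Rightarrow> 'i"
  assumes \<Phi>: "C1_family \<Phi>" and z: "bounded_borel z" and U: "U \<in> borel_measurable borel"
    and \<phi>: "\<phi> \<in> borel_measurable borel" and \<pi>: "\<pi> \<in> borel_measurable borel"
  shows "bounded_borel (\<lambda>p. \<Phi> (\<phi> p) (z (\<pi> p), U (\<pi> p)))"
    and "bounded_borel \<delta> \<Longrightarrow> bounded_borel (\<lambda>p. state_deriv (\<Phi> (\<phi> p)) (z (\<pi> p), U (\<pi> p)) (\<delta> (\<pi> p)))"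
proof -
  obtain R where R: "\<And>x. norm (z x) \<le> R" using bounded_borelE[OF z] by metis
  obtain C where C: "C \<ge> 0" "\<And>i v. norm (fst v) \<le> R \<Longrightarrow> norm (\<Phi> i v) \<le> C"
    "\<And>i v h. norm (fst v) \<le> R \<Longrightarrow> norm (state_deriv (\<Phi> i) v h) \<le> C * norm h"
    using C1_family_bounded[OF \<Phi>] by metis
  have z': "z \<in> borel_measurable borel" by (rule bounded_borel_measurable[OF z])
  note zp = measurable_compose[OF \<pi> z'] and Up = measurable_compose[OF \<pi> U]
  have m: "(\<lambda>p. (\<phi> p, z (\<pi> p), U (\<pi> p))) \<in> borel_measurable borel"
    by (intro borel_measurable_Pair \<phi> zp Up)
  show "bounded_borel (\<lambda>p. \<Phi> (\<phi> p) (z (\<pi> p), U (\<pi> p)))"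
    using measurable_compose[OF m C1_family_measurable[OF \<Phi>]] C(2) R
    by (intro bounded_borelI[where C=C]) auto
  assume \<delta>: "bounded_borel \<delta>"
  obtain D where D: "\<And>x. norm (\<delta> x) \<le> D" using bounded_borelE[OF \<delta>] by metis
  have m: "(\<lambda>p. (\<phi> p, (z (\<pi> p), U (\<pi> p)), \<delta> (\<pi> p))) \<in> borel_measurable borel"
    by (intro borel_measurable_Pair \<phi> zp Up measurable_compose[OF \<pi> bounded_borel_measurable[OF \<delta>]])
  have "norm (state_deriv (\<Phi> (\<phi> p)) (z (\<pi> p), U (\<pi> p)) (\<delta> (\<pi> p))) \<le> C * D" for p
    by (rule order_trans[OF C(3)]) (use R D C(1) in \<open>auto intro: mult_left_mono\<close>)
  then show "bounded_borel (\<lambda>p. state_deriv (\<Phi> (\<phi> p)) (z (\<pi> p), U (\<pi> p)) (\<delta> (\<pi> p)))"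
    using measurable_compose[OF m C1_family_deriv_measurable[OF \<Phi>]]
    by (intro bounded_borelI[where C="C * D"]) auto
qed

section \<open>One kernel for the state equation, one integrand for the cost\<close>

text \<open>
  The point at which state and controls are evaluated when the integration variable is \<open>\<omega>\<close> and the
  current point is \<open>x\<close>.
\<close>

definition src :: "real \<times> real \<Rightarrow> real \<times> real \<Rightarrow> real \<times> real" where
  "src x \<omega> = (if fst \<omega> < 0 then fst x else fst \<omega>, if snd \<omega> < 0 then snd x else snd \<omega>)"

lemma src_measurable: "(\<lambda>(x, \<omega>). src x \<omega>) \<in> borel_measurable borel"
proof -
  have [measurable]: "fst \<in> borel_measurable (borel :: (real \<times> real) measure)"
    "snd \<in> borel_measurable (borel :: (real \<times> real) measure)"
    "fst \<in> borel_measurable (borel :: ((real \<times> real) \<times> (real \<times> real)) measure)"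
    "snd \<in> borel_measurable (borel :: ((real \<times> real) \<times> (real \<times> real)) measure)"
    by (intro borel_measurable_continuous_onI continuous_intros)+
  show ?thesis unfolding src_def case_prod_unfold by (intro borel_measurable_Pair) measurable
qed

definition kern ::
  "('n::finite, 'a::euclidean_space, 'b::euclidean_space, 'c::euclidean_space) problem \<Rightarrow>
   (real \<times> real) \<times> (real \<times> real) \<Rightarrow> ('n, 'a, 'b, 'c) point \<Rightarrow> real^'n" where
  "kern P = (\<lambda>((s, t), (\<sigma>, \<tau>)) v.
     if \<sigma> < 0 then
       if \<tau> < 0 then (if (s, t) \<in> rect P \<and> snd v \<in> controls P then f0 P s t (snd v) else 0)
       else (if (s, t, \<tau>) \<in> dom2 P \<and> snd v \<in> controls P then f2 P s t \<tau> v else 0)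
     else
       if \<tau> < 0 then (if (s, t, \<sigma>) \<in> dom1 P \<and> snd v \<in> controls P then f1 P s t \<sigma> v else 0)
       else (if (s, t, \<sigma>, \<tau>) \<in> dom12 P \<and> snd v \<in> controls P then f12 P s t \<sigma> \<tau> v else 0))"

text \<open>
  The test \<open>0 \<in> {0}\<close> gives the first branch the same shape as the others, with
  the one-point index set over which the regularity of \<open>F0\<close> is stated.
\<close>

definition fcost ::
  "('n::finite, 'a::euclidean_space, 'b::euclidean_space, 'c::euclidean_space) problem \<Rightarrow>
   real \<times> real \<Rightarrow> ('n, 'a, 'b, 'c) point \<Rightarrow> real" where
  "fcost P = (\<lambda>(\<sigma>, \<tau>) v.
     if \<sigma> < 0 then
       if \<tau> < 0 then (if (0::real) \<in> {0} \<and> snd v \<in> controls P then F0 P v else 0)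
       else (if \<tau> \<in> {0..endB P} \<and> snd v \<in> controls P then F2 P \<tau> v else 0)
     else
       if \<tau> < 0 then (if \<sigma> \<in> {0..endA P} \<and> snd v \<in> controls P then F1 P \<sigma> v else 0)
       else (if (\<sigma>, \<tau>) \<in> rect P \<and> snd v \<in> controls P then F12 P \<sigma> \<tau> v else 0))"

lemma C1_in_snd:
  fixes g :: "'i::topological_space \<Rightarrow> 'u::real_normed_vector \<Rightarrow> 'w::real_normed_vector"
  assumes "C1_in T U g"
  shows "C1_in T ((UNIV :: 'y::real_normed_vector set) \<times> U) (\<lambda>i v. g i (snd v))"
proof -
  from assms obtain D :: "'i \<Rightarrow> 'u \<Rightarrow> 'u \<Rightarrow>\<^sub>L 'w" where
    gc: "continuous_on (T \<times> U) (\<lambda>(p, v). g p v)"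
    and Dc: "continuous_on (T \<times> U) (\<lambda>(p, v). D p v)"
    and D: "\<And>p v. p \<in> T \<Longrightarrow> v \<in> U \<Longrightarrow> (g p has_derivative blinfun_apply (D p v)) (at v within U)"
    unfolding C1_in_def by blast
  let ?S = "Blinfun snd :: ('y \<times> 'u) \<Rightarrow>\<^sub>L 'u"
  have S: "blinfun_apply ?S = snd" by (rule bounded_linear_Blinfun_apply[OF bounded_linear_snd])
  have "continuous_on (T \<times> (UNIV \<times> U)) (\<lambda>x. (\<lambda>(p, v). D p v) (fst x, snd (snd x)) o\<^sub>L ?S)"
    by (intro continuous_intros continuous_on_compose2[OF Dc]) auto
  moreover have "continuous_on (T \<times> (UNIV \<times> U)) (\<lambda>x. (\<lambda>(p, v). g p v) (fst x, snd (snd (x :: 'i \<times> 'y \<times> 'u))))"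
    by (intro continuous_intros continuous_on_compose2[OF gc]) auto
  moreover have "((\<lambda>v. g p (snd v)) has_derivative blinfun_apply (D p (snd v) o\<^sub>L ?S)) (at v within UNIV \<times> U)"
    if "p \<in> T" "v \<in> UNIV \<times> U" for p and v :: "'y \<times> 'u"
  proof -
    have "(g p has_derivative blinfun_apply (D p (snd v))) (at (snd v) within snd ` (UNIV \<times> U :: ('y \<times> 'u) set))"
      using D[of p "snd v"] that by auto
    moreover have "((snd :: 'y \<times> 'u \<Rightarrow> 'u) has_derivative snd) (at v within UNIV \<times> U)"
      by (auto intro!: derivative_eq_intros)
    ultimately have "((\<lambda>v. g p (snd v)) has_derivative (\<lambda>h. blinfun_apply (D p (snd v)) (snd h))) (at v within UNIV \<times> U)"
      by (rule has_derivative_in_compose[rotated])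
    moreover have "blinfun_apply (D p (snd v) o\<^sub>L ?S) = (\<lambda>h. blinfun_apply (D p (snd v)) (snd h))"
      by (simp add: fun_eq_iff S)
    ultimately show ?thesis by simp
  qed
  ultimately show ?thesis unfolding C1_in_def
    by (intro conjI exI[of _ "\<lambda>p v. D p (snd v) o\<^sub>L ?S"]) (auto simp: case_prod_unfold)
qed

lemma compact_domains:
  "compact (rect P)" "compact (dom1 P)" "compact (dom2 P)" "compact (dom12 P)"
proof -
  show "compact (rect P)" unfolding rect_def by (intro compact_Times compact_Icc)
  let ?A = "endA P" and ?B = "endB P"
  have 1: "dom1 P = ({0..?A} \<times> {0..?B} \<times> {0..?A}) \<inter> {x. snd (snd x) \<le> fst x}"
    unfolding dom1_def by auto
  have 2: "dom2 P = ({0..?A} \<times> {0..?B} \<times> {0..?B}) \<inter> {x. snd (snd x) \<le> fst (snd x)}"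
    unfolding dom2_def by auto
  have 3: "dom12 P = ({0..?A} \<times> {0..?B} \<times> {0..?A} \<times> {0..?B}) \<inter>
     {x. fst (snd (snd x)) \<le> fst x} \<inter> {x. snd (snd (snd x)) \<le> fst (snd x)}"
    unfolding dom12_def by auto
  show "compact (dom1 P)" unfolding 1
    by (intro compact_Int_closed compact_Times compact_Icc closed_Collect_le continuous_intros)
  show "compact (dom2 P)" unfolding 2
    by (intro compact_Int_closed compact_Times compact_Icc closed_Collect_le continuous_intros)
  show "compact (dom12 P)" unfolding 3
    by (intro compact_Int_closed compact_Times compact_Icc closed_Collect_le continuous_intros)
qed

lemma compact_controls: "regular_problem P \<Longrightarrow> compact (controls P)"
  unfolding controls_def regular_problem_def by (intro compact_Times) auto

lemma pred_fst_less: "Measurable.pred borel (\<lambda>x::real \<times> real. fst x < 0)"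
  and pred_snd_less: "Measurable.pred borel (\<lambda>x::real \<times> real. snd x < 0)"
proof -
  have [measurable]: "fst \<in> borel_measurable (borel :: (real \<times> real) measure)"
    "snd \<in> borel_measurable (borel :: (real \<times> real) measure)"
    by (intro borel_measurable_continuous_onI continuous_intros)+
  show "Measurable.pred borel (\<lambda>x::real \<times> real. fst x < 0)"
    "Measurable.pred borel (\<lambda>x::real \<times> real. snd x < 0)" by measurable
qed

lemma C1_family_kern:
  fixes P :: "('n::finite, 'a::euclidean_space, 'b::euclidean_space, 'c::euclidean_space) problem"
  assumes "regular_problem P" shows "C1_family (kern P)"
proof -
  note R = assms[unfolded regular_problem_def] and U = compact_controls[OF assms]
  have snd_m: "snd \<in> borel_measurable (borel :: ((real \<times> real) \<times> (real \<times> real)) measure)"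
    by (intro borel_measurable_continuous_onI continuous_intros)
  note p1 = measurable_compose[OF snd_m pred_fst_less] and p2 = measurable_compose[OF snd_m pred_snd_less]
  define k0 where "k0 = (\<lambda>i (v :: ('n, 'a, 'b, 'c) point). if i \<in> rect P \<and> snd v \<in> controls P then (\<lambda>(s, t). f0 P s t) i (snd v) else 0)"
  define k1 where "k1 = (\<lambda>i v. if i \<in> dom1 P \<and> snd v \<in> controls P then (\<lambda>(s, t, \<sigma>). f1 P s t \<sigma>) i v else 0)"
  define k2 where "k2 = (\<lambda>i v. if i \<in> dom2 P \<and> snd v \<in> controls P then (\<lambda>(s, t, \<tau>). f2 P s t \<tau>) i v else 0)"
  define k3 where "k3 = (\<lambda>i v. if i \<in> dom12 P \<and> snd v \<in> controls P then (\<lambda>(s, t, \<sigma>, \<tau>). f12 P s t \<sigma> \<tau>) i v else 0)"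
  have 0: "C1_family k0"
    unfolding k0_def using R by (intro C1_family_restrict U compact_domains C1_in_snd) auto
  have 1: "C1_family k1"
    unfolding k1_def using R by (intro C1_family_restrict U compact_domains) auto
  have 2: "C1_family k2"
    unfolding k2_def using R by (intro C1_family_restrict U compact_domains) auto
  have 3: "C1_family k3"
    unfolding k3_def using R by (intro C1_family_restrict U compact_domains) auto
  have m: "(\<lambda>i::(real \<times> real) \<times> (real \<times> real). fst i) \<in> borel_measurable borel"
     "(\<lambda>i::(real \<times> real) \<times> (real \<times> real). (fst (fst i), snd (fst i), fst (snd i))) \<in> borel_measurable borel"
     "(\<lambda>i::(real \<times> real) \<times> (real \<times> real). (fst (fst i), snd (fst i), snd (snd i))) \<in> borel_measurable borel"
     "(\<lambda>i::(real \<times> real) \<times> (real \<times> real). (fst (fst i), snd (fst i), snd i)) \<in> borel_measurable borel"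
    by (intro borel_measurable_continuous_onI continuous_intros)+
  have eq: "kern P = (\<lambda>i v. if fst (snd i) < 0 then
         (if snd (snd i) < 0 then k0 (fst i) v else k2 (fst (fst i), snd (fst i), snd (snd i)) v)
       else (if snd (snd i) < 0 then k1 (fst (fst i), snd (fst i), fst (snd i)) v
         else k3 (fst (fst i), snd (fst i), snd i) v))"
  proof (intro ext)
    fix i :: "(real \<times> real) \<times> (real \<times> real)" and v
    obtain s t \<sigma> \<tau> where i: "i = ((s, t), (\<sigma>, \<tau>))" by (metis prod.exhaust)
    show "kern P i v = (if fst (snd i) < 0 then
         (if snd (snd i) < 0 then k0 (fst i) v else k2 (fst (fst i), snd (fst i), snd (snd i)) v)
       else (if snd (snd i) < 0 then k1 (fst (fst i), snd (fst i), fst (snd i)) v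
         else k3 (fst (fst i), snd (fst i), snd i) v))"
      by (simp add: i kern_def k0_def k1_def k2_def k3_def)
  qed
  show ?thesis unfolding eq
    by (rule C1_family_if[OF C1_family_if[OF C1_family_reindex[OF 0 m(1)] C1_family_reindex[OF 2 m(3)] p2]
        C1_family_if[OF C1_family_reindex[OF 1 m(2)] C1_family_reindex[OF 3 m(4)] p2] p1])
qed

lemma C1_family_fcost:
  assumes "regular_problem P" shows "C1_family (fcost P)"
proof -
  note R = assms[unfolded regular_problem_def] and U = compact_controls[OF assms]
  define k0 where "k0 = (\<lambda>i v. if i \<in> {0::real} \<and> snd v \<in> controls P then (\<lambda>_. F0 P) i v else 0)"
  define k1 where "k1 = (\<lambda>i v. if i \<in> {0..endA P} \<and> snd v \<in> controls P then F1 P i v else 0)"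
  define k2 where "k2 = (\<lambda>i v. if i \<in> {0..endB P} \<and> snd v \<in> controls P then F2 P i v else 0)"
  define k3 where "k3 = (\<lambda>i v. if i \<in> rect P \<and> snd v \<in> controls P then (\<lambda>(s, t). F12 P s t) i v else 0)"
  have 0: "C1_family k0"
    unfolding k0_def using R by (intro C1_family_restrict U compact_domains) auto
  have 1: "C1_family k1"
    unfolding k1_def using R by (intro C1_family_restrict U compact_Icc) auto
  have 2: "C1_family k2"
    unfolding k2_def using R by (intro C1_family_restrict U compact_Icc) auto
  have 3: "C1_family k3"
    unfolding k3_def using R by (intro C1_family_restrict U compact_domains) auto
  have m: "(\<lambda>i::real \<times> real. 0::real) \<in> borel_measurable borel"
     "(\<lambda>i::real \<times> real. fst i) \<in> borel_measurable borel"
     "(\<lambda>i::real \<times> real. snd i) \<in> borel_measurable borel"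
    by (intro borel_measurable_continuous_onI continuous_intros)+
  have eq: "fcost P = (\<lambda>i v. if fst i < 0 then (if snd i < 0 then k0 0 v else k2 (snd i) v)
         else (if snd i < 0 then k1 (fst i) v else k3 i v))"
    by (intro ext) (simp add: fcost_def k0_def k1_def k2_def k3_def case_prod_unfold)
  show ?thesis unfolding eq
    by (rule C1_family_if[OF C1_family_if[OF C1_family_reindex[OF 0 m(1)] C1_family_reindex[OF 2 m(3)] pred_snd_less]
        C1_family_if[OF C1_family_reindex[OF 1 m(2)] 3 pred_snd_less] pred_fst_less])
qed

lemma kern_lipschitz:
  fixes P :: "('n::finite, 'a::euclidean_space, 'b::euclidean_space, 'c::euclidean_space) problem"
  assumes "regular_problem P"
  obtains L where "L \<ge> 0" "\<And>i \<eta> \<eta>' u. norm (kern P i (\<eta>, u) - kern P i (\<eta>', u)) \<le> L * norm (\<eta> - \<eta>')"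
proof -
  note R = assms[unfolded regular_problem_def bounded_lipschitz_in_state_def]
  obtain L1 where L1: "\<And>i u. i \<in> dom1 P \<Longrightarrow> u \<in> controls P \<Longrightarrow>
      L1-lipschitz_on UNIV (\<lambda>y. (\<lambda>(s, t, \<sigma>). f1 P s t \<sigma>) i (y, u))" using R by blast
  obtain L2 where L2: "\<And>i u. i \<in> dom2 P \<Longrightarrow> u \<in> controls P \<Longrightarrow>
      L2-lipschitz_on UNIV (\<lambda>y. (\<lambda>(s, t, \<sigma>). f2 P s t \<sigma>) i (y, u))" using R by blast
  obtain L3 where L3: "\<And>i u. i \<in> dom12 P \<Longrightarrow> u \<in> controls P \<Longrightarrow>
      L3-lipschitz_on UNIV (\<lambda>y. (\<lambda>(s, t, \<sigma>, \<tau>). f12 P s t \<sigma> \<tau>) i (y, u))" using R by blast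
  define L where "L = max 0 (max L1 (max L2 L3))"
  have le: "L' * norm (\<eta> - \<eta>') \<le> L * norm (\<eta> - \<eta>')" if "L' \<in> {0, L1, L2, L3}"
    for L' and \<eta> \<eta>' :: "real^'n"
    using that by (intro mult_right_mono) (auto simp: L_def)
  show thesis
  proof
    show "L \<ge> 0" by (simp add: L_def)
    fix i :: "(real \<times> real) \<times> (real \<times> real)" and \<eta> \<eta>' :: "real^'n" and u :: "'a \<times> 'b \<times> 'c"
    obtain s t \<sigma> \<tau> where i: "i = ((s, t), (\<sigma>, \<tau>))" by (metis prod.exhaust)
    have z: "0 \<le> L * norm (\<eta> - \<eta>')" using le[of 0 \<eta> \<eta>'] by simp
    have 1: "norm (f1 P s t \<sigma> (\<eta>, u) - f1 P s t \<sigma> (\<eta>', u)) \<le> L * norm (\<eta> - \<eta>')"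
      if "(s, t, \<sigma>) \<in> dom1 P" "u \<in> controls P"
      using lipschitz_onD[OF L1[OF that], of \<eta> \<eta>'] le[of L1 \<eta> \<eta>'] by (simp add: dist_norm)
    have 2: "norm (f2 P s t \<tau> (\<eta>, u) - f2 P s t \<tau> (\<eta>', u)) \<le> L * norm (\<eta> - \<eta>')"
      if "(s, t, \<tau>) \<in> dom2 P" "u \<in> controls P"
      using lipschitz_onD[OF L2[OF that], of \<eta> \<eta>'] le[of L2 \<eta> \<eta>'] by (simp add: dist_norm)
    have 3: "norm (f12 P s t \<sigma> \<tau> (\<eta>, u) - f12 P s t \<sigma> \<tau> (\<eta>', u)) \<le> L * norm (\<eta> - \<eta>')"
      if "(s, t, \<sigma>, \<tau>) \<in> dom12 P" "u \<in> controls P"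
      using lipschitz_onD[OF L3[OF that], of \<eta> \<eta>'] le[of L3 \<eta> \<eta>'] by (simp add: dist_norm)
    show "norm (kern P i (\<eta>, u) - kern P i (\<eta>', u)) \<le> L * norm (\<eta> - \<eta>')"
      using 1 2 3 z by (auto simp: i kern_def)
  qed
qed

lemma kern_support:
  assumes "kern P (x, \<omega>) v \<noteq> 0"
  shows "x \<in> rect P" "src x \<omega> \<in> rect P" "fst \<omega> \<le> fst x" "snd \<omega> \<le> snd x" "snd v \<in> controls P"
proof -
  obtain s t \<sigma> \<tau> where i: "x = (s, t)" "\<omega> = (\<sigma>, \<tau>)" by (metis prod.exhaust)
  show "x \<in> rect P" "src x \<omega> \<in> rect P" "fst \<omega> \<le> fst x" "snd \<omega> \<le> snd x" "snd v \<in> controls P"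
    using assms by (auto simp: i kern_def src_def dom1_def dom2_def dom12_def rect_def split: if_splits)
qed

lemma kern_const_in_state: "fst \<omega> < 0 \<Longrightarrow> snd \<omega> < 0 \<Longrightarrow> kern P (x, \<omega>) (\<eta>, u) = kern P (x, \<omega>) (\<eta>', u)"
  by (auto simp: kern_def split: prod.splits)

abbreviation plane :: "('n::finite, 'a, 'b, 'c) problem \<Rightarrow> (real \<times> real) measure" where
  "plane P \<equiv> ext_plane (endA P) (endB P)"

section \<open>The state equation as a contraction\<close>

definition volterra ::
  "('n::finite, 'a::euclidean_space, 'b::euclidean_space, 'c::euclidean_space) problem \<Rightarrow>
   (real \<times> real \<Rightarrow> 'a \<times> 'b \<times> 'c) \<Rightarrow> (real \<times> real \<Rightarrow> real^'n) \<Rightarrow> real \<times> real \<Rightarrow> real^'n" where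
  "volterra P U z x = (\<integral>\<omega>. kern P (x, \<omega>) (z (src x \<omega>), U (src x \<omega>)) \<partial>plane P)"

lemma ident_borel: "(\<lambda>p::'p::euclidean_space. p) \<in> borel_measurable borel"
  by simp

lemma bounded_borel_kern_path:
  assumes "regular_problem P" "bounded_borel z" "U \<in> borel_measurable borel"
  shows "bounded_borel (\<lambda>(x, \<omega>). kern P (x, \<omega>) (z (src x \<omega>), U (src x \<omega>)))"
  using C1_family_compose(1)[OF C1_family_kern[OF assms(1)] assms(2,3) ident_borel src_measurable]
  by (simp add: case_prod_unfold)

lemma bounded_borel_kern_section:
  assumes "regular_problem P" "bounded_borel z" "U \<in> borel_measurable borel"
  shows "bounded_borel (\<lambda>\<omega>. kern P (x, \<omega>) (z (src x \<omega>), U (src x \<omega>)))"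
  using bounded_borel_section2[OF bounded_borel_kern_path[OF assms]] by simp

lemma bounded_borel_volterra:
  assumes "regular_problem P" "bounded_borel z" "U \<in> borel_measurable borel"
  shows "bounded_borel (volterra P U z)"
  using bounded_borel_integral[OF bounded_borel_kern_path[OF assms] finite_measure_ext_plane sets_ext_plane]
  unfolding volterra_def[abs_def] by simp

lemma volterra_outside: "x \<notin> rect P \<Longrightarrow> volterra P U z x = 0"
proof -
  assume "x \<notin> rect P"
  then have "kern P (x, \<omega>) v = 0" for \<omega> v using kern_support(1) by blast
  then show ?thesis by (simp add: volterra_def)
qed

text \<open>
  The quotient of the weights at the source and at the current point, in one coordinate.
\<close>

definition decay :: "real \<Rightarrow> real \<Rightarrow> real \<Rightarrow> real" where
  "decay lam s \<sigma> = (if \<sigma> < 0 then 1 else if \<sigma> \<le> s then exp (- (lam * (s - \<sigma>))) else 0)"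

lemma decay_nonneg: "0 \<le> decay lam s \<sigma>" by (simp add: decay_def)

lemma bounded_borel_decay: "lam > 0 \<Longrightarrow> bounded_borel (decay lam s)"
  by (rule bounded_borelI[where C=1]) (auto simp: decay_def[abs_def])

lemma integral_decay_le:
  assumes lam: "lam > 0" and s: "0 \<le> s" "s \<le> a"
  shows "(\<integral>\<sigma>. decay lam s \<sigma> \<partial>ext_lebesgue a) \<le> 1 + 1 / lam"
proof -
  have "(\<integral>\<sigma>. decay lam s \<sigma> \<partial>ext_lebesgue a) = decay lam s (-1) + (LBINT \<sigma>:{0..a}. decay lam s \<sigma>)"
    using s by (intro integral_ext_lebesgue bounded_borel_decay lam) (auto simp: decay_def)
  also have "(LBINT \<sigma>:{0..a}. decay lam s \<sigma>) = (LBINT \<sigma>:{0..s}. exp (- (lam * (s - \<sigma>))))"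
    using s by (intro set_integral_shrink) (auto simp: decay_def)
  also have "\<dots> = exp (- (lam * (s - s))) / lam - exp (- (lam * (s - 0))) / lam"
    unfolding set_lebesgue_integral_def
  proof (rule integral_FTC_atLeastAtMost[OF s(1)])
    fix \<sigma>
    show "((\<lambda>\<sigma>. exp (- (lam * (s - \<sigma>))) / lam) has_vector_derivative exp (- (lam * (s - \<sigma>)))) (at \<sigma> within {0..s})"
      unfolding has_real_derivative_iff_has_vector_derivative[symmetric]
      using lam by (auto intro!: derivative_eq_intros)
  qed (intro continuous_intros)
  also have "\<dots> \<le> 1 / lam" using lam by simp
  finally show ?thesis by (simp add: decay_def)
qed

lemma integral_ext_plane_prod:
  fixes f g :: "real \<Rightarrow> real"
  assumes "bounded_borel f" "bounded_borel g"
  shows "(\<integral>\<omega>. f (fst \<omega>) * g (snd \<omega>) \<partial>ext_plane a b) = (\<integral>\<sigma>. f \<sigma> \<partial>ext_lebesgue a) * (\<integral>\<tau>. g \<tau> \<partial>ext_lebesgue b)"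
    and "bounded_borel (\<lambda>\<omega>. f (fst \<omega>) * g (snd \<omega>))"
proof -
  obtain C where C: "C \<ge> 0" "\<And>x. norm (f x) \<le> C" using bounded_borelE[OF assms(1)] by metis
  obtain D where D: "D \<ge> 0" "\<And>x. norm (g x) \<le> D" using bounded_borelE[OF assms(2)] by metis
  have m: "(\<lambda>x::real \<times> real. f (fst x)) \<in> borel_measurable borel" "(\<lambda>x::real \<times> real. g (snd x)) \<in> borel_measurable borel"
    by (rule measurable_compose[OF _ bounded_borel_measurable[OF assms(1)]]
       measurable_compose[OF _ bounded_borel_measurable[OF assms(2)]],
       intro borel_measurable_continuous_onI continuous_intros)+
  show b: "bounded_borel (\<lambda>\<omega>. f (fst \<omega>) * g (snd \<omega>))"
    by (rule bounded_borelI[where C="C * D"])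
       (intro borel_measurable_times m, use C D in \<open>auto simp: abs_mult intro!: mult_mono\<close>)
  have "(\<integral>\<omega>. f (fst \<omega>) * g (snd \<omega>) \<partial>ext_plane a b) = (\<integral>\<sigma>. (\<integral>\<tau>. f \<sigma> * g \<tau> \<partial>ext_lebesgue b) \<partial>ext_lebesgue a)"
    using integral_ext_plane[OF b] by simp
  then show "(\<integral>\<omega>. f (fst \<omega>) * g (snd \<omega>) \<partial>ext_plane a b) = (\<integral>\<sigma>. f \<sigma> \<partial>ext_lebesgue a) * (\<integral>\<tau>. g \<tau> \<partial>ext_lebesgue b)"
    by simp
qed

text \<open>
  On the rectangle this is \<open>exp (lam * (s + t))\<close>; clamping the coordinates keeps it between positive
  constants on the whole plane.
\<close>

definition weight :: "('n::finite, 'a, 'b, 'c) problem \<Rightarrow> real \<Rightarrow> real \<times> real \<Rightarrow> real" where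
  "weight P lam x = exp (lam * (max 0 (min (endA P) (fst x)) + max 0 (min (endB P) (snd x))))"

lemma weight_bounds:
  assumes "lam > 0" "endA P > 0" "endB P > 0"
  shows "1 \<le> weight P lam x" "weight P lam x \<le> exp (lam * (endA P + endB P))"
  using assms by (auto simp: weight_def intro!: mult_left_mono add_mono)

lemma weight_src:
  assumes "x \<in> rect P" "src x \<omega> \<in> rect P" "fst \<omega> \<le> fst x" "snd \<omega> \<le> snd x"
  shows "weight P lam (src x \<omega>) = weight P lam x * (decay lam (fst x) (fst \<omega>) * decay lam (snd x) (snd \<omega>))"
  using assms by (auto simp: weight_def src_def decay_def rect_def mult_exp_exp algebra_simps split: if_splits)

text \<open>
  By \<open>weight_src\<close> and \<open>kern_const_in_state\<close> the Lipschitz bound reduces to the integral of \<open>decay\<close> in both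
  coordinates without the part where neither is integrated, that is, to
  \<open>(1 + 1/lam)\<^sup>2 - 1 \<le> 3/lam\<close>.  The bound does not depend on the control, and so neither does \<open>lam\<close>.
\<close>

lemma volterra_contraction:
  fixes P :: "('n::finite, 'a::euclidean_space, 'b::euclidean_space, 'c::euclidean_space) problem"
  assumes reg: "regular_problem P"
  obtains lam where "lam > 0"
    "\<And>U z z' c x. U \<in> borel_measurable borel \<Longrightarrow> bounded_borel z \<Longrightarrow> bounded_borel z' \<Longrightarrow> 0 \<le> c \<Longrightarrow>
      (\<And>x. norm (z x - z' x) \<le> c * weight P lam x) \<Longrightarrow>
      norm (volterra P U z x - volterra P U z' x) \<le> 1 / 2 * c * weight P lam x"
proof -
  obtain L where L: "L \<ge> 0" "\<And>i \<eta> \<eta>' u. norm (kern P i (\<eta>, u) - kern P i (\<eta>', u)) \<le> L * norm (\<eta> - \<eta>')"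
    using kern_lipschitz[OF reg] by metis
  \<comment> \<open>\<open>6 * L\<close> makes \<open>3 * L / lam \<le> 1 / 2\<close>; adding 1 gives \<open>lam \<ge> 1\<close>, so that \<open>1 / lam\<^sup>2 \<le> 1 / lam\<close>.\<close>
  define lam where "lam = 6 * L + 1"
  have lam: "lam \<ge> 1" using L by (simp add: lam_def)
  have small: "L * ((1 + 1 / lam) * (1 + 1 / lam) - 1) \<le> 1 / 2"
  proof -
    have "(1 + 1 / lam) * (1 + 1 / lam) - 1 = 2 / lam + 1 / lam * (1 / lam)" by (simp add: algebra_simps)
    also have "\<dots> \<le> 2 / lam + 1 / lam * 1" using lam by (intro add_left_mono mult_left_mono) auto
    finally have "(1 + 1 / lam) * (1 + 1 / lam) - 1 \<le> 3 / lam" by simp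
    then have "L * ((1 + 1 / lam) * (1 + 1 / lam) - 1) \<le> L * (3 / lam)" using L(1) by (rule mult_left_mono)
    also have "\<dots> \<le> 1 / 2" using lam by (simp add: lam_def field_simps)
    finally show ?thesis .
  qed
  have AB: "endA P > 0" "endB P > 0" using reg by (auto simp: regular_problem_def)
  show thesis
  proof
    show "lam > 0" using lam by simp
    fix U :: "real \<times> real \<Rightarrow> 'a \<times> 'b \<times> 'c" and z z' :: "real \<times> real \<Rightarrow> real^'n" and c x
    assume U: "U \<in> borel_measurable borel" and z: "bounded_borel z" "bounded_borel z'" and c: "0 \<le> c"
      and le: "\<And>x. norm (z x - z' x) \<le> c * weight P lam x"
    let ?w = "weight P lam x"
    have wp: "?w > 0" by (simp add: weight_def)
    show "norm (volterra P U z x - volterra P U z' x) \<le> 1 / 2 * c * ?w"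
    proof (cases "x \<in> rect P")
      case False
      then show ?thesis using c wp by (simp add: volterra_outside)
    next
      case True
      obtain s t where x: "x = (s, t)" by (cases x)
      have st: "0 \<le> s" "s \<le> endA P" "0 \<le> t" "t \<le> endB P" using True by (auto simp: x rect_def)
      let ?k = "\<lambda>\<omega>. kern P (x, \<omega>) (z (src x \<omega>), U (src x \<omega>))"
      let ?k' = "\<lambda>\<omega>. kern P (x, \<omega>) (z' (src x \<omega>), U (src x \<omega>))"
      let ?n = "\<lambda>\<sigma>::real. if \<sigma> < 0 then 1 else 0 :: real"
      let ?b = "\<lambda>\<omega>. decay lam s (fst \<omega>) * decay lam t (snd \<omega>) - ?n (fst \<omega>) * ?n (snd \<omega>)"
      have n: "bounded_borel ?n" by (rule bounded_borelI[where C=1]) auto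
      have nint: "(\<integral>\<sigma>. ?n \<sigma> \<partial>ext_lebesgue a) = 1" if "0 \<le> a" for a
      proof -
        have "(\<integral>\<sigma>. ?n \<sigma> \<partial>ext_lebesgue a) = ?n (-1) + (LBINT \<sigma>:{0..a}. ?n \<sigma>)"
          by (rule integral_ext_lebesgue[OF n _ that]) auto
        also have "(LBINT \<sigma>:{0..a}. ?n \<sigma>) = (LBINT \<sigma>:({} :: real set). 0::real)" by (rule set_integral_shrink) auto
        finally show ?thesis by simp
      qed
      have d: "bounded_borel (decay lam s)" "bounded_borel (decay lam t)"
        using lam by (auto intro: bounded_borel_decay)
      note fin = integrable_bounded_borel[OF finite_measure_ext_plane sets_ext_plane]
      note ik = fin[OF bounded_borel_kern_section[OF reg z(1) U]] fin[OF bounded_borel_kern_section[OF reg z(2) U]]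
      note id = fin[OF integral_ext_plane_prod(2)[OF d]] fin[OF integral_ext_plane_prod(2)[OF n n]]
      have pt: "norm (?k \<omega> - ?k' \<omega>) \<le> L * c * ?w * ?b \<omega>" for \<omega>
      proof (cases "fst \<omega> < 0 \<and> snd \<omega> < 0")
        case True
        then show ?thesis
          using kern_const_in_state[of \<omega> P x "z (src x \<omega>)" "U (src x \<omega>)" "z' (src x \<omega>)"] by (simp add: decay_def)
      next
        case False
        have b: "?b \<omega> = decay lam s (fst \<omega>) * decay lam t (snd \<omega>)" using False by auto
        show ?thesis
        proof (cases "?k \<omega> = 0 \<and> ?k' \<omega> = 0")
          case True
          then show ?thesis using L c wp decay_nonneg by (auto simp: b)
        next
          case F: False
          then have sup: "src x \<omega> \<in> rect P" "fst \<omega> \<le> fst x" "snd \<omega> \<le> snd x"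
            using kern_support[of P x \<omega>] by blast+
          have "norm (?k \<omega> - ?k' \<omega>) \<le> L * norm (z (src x \<omega>) - z' (src x \<omega>))" by (rule L(2))
          also have "\<dots> \<le> L * (c * weight P lam (src x \<omega>))" using L(1) le by (intro mult_left_mono)
          also have "\<dots> = L * c * ?w * ?b \<omega>"
            unfolding b using weight_src[OF True sup, of lam] by (simp add: x mult_ac)
          finally show ?thesis .
        qed
      qed
      have "norm (volterra P U z x - volterra P U z' x) = norm (\<integral>\<omega>. ?k \<omega> - ?k' \<omega> \<partial>plane P)"
        unfolding volterra_def by (subst Bochner_Integration.integral_diff[OF ik]) simp
      also have "\<dots> \<le> (\<integral>\<omega>. norm (?k \<omega> - ?k' \<omega>) \<partial>plane P)" by (rule integral_norm_bound)
      also have "\<dots> \<le> (\<integral>\<omega>. L * c * ?w * ?b \<omega> \<partial>plane P)"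
        by (rule integral_mono) (use ik id pt in auto)
      also have "\<dots> = L * c * ?w * (\<integral>\<omega>. ?b \<omega> \<partial>plane P)" by simp
      also have "(\<integral>\<omega>. ?b \<omega> \<partial>plane P) =
          (\<integral>\<sigma>. decay lam s \<sigma> \<partial>ext_lebesgue (endA P)) * (\<integral>\<tau>. decay lam t \<tau> \<partial>ext_lebesgue (endB P)) - 1 * 1"
        unfolding Bochner_Integration.integral_diff[OF id] integral_ext_plane_prod(1)[OF d]
          integral_ext_plane_prod(1)[OF n n] using nint AB by simp
      also have "\<dots> \<le> (1 + 1 / lam) * (1 + 1 / lam) - 1"
      proof -
        have "(\<integral>\<sigma>. decay lam s \<sigma> \<partial>ext_lebesgue (endA P)) * (\<integral>\<tau>. decay lam t \<tau> \<partial>ext_lebesgue (endB P))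
          \<le> (1 + 1 / lam) * (1 + 1 / lam)"
          using lam st by (intro mult_mono integral_decay_le Bochner_Integration.integral_nonneg decay_nonneg) auto
        then show ?thesis by simp
      qed
      finally have "norm (volterra P U z x - volterra P U z' x) \<le> L * c * ?w * ((1 + 1 / lam) * (1 + 1 / lam) - 1)"
        using L(1) c wp by (meson mult_left_mono mult_nonneg_nonneg less_imp_le)
      also have "\<dots> = L * ((1 + 1 / lam) * (1 + 1 / lam) - 1) * (c * ?w)" by simp
      also have "\<dots> \<le> 1 / 2 * (c * ?w)" using small c wp by (intro mult_right_mono) auto
      finally show ?thesis by simp
    qed
  qed
qed

lemma bounded_borel_uniform_limit:
  fixes F :: "nat \<Rightarrow> 'x::topological_space \<Rightarrow> 'e::euclidean_space"
  assumes F: "\<And>n. bounded_borel (F n)" and lim: "uniform_limit UNIV F f sequentially"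
  shows "bounded_borel f"
proof -
  have "f \<in> borel_measurable borel"
    by (rule borel_measurable_LIMSEQ_metric[OF bounded_borel_measurable[OF F]])
       (use tendsto_uniform_limitI[OF lim] in auto)
  moreover obtain N where N: "\<And>x. dist (F N x) (f x) < 1"
    using lim[unfolded uniform_limit_iff, rule_format, of 1] by (auto simp: eventually_sequentially)
  obtain C where C: "\<And>x. norm (F N x) \<le> C" using bounded_borelE[OF F] by metis
  have "norm (f x) \<le> C + 1" for x
    using N[of x] C[of x] norm_triangle_ineq3[of "F N x" "f x"] by (simp add: dist_norm)
  ultimately show ?thesis by (intro bounded_borelI)
qed

lemma volterra_fixpoint:
  fixes P :: "('n::finite, 'a::euclidean_space, 'b::euclidean_space, 'c::euclidean_space) problem"
    and Inv :: "(real \<times> real \<Rightarrow> real^'n) \<Rightarrow> bool"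
  assumes reg: "regular_problem P" and U: "U \<in> borel_measurable borel"
    and 0: "Inv (\<lambda>x. 0)" and step: "\<And>z. bounded_borel z \<Longrightarrow> Inv z \<Longrightarrow> Inv (volterra P U z)"
    and lim: "\<And>F f. (\<And>n. Inv (F n)) \<Longrightarrow> uniform_limit UNIV F f sequentially \<Longrightarrow> Inv f"
  obtains z where "bounded_borel z" "Inv z" "volterra P U z = z"
proof -
  obtain lam where lam: "lam > 0"
    "\<And>z z' c x. bounded_borel z \<Longrightarrow> bounded_borel z' \<Longrightarrow> 0 \<le> c \<Longrightarrow>
      (\<And>x. norm (z x - z' x) \<le> c * weight P lam x) \<Longrightarrow>
      norm (volterra P U z x - volterra P U z' x) \<le> 1 / 2 * c * weight P lam x"
    using volterra_contraction[OF reg] U by metis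
  have AB: "endA P > 0" "endB P > 0" using reg by (auto simp: regular_problem_def)
  define S where "S = {z. bounded_borel z \<and> Inv z}"
  obtain z where "z \<in> S" "volterra P U z = z"
  proof (rule weighted_contraction_fixpoint[where q="1/2" and w="weight P lam" and S=S and T="volterra P U" and ?g0.0="\<lambda>x. 0"])
    show "(\<lambda>x. 0) \<in> S" using 0 by (auto simp: S_def intro!: bounded_borelI)
    show "volterra P U f \<in> S" if "f \<in> S" for f
      using that step bounded_borel_volterra[OF reg _ U] by (auto simp: S_def)
    show "bounded (range f)" if "f \<in> S" for f using that by (auto simp: S_def bounded_borel_def)
    show "f \<in> S" if "\<And>n. F n \<in> S" "uniform_limit UNIV F f sequentially" for F f
      using that lim[of F f] bounded_borel_uniform_limit[of F f] by (auto simp: S_def)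
    show "norm (volterra P U f x - volterra P U g x) \<le> 1 / 2 * c * weight P lam x"
      if "f \<in> S" "g \<in> S" "0 \<le> c" "\<And>x. norm (f x - g x) \<le> c * weight P lam x" for f g c x
      using that by (intro lam(2)) (auto simp: S_def)
  qed (use weight_bounds[OF lam(1) AB] in auto)
  then show thesis using that by (auto simp: S_def)
qed

lemma volterra_stability:
  fixes P :: "('n::finite, 'a::euclidean_space, 'b::euclidean_space, 'c::euclidean_space) problem"
  assumes reg: "regular_problem P"
  obtains K where "K \<ge> 0"
    "\<And>U z z' c x. U \<in> borel_measurable borel \<Longrightarrow> bounded_borel z \<Longrightarrow> bounded_borel z' \<Longrightarrow> 0 \<le> c \<Longrightarrow>
      volterra P U z = z \<Longrightarrow> (\<And>x. norm (volterra P U z' x - z' x) \<le> c) \<Longrightarrow> norm (z x - z' x) \<le> K * c"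
proof -
  obtain lam where lam: "lam > 0"
    "\<And>U z z' c x. U \<in> borel_measurable borel \<Longrightarrow> bounded_borel z \<Longrightarrow> bounded_borel z' \<Longrightarrow> 0 \<le> c \<Longrightarrow>
      (\<And>x. norm (z x - z' x) \<le> c * weight P lam x) \<Longrightarrow>
      norm (volterra P U z x - volterra P U z' x) \<le> 1 / 2 * c * weight P lam x"
    using volterra_contraction[OF reg] by metis
  have AB: "endA P > 0" "endB P > 0" using reg by (auto simp: regular_problem_def)
  define W where "W = exp (lam * (endA P + endB P))"
  show thesis
  proof
    show "0 \<le> 2 * W" by (simp add: W_def)
    fix U :: "real \<times> real \<Rightarrow> 'a \<times> 'b \<times> 'c" and z z' :: "real \<times> real \<Rightarrow> real^'n" and c x
    assume U: "U \<in> borel_measurable borel" and z: "bounded_borel z" "bounded_borel z'" and c: "0 \<le> c"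
      and fx: "volterra P U z = z" and le: "\<And>x. norm (volterra P U z' x - z' x) \<le> c"
    have "norm (z x - z' x) \<le> c / (1 - 1 / 2) * weight P lam x"
      by (rule weighted_contraction_stability[where T="volterra P U"])
         (use weight_bounds[OF lam(1) AB] c z lam(2)[OF U z] fx le in \<open>auto simp: bounded_borel_def\<close>)
    also have "\<dots> \<le> c / (1 - 1 / 2) * W"
      unfolding W_def using c by (intro mult_left_mono weight_bounds lam(1) AB) auto
    finally show "norm (z x - z' x) \<le> 2 * W * c" by (simp add: mult_ac)
  qed
qed

section \<open>States, fixed points and the cost\<close>

definition ctrl ::
  "('n::finite, 'a::euclidean_space, 'b::euclidean_space, 'c::euclidean_space) problem \<Rightarrow>
   (real \<Rightarrow> 'a) \<Rightarrow> (real \<Rightarrow> 'b) \<Rightarrow> (real \<Rightarrow> real \<Rightarrow> 'c) \<Rightarrow> real \<times> real \<Rightarrow> 'a \<times> 'b \<times> 'c" where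
  "ctrl P u1 u2 u12 x = (if x \<in> rect P then (u1 (fst x), u2 (snd x), u12 (fst x) (snd x)) else 0)"

lemma borel_measurable_zero_extend:
  fixes f :: "'x::topological_space \<Rightarrow> 'e::euclidean_space"
  assumes "f \<in> borel_measurable (restrict_space borel X)" "X \<in> sets borel"
  shows "(\<lambda>x. if x \<in> X then f x else 0) \<in> borel_measurable borel"
proof -
  have "(\<lambda>x. indicator X x *\<^sub>R f x) \<in> borel_measurable borel"
    using assms by (subst borel_measurable_restrict_space_iff[symmetric]) auto
  moreover have "(\<lambda>x. indicator X x *\<^sub>R f x) = (\<lambda>x. if x \<in> X then f x else 0)" by (auto simp: indicator_def)
  ultimately show ?thesis by simp
qed

lemma rect_borel: "rect P \<in> sets borel"
  using compact_domains(1)[of P] by (intro borel_closed compact_imp_closed)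

lemma fst_snd_rect:
  "fst \<in> restrict_space borel (rect P) \<rightarrow>\<^sub>M restrict_space borel {0..endA P}"
  "snd \<in> restrict_space borel (rect P) \<rightarrow>\<^sub>M restrict_space borel {0..endB P}"
proof -
  have m: "fst \<in> borel_measurable (borel :: (real \<times> real) measure)"
    "snd \<in> borel_measurable (borel :: (real \<times> real) measure)"
    by (intro borel_measurable_continuous_onI continuous_intros)+
  show "fst \<in> restrict_space borel (rect P) \<rightarrow>\<^sub>M restrict_space borel {0..endA P}"
    by (rule measurable_restrict_space3[OF m(1)]) (auto simp: rect_def)
  show "snd \<in> restrict_space borel (rect P) \<rightarrow>\<^sub>M restrict_space borel {0..endB P}"
    by (rule measurable_restrict_space3[OF m(2)]) (auto simp: rect_def)
qed

lemma ctrl_measurable: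
  assumes "measurable_controls P u1 u2 u12"
  shows "ctrl P u1 u2 u12 \<in> borel_measurable borel"
proof -
  note m = assms[unfolded measurable_controls_def]
  have "(\<lambda>x. (u1 (fst x), u2 (snd x), u12 (fst x) (snd x))) \<in> borel_measurable (restrict_space borel (rect P))"
    using m measurable_compose[OF fst_snd_rect(1)[of P], of u1] measurable_compose[OF fst_snd_rect(2)[of P], of u2]
    by (intro borel_measurable_Pair) (auto simp: case_prod_unfold)
  from borel_measurable_zero_extend[OF this rect_borel] show ?thesis
    by (simp add: ctrl_def[abs_def])
qed

lemma ctrl_in_controls:
  assumes "measurable_controls P u1 u2 u12" "x \<in> rect P"
  shows "ctrl P u1 u2 u12 x \<in> controls P"
  using assms by (auto simp: measurable_controls_def ctrl_def controls_def rect_def)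

lemma volterra_eq_state_rhs:
  fixes P :: "('n::finite, 'a::euclidean_space, 'b::euclidean_space, 'c::euclidean_space) problem"
  assumes reg: "regular_problem P" and mc: "measurable_controls P u1 u2 u12" and z: "bounded_borel z"
    and y: "\<And>\<sigma> \<tau>. (\<sigma>, \<tau>) \<in> rect P \<Longrightarrow> z (\<sigma>, \<tau>) = y \<sigma> \<tau>" and st: "(s, t) \<in> rect P"
  shows "volterra P (ctrl P u1 u2 u12) z (s, t) =
     f0 P s t (u1 s, u2 t, u12 s t)
          + (LBINT \<sigma>:{0..s}. f1 P s t \<sigma> (along y u1 u2 u12 \<sigma> t))
          + (LBINT \<tau>:{0..t}. f2 P s t \<tau> (along y u1 u2 u12 s \<tau>))
          + (LBINT \<sigma>:{0..s}. LBINT \<tau>:{0..t}. f12 P s t \<sigma> \<tau> (along y u1 u2 u12 \<sigma> \<tau>))"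
proof -
  let ?U = "ctrl P u1 u2 u12"
  define h where "h \<omega> = kern P ((s, t), \<omega>) (z (src (s, t) \<omega>), ?U (src (s, t) \<omega>))" for \<omega>
  have h: "bounded_borel h"
    unfolding h_def by (rule bounded_borel_kern_section[OF reg z ctrl_measurable[OF mc]])
  have in': "ctrl P u1 u2 u12 (\<sigma>, \<tau>) = (u1 \<sigma>, u2 \<tau>, u12 \<sigma> \<tau>)" "(u1 \<sigma>, u2 \<tau>, u12 \<sigma> \<tau>) \<in> controls P"
    if "(\<sigma>, \<tau>) \<in> rect P" for \<sigma> \<tau>
    using ctrl_in_controls[OF mc that] that by (simp_all add: ctrl_def)
  have st': "0 \<le> s" "s \<le> endA P" "0 \<le> t" "t \<le> endB P" using st by (auto simp: rect_def)
  have "volterra P ?U z (s, t) = (\<integral>\<omega>. h \<omega> \<partial>plane P)" by (simp add: volterra_def h_def)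
  also have "\<dots> = h (-1, -1) + (LBINT \<sigma>:{0..endA P}. h (\<sigma>, -1)) + (LBINT \<tau>:{0..endB P}. h (-1, \<tau>))
     + (LBINT \<sigma>:{0..endA P}. LBINT \<tau>:{0..endB P}. h (\<sigma>, \<tau>))"
    by (rule integral_ext_plane_split[OF h]) (use st' in \<open>auto simp: h_def kern_def src_def\<close>)
  also have "h (-1, -1) = f0 P s t (u1 s, u2 t, u12 s t)"
    using st in'[OF st] by (simp add: h_def kern_def src_def)
  also have "(LBINT \<sigma>:{0..endA P}. h (\<sigma>, -1)) = (LBINT \<sigma>:{0..s}. f1 P s t \<sigma> (along y u1 u2 u12 \<sigma> t))"
  proof (rule set_integral_shrink)
    fix \<sigma> assume "\<sigma> \<in> {0..s}"
    then have "(\<sigma>, t) \<in> rect P" "(s, t, \<sigma>) \<in> dom1 P" "\<not> \<sigma> < 0" "\<sigma> \<in> {0..endA P}"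
      using st' by (auto simp: rect_def dom1_def)
    then show "\<sigma> \<in> {0..endA P} \<and> h (\<sigma>, -1) = f1 P s t \<sigma> (along y u1 u2 u12 \<sigma> t)"
      using in'[of \<sigma> t] y by (simp add: h_def kern_def src_def along_def)
  next
    fix \<sigma> assume "\<sigma> \<in> {0..endA P} - {0..s}"
    then show "h (\<sigma>, -1) = 0" by (auto simp: h_def kern_def dom1_def)
  qed
  also have "(LBINT \<tau>:{0..endB P}. h (-1, \<tau>)) = (LBINT \<tau>:{0..t}. f2 P s t \<tau> (along y u1 u2 u12 s \<tau>))"
  proof (rule set_integral_shrink)
    fix \<tau> assume "\<tau> \<in> {0..t}"
    then have "(s, \<tau>) \<in> rect P" "(s, t, \<tau>) \<in> dom2 P" "\<not> \<tau> < 0" "\<tau> \<in> {0..endB P}"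
      using st' by (auto simp: rect_def dom2_def)
    then show "\<tau> \<in> {0..endB P} \<and> h (-1, \<tau>) = f2 P s t \<tau> (along y u1 u2 u12 s \<tau>)"
      using in'[of s \<tau>] y by (simp add: h_def kern_def src_def along_def)
  next
    fix \<tau> assume "\<tau> \<in> {0..endB P} - {0..t}"
    then show "h (-1, \<tau>) = 0" by (auto simp: h_def kern_def dom2_def)
  qed
  also have "(LBINT \<sigma>:{0..endA P}. LBINT \<tau>:{0..endB P}. h (\<sigma>, \<tau>)) =
     (LBINT \<sigma>:{0..s}. LBINT \<tau>:{0..t}. f12 P s t \<sigma> \<tau> (along y u1 u2 u12 \<sigma> \<tau>))"
  proof (rule set_integral_shrink)
    fix \<sigma> assume \<sigma>: "\<sigma> \<in> {0..s}"
    have "(LBINT \<tau>:{0..endB P}. h (\<sigma>, \<tau>)) = (LBINT \<tau>:{0..t}. f12 P s t \<sigma> \<tau> (along y u1 u2 u12 \<sigma> \<tau>))"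
    proof (rule set_integral_shrink)
      fix \<tau> assume "\<tau> \<in> {0..t}"
      then have "(\<sigma>, \<tau>) \<in> rect P" "(s, t, \<sigma>, \<tau>) \<in> dom12 P" "\<not> \<tau> < 0" "\<not> \<sigma> < 0" "\<tau> \<in> {0..endB P}"
        using st' \<sigma> by (auto simp: rect_def dom12_def)
      then show "\<tau> \<in> {0..endB P} \<and> h (\<sigma>, \<tau>) = f12 P s t \<sigma> \<tau> (along y u1 u2 u12 \<sigma> \<tau>)"
        using in'[of \<sigma> \<tau>] y by (simp add: h_def kern_def src_def along_def)
    next
      fix \<tau> assume "\<tau> \<in> {0..endB P} - {0..t}"
      then show "h (\<sigma>, \<tau>) = 0" using \<sigma> by (auto simp: h_def kern_def dom12_def)
    qed
    then show "\<sigma> \<in> {0..endA P} \<and> (LBINT \<tau>:{0..endB P}. h (\<sigma>, \<tau>)) = (LBINT \<tau>:{0..t}. f12 P s t \<sigma> \<tau> (along y u1 u2 u12 \<sigma> \<tau>))"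
      using \<sigma> st' by auto
  next
    fix \<sigma> assume \<sigma>: "\<sigma> \<in> {0..endA P} - {0..s}"
    have "(LBINT \<tau>:{0..endB P}. h (\<sigma>, \<tau>)) = (LBINT \<tau>:({} :: real set). 0)"
      by (rule set_integral_shrink) (use \<sigma> in \<open>auto simp: h_def kern_def dom12_def\<close>)
    then show "(LBINT \<tau>:{0..endB P}. h (\<sigma>, \<tau>)) = 0" by simp
  qed
  finally show ?thesis .
qed

lemma state_imp_fixpoint:
  assumes reg: "regular_problem P" and mc: "measurable_controls P u1 u2 u12"
    and y: "is_state P u1 u2 u12 y"
  defines "z \<equiv> \<lambda>x. if x \<in> rect P then y (fst x) (snd x) else 0"
  shows "bounded_borel z" "volterra P (ctrl P u1 u2 u12) z = z"
proof -
  note Y = y[unfolded is_state_def]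
  have "z \<in> borel_measurable borel"
    unfolding z_def using Y by (intro borel_measurable_zero_extend rect_borel) (auto simp: case_prod_unfold)
  moreover obtain C where C: "\<And>x. x \<in> rect P \<Longrightarrow> norm (y (fst x) (snd x)) \<le> C"
    using Y unfolding bounded_iff by fastforce
  have "norm (z x) \<le> max 0 C" for x using C[of x] by (auto simp: z_def)
  ultimately show z: "bounded_borel z" by (intro bounded_borelI)
  show "volterra P (ctrl P u1 u2 u12) z = z"
  proof
    fix x
    show "volterra P (ctrl P u1 u2 u12) z x = z x"
    proof (cases "x \<in> rect P")
      case True
      obtain s t where x: "x = (s, t)" by (cases x)
      have "volterra P (ctrl P u1 u2 u12) z (s, t) = y s t"
        by (subst volterra_eq_state_rhs[OF reg mc z, where y=y])
           (use Y True x in \<open>auto simp: z_def rect_def\<close>)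
      then show ?thesis using True by (simp add: x z_def)
    qed (simp add: volterra_outside z_def)
  qed
qed

lemma fixpoint_imp_state:
  assumes reg: "regular_problem P" and mc: "measurable_controls P u1 u2 u12"
    and z: "bounded_borel z" and fx: "volterra P (ctrl P u1 u2 u12) z = z"
  shows "is_state P u1 u2 u12 (\<lambda>s t. z (s, t))"
  unfolding is_state_def
proof (intro conjI ballI)
  show "(\<lambda>(s, t). z (s, t)) \<in> borel_measurable (restrict_space borel (rect P))"
    using bounded_borel_measurable[OF z] by (simp add: measurable_restrict_space1)
  show "bounded ((\<lambda>(s, t). z (s, t)) ` rect P)"
    using z unfolding bounded_borel_def by (auto intro: bounded_subset)
  fix s t assume "s \<in> {0..endA P}" "t \<in> {0..endB P}"
  then have "(s, t) \<in> rect P" by (simp add: rect_def)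
  from volterra_eq_state_rhs[OF reg mc z _ this, where y="\<lambda>s t. z (s, t)"]
  show "z (s, t) = f0 P s t (u1 s, u2 t, u12 s t)
          + (LBINT \<sigma>:{0..s}. f1 P s t \<sigma> (along (\<lambda>s t. z (s, t)) u1 u2 u12 \<sigma> t))
          + (LBINT \<tau>:{0..t}. f2 P s t \<tau> (along (\<lambda>s t. z (s, t)) u1 u2 u12 s \<tau>))
          + (LBINT \<sigma>:{0..s}. LBINT \<tau>:{0..t}. f12 P s t \<sigma> \<tau> (along (\<lambda>s t. z (s, t)) u1 u2 u12 \<sigma> \<tau>))"
    by (simp add: fx)
qed

abbreviation corner :: "('n::finite, 'a, 'b, 'c) problem \<Rightarrow> real \<times> real" where
  "corner P \<equiv> (endA P, endB P)"

abbreviation path_cost where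
  "path_cost P U z \<equiv> (\<integral>\<omega>. fcost P \<omega> (z (src (corner P) \<omega>), U (src (corner P) \<omega>)) \<partial>plane P)"

lemma src_corner_measurable: "src x \<in> borel_measurable borel"
  using measurable_compose[OF _ src_measurable, of "\<lambda>\<omega>. (x, \<omega>)" borel]
  by (simp add: borel_measurable_continuous_onI continuous_intros)

lemma bounded_borel_fcost_path:
  assumes "regular_problem P" "bounded_borel z" "U \<in> borel_measurable borel"
  shows "bounded_borel (\<lambda>\<omega>. fcost P \<omega> (z (src (corner P) \<omega>), U (src (corner P) \<omega>)))"
  using C1_family_compose(1)[OF C1_family_fcost[OF assms(1)] assms(2,3) ident_borel src_corner_measurable]
  by simp

lemma cost_eq_integral:
  fixes P :: "('n::finite, 'a::euclidean_space, 'b::euclidean_space, 'c::euclidean_space) problem"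
  assumes reg: "regular_problem P" and mc: "measurable_controls P u1 u2 u12" and z: "bounded_borel z"
    and y: "\<And>\<sigma> \<tau>. (\<sigma>, \<tau>) \<in> rect P \<Longrightarrow> z (\<sigma>, \<tau>) = y \<sigma> \<tau>"
  shows "cost P u1 u2 u12 y = path_cost P (ctrl P u1 u2 u12) z"
proof -
  let ?U = "ctrl P u1 u2 u12"
  define h where "h \<omega> = fcost P \<omega> (z (src (corner P) \<omega>), ?U (src (corner P) \<omega>))" for \<omega>
  have h: "bounded_borel h"
    unfolding h_def by (rule bounded_borel_fcost_path[OF reg z ctrl_measurable[OF mc]])
  have AB: "endA P > 0" "endB P > 0" using reg by (auto simp: regular_problem_def)
  have in': "z (\<sigma>, \<tau>) = y \<sigma> \<tau>" "ctrl P u1 u2 u12 (\<sigma>, \<tau>) = (u1 \<sigma>, u2 \<tau>, u12 \<sigma> \<tau>)" "(u1 \<sigma>, u2 \<tau>, u12 \<sigma> \<tau>) \<in> controls P"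
    "(\<sigma>, \<tau>) \<in> rect P"
    if "\<sigma> \<in> {0..endA P}" "\<tau> \<in> {0..endB P}" for \<sigma> \<tau>
    using ctrl_in_controls[OF mc, of "(\<sigma>, \<tau>)"] that y by (simp_all add: ctrl_def rect_def)
  have "(\<integral>\<omega>. h \<omega> \<partial>plane P) = h (-1, -1) + (LBINT \<sigma>:{0..endA P}. h (\<sigma>, -1)) + (LBINT \<tau>:{0..endB P}. h (-1, \<tau>))
     + (LBINT \<sigma>:{0..endA P}. LBINT \<tau>:{0..endB P}. h (\<sigma>, \<tau>))"
    by (rule integral_ext_plane_split[OF h]) (use AB in \<open>auto simp: h_def fcost_def src_def\<close>)
  also have "h (-1, -1) = F0 P (along y u1 u2 u12 (endA P) (endB P))"
    using AB in'[of "endA P" "endB P"] by (simp add: h_def fcost_def src_def along_def)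
  also have "(LBINT \<sigma>:{0..endA P}. h (\<sigma>, -1)) = (LBINT \<sigma>:{0..endA P}. F1 P \<sigma> (along y u1 u2 u12 \<sigma> (endB P)))"
    by (rule set_integral_shrink) (use AB in' in \<open>auto simp: h_def fcost_def src_def along_def\<close>)
  also have "(LBINT \<tau>:{0..endB P}. h (-1, \<tau>)) = (LBINT \<tau>:{0..endB P}. F2 P \<tau> (along y u1 u2 u12 (endA P) \<tau>))"
    by (rule set_integral_shrink) (use AB in' in \<open>auto simp: h_def fcost_def src_def along_def\<close>)
  also have "(LBINT \<sigma>:{0..endA P}. LBINT \<tau>:{0..endB P}. h (\<sigma>, \<tau>)) =
     (LBINT \<sigma>:{0..endA P}. LBINT \<tau>:{0..endB P}. F12 P \<sigma> \<tau> (along y u1 u2 u12 \<sigma> \<tau>))"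
  proof (rule set_integral_shrink)
    fix \<sigma> assume \<sigma>: "\<sigma> \<in> {0..endA P}"
    have "(LBINT \<tau>:{0..endB P}. h (\<sigma>, \<tau>)) = (LBINT \<tau>:{0..endB P}. F12 P \<sigma> \<tau> (along y u1 u2 u12 \<sigma> \<tau>))"
      by (rule set_integral_shrink) (use \<sigma> in' in \<open>auto simp: h_def fcost_def src_def along_def\<close>)
    then show "\<sigma> \<in> {0..endA P} \<and> (LBINT \<tau>:{0..endB P}. h (\<sigma>, \<tau>)) = (LBINT \<tau>:{0..endB P}. F12 P \<sigma> \<tau> (along y u1 u2 u12 \<sigma> \<tau>))"
      using \<sigma> by simp
  qed auto
  finally show ?thesis by (simp add: cost_def Let_def h_def)
qed

section \<open>Continuity of the state\<close>

text \<open>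
  Continuity wherever the one-dimensional controls are continuous.  Asking only that \<open>u1\<close> and \<open>u2\<close>
  converge along the sequence, rather than that they be continuous, covers sequences that
  move in one coordinate while the other one sits at a discontinuity.  Such sequences arise as
  sources of line integrals, and only for this reason is the property preserved by \<open>volterra\<close>.
\<close>

definition state_continuous ::
  "('n::finite, 'a::euclidean_space, 'b::euclidean_space, 'c::euclidean_space) problem \<Rightarrow>
   (real \<Rightarrow> 'a) \<Rightarrow> (real \<Rightarrow> 'b) \<Rightarrow> (real \<times> real \<Rightarrow> real^'n) \<Rightarrow> bool" where
  "state_continuous P u1 u2 z \<longleftrightarrow>
     (\<forall>X x. (\<forall>n. X n \<in> rect P) \<longrightarrow> X \<longlonglongrightarrow> x \<longrightarrow>
        (\<lambda>n. u1 (fst (X n))) \<longlonglongrightarrow> u1 (fst x) \<longrightarrow> (\<lambda>n. u2 (snd (X n))) \<longlonglongrightarrow> u2 (snd x) \<longrightarrow>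
        (\<lambda>n. z (X n)) \<longlonglongrightarrow> z x)"

lemma kern_indep:
  assumes "f0_f1_f2_indep_u12 P" "fst \<omega> < 0 \<or> snd \<omega> < 0" "c \<in> U12 P" "c' \<in> U12 P"
  shows "kern P (x, \<omega>) (\<eta>, a, b, c) = kern P (x, \<omega>) (\<eta>, a, b, c')"
proof -
  obtain s t \<sigma> \<tau> where x: "x = (s, t)" "\<omega> = (\<sigma>, \<tau>)" by (metis prod.exhaust)
  show ?thesis
  proof (cases "a \<in> U1 P \<and> b \<in> U2 P")
    case True
    then have I: "\<And>s t. (s, t) \<in> rect P \<Longrightarrow> f0 P s t (a, b, c) = f0 P s t (a, b, c')"
      "\<And>s t \<sigma> y. (s, t, \<sigma>) \<in> dom1 P \<Longrightarrow> f1 P s t \<sigma> (y, a, b, c) = f1 P s t \<sigma> (y, a, b, c')"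
      "\<And>s t \<tau> y. (s, t, \<tau>) \<in> dom2 P \<Longrightarrow> f2 P s t \<tau> (y, a, b, c) = f2 P s t \<tau> (y, a, b, c')"
      using assms(1,3,4) unfolding f0_f1_f2_indep_u12_def by blast+
    show ?thesis using assms True I by (auto simp: x kern_def controls_def)
  qed (auto simp: x kern_def controls_def)
qed

lemma tendsto_restrict:
  fixes g :: "'p::topological_space \<Rightarrow> 'v::topological_space \<Rightarrow> 'w::real_normed_vector"
  assumes g: "continuous_on (T \<times> V) (\<lambda>(p, v). g p v)" and p: "p \<longlonglongrightarrow> p'" and v: "v \<longlonglongrightarrow> v'"
    and V: "\<And>n. v n \<in> V" "v' \<in> V" and ev: "\<forall>\<^sub>F n in sequentially. p n \<in> T \<longleftrightarrow> p' \<in> T"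
  shows "(\<lambda>n. if p n \<in> T then g (p n) (v n) else 0) \<longlonglongrightarrow> (if p' \<in> T then g p' v' else 0)"
proof (cases "p' \<in> T")
  case True
  have ev': "\<forall>\<^sub>F n in sequentially. p n \<in> T" using ev True by simp
  have "(\<lambda>n. (\<lambda>(p, v). g p v) (p n, v n)) \<longlonglongrightarrow> (\<lambda>(p, v). g p v) (p', v')"
    by (rule continuous_on_tendsto_compose[OF g])
       (use True V ev' in \<open>auto intro!: tendsto_intros p v elim: eventually_mono\<close>)
  moreover have "\<forall>\<^sub>F n in sequentially. g (p n) (v n) = (if p n \<in> T then g (p n) (v n) else 0)"
    using ev' by (rule eventually_mono) simp
  ultimately show ?thesis using True by (simp add: tendsto_cong)
next
  case False
  have "\<forall>\<^sub>F n in sequentially. (if p n \<in> T then g (p n) (v n) else 0) = 0"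
    using ev by (rule eventually_mono) (use False in simp)
  then show ?thesis using False by (simp add: tendsto_eventually)
qed

lemma eventually_le_iff:
  fixes s p :: "nat \<Rightarrow> real"
  assumes "s \<longlonglongrightarrow> s'" "p \<longlonglongrightarrow> p'" "p' \<noteq> s'"
  shows "\<forall>\<^sub>F n in sequentially. p n \<le> s n \<longleftrightarrow> p' \<le> s'"
proof -
  have l: "(\<lambda>n. s n - p n) \<longlonglongrightarrow> s' - p'" by (intro tendsto_intros assms)
  show ?thesis
  proof (cases "p' \<le> s'")
    case True
    then show ?thesis using order_tendstoD(1)[OF l, of 0] assms(3) by (auto elim!: eventually_mono)
  next
    case False
    then show ?thesis using order_tendstoD(2)[OF l, of 0] by (auto elim!: eventually_mono)
  qed
qed

text \<open>
  The kernel jumps on the boundary of its domain, where a source coordinate equals the current one.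
  Off this null set it is continuous jointly in all arguments, as long as the same coordinates are
  integrated along the whole sequence.
\<close>

lemma kern_tendsto:
  fixes P :: "('n::finite, 'a::euclidean_space, 'b::euclidean_space, 'c::euclidean_space) problem"
  assumes reg: "regular_problem P" and r: "\<And>n. (S n, T n) \<in> rect P" "(s, t) \<in> rect P"
    and lim: "S \<longlonglongrightarrow> s" "T \<longlonglongrightarrow> t" "\<sigma> \<longlonglongrightarrow> \<sigma>'" "\<tau> \<longlonglongrightarrow> \<tau>'"
    and sgn: "\<And>n. \<sigma> n < 0 \<longleftrightarrow> \<sigma>' < 0" "\<And>n. \<tau> n < 0 \<longleftrightarrow> \<tau>' < 0"
    and ne: "\<sigma>' \<noteq> s" "\<tau>' \<noteq> t"
    and v: "v \<longlonglongrightarrow> v'" "\<And>n. snd (v n) \<in> controls P" "snd v' \<in> controls P"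
  shows "(\<lambda>n. kern P ((S n, T n), (\<sigma> n, \<tau> n)) (v n)) \<longlonglongrightarrow> kern P ((s, t), (\<sigma>', \<tau>')) v'"
proof -
  note R = reg[unfolded regular_problem_def C1_in_def]
  have st: "0 \<le> S n" "S n \<le> endA P" "0 \<le> T n" "T n \<le> endB P" "0 \<le> s" "s \<le> endA P" "0 \<le> t" "t \<le> endB P" for n
    using r(1)[of n] r(2) by (auto simp: rect_def)
  have v': "v n \<in> UNIV \<times> controls P" "v' \<in> UNIV \<times> controls P" for n using v(2)[of n] v(3) by (simp_all add: mem_Times_iff)
  note es = eventually_le_iff[OF lim(1,3) ne(1)] and et = eventually_le_iff[OF lim(2,4) ne(2)]
  consider "\<sigma>' < 0" "\<tau>' < 0" | "\<sigma>' < 0" "\<not> \<tau>' < 0" | "\<not> \<sigma>' < 0" "\<tau>' < 0" | "\<not> \<sigma>' < 0" "\<not> \<tau>' < 0" by blast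
  then show ?thesis
  proof cases
    case 1
    have "(\<lambda>n. if (S n, T n) \<in> rect P then (\<lambda>(s, t). f0 P s t) (S n, T n) (snd (v n)) else 0)
       \<longlonglongrightarrow> (if (s, t) \<in> rect P then (\<lambda>(s, t). f0 P s t) (s, t) (snd v') else 0)"
      by (rule tendsto_restrict[where V="controls P"]) (use R v r in \<open>auto intro!: tendsto_intros lim\<close>)
    then show ?thesis using 1 sgn v(2,3) r by (simp add: kern_def)
  next
    case 2
    have "\<forall>\<^sub>F n in sequentially. (S n, T n, \<tau> n) \<in> dom2 P \<longleftrightarrow> (s, t, \<tau>') \<in> dom2 P"
      using et by (rule eventually_mono) (use 2 st sgn(2) in \<open>auto simp: dom2_def not_less\<close>)
    then have "(\<lambda>n. if (S n, T n, \<tau> n) \<in> dom2 P then (\<lambda>(s, t, \<tau>). f2 P s t \<tau>) (S n, T n, \<tau> n) (v n) else 0)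
       \<longlonglongrightarrow> (if (s, t, \<tau>') \<in> dom2 P then (\<lambda>(s, t, \<tau>). f2 P s t \<tau>) (s, t, \<tau>') v' else 0)"
      by (intro tendsto_restrict[where V="UNIV \<times> controls P"]) (use R v v' in \<open>auto intro!: tendsto_intros lim\<close>)
    then show ?thesis using 2 sgn v(2,3) by (simp add: kern_def cong: if_cong split del: if_split)
  next
    case 3
    have "\<forall>\<^sub>F n in sequentially. (S n, T n, \<sigma> n) \<in> dom1 P \<longleftrightarrow> (s, t, \<sigma>') \<in> dom1 P"
      using es by (rule eventually_mono) (use 3 st sgn(1) in \<open>auto simp: dom1_def not_less\<close>)
    then have "(\<lambda>n. if (S n, T n, \<sigma> n) \<in> dom1 P then (\<lambda>(s, t, \<sigma>). f1 P s t \<sigma>) (S n, T n, \<sigma> n) (v n) else 0)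
       \<longlonglongrightarrow> (if (s, t, \<sigma>') \<in> dom1 P then (\<lambda>(s, t, \<sigma>). f1 P s t \<sigma>) (s, t, \<sigma>') v' else 0)"
      by (intro tendsto_restrict[where V="UNIV \<times> controls P"]) (use R v v' in \<open>auto intro!: tendsto_intros lim\<close>)
    then show ?thesis using 3 sgn v(2,3) by (simp add: kern_def cong: if_cong split del: if_split)
  next
    case 4
    have "\<forall>\<^sub>F n in sequentially. (S n, T n, \<sigma> n, \<tau> n) \<in> dom12 P \<longleftrightarrow> (s, t, \<sigma>', \<tau>') \<in> dom12 P"
      using eventually_conj[OF es et]
      by (rule eventually_mono) (use 4 st sgn in \<open>auto simp: dom12_def not_less\<close>)
    then have "(\<lambda>n. if (S n, T n, \<sigma> n, \<tau> n) \<in> dom12 P then (\<lambda>(s, t, \<sigma>, \<tau>). f12 P s t \<sigma> \<tau>) (S n, T n, \<sigma> n, \<tau> n) (v n) else 0)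
       \<longlonglongrightarrow> (if (s, t, \<sigma>', \<tau>') \<in> dom12 P then (\<lambda>(s, t, \<sigma>, \<tau>). f12 P s t \<sigma> \<tau>) (s, t, \<sigma>', \<tau>') v' else 0)"
      by (intro tendsto_restrict[where V="UNIV \<times> controls P"]) (use R v v' in \<open>auto intro!: tendsto_intros lim\<close>)
    then show ?thesis using 4 sgn v(2,3) by (simp add: kern_def cong: if_cong split del: if_split)
  qed
qed

lemma volterra_state_continuous:
  fixes P :: "('n::finite, 'a::euclidean_space, 'b::euclidean_space, 'c::euclidean_space) problem"
  assumes reg: "regular_problem P" and ind: "f0_f1_f2_indep_u12 P"
    and mc: "measurable_controls P u1 u2 u12" and z: "bounded_borel z"
    and zc: "state_continuous P u1 u2 z"
  shows "state_continuous P u1 u2 (volterra P (ctrl P u1 u2 u12) z)"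
  unfolding state_continuous_def
proof (intro allI impI)
  fix X x assume X: "\<forall>n. X n \<in> rect P" and lim: "X \<longlonglongrightarrow> x"
    and l1: "(\<lambda>n. u1 (fst (X n))) \<longlonglongrightarrow> u1 (fst x)" and l2: "(\<lambda>n. u2 (snd (X n))) \<longlonglongrightarrow> u2 (snd x)"
  let ?U = "ctrl P u1 u2 u12"
  let ?k = "\<lambda>x \<omega>. kern P (x, \<omega>) (z (src x \<omega>), ?U (src x \<omega>))"
  have xr: "x \<in> rect P"
    by (rule closed_sequentially[OF compact_imp_closed[OF compact_domains(1)]]) (use X lim in auto)
  define c0 where "c0 = u12 (fst x) (snd x)"
  have u: "u1 (fst q) \<in> U1 P" "u2 (snd q) \<in> U2 P" "u12 (fst q) (snd q) \<in> U12 P" if "q \<in> rect P" for q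
    using mc that by (auto simp: measurable_controls_def rect_def)
  have c0: "c0 \<in> U12 P" using u(3)[OF xr] by (simp add: c0_def)
  obtain R0 where R0: "\<And>x. norm (z x) \<le> R0" using bounded_borelE[OF z] by metis
  obtain C where C: "\<And>i v. norm (fst v) \<le> R0 \<Longrightarrow> norm (kern P i v) \<le> C"
    using C1_family_bounded[OF C1_family_kern[OF reg]] by metis
  note km = bounded_borel_kern_section[OF reg z ctrl_measurable[OF mc], THEN bounded_borel_measurable]
  have pt: "(\<lambda>n. ?k (X n) \<omega>) \<longlonglongrightarrow> ?k x \<omega>"
    if om: "\<omega> \<in> {-1..endA P} \<times> {-1..endB P}" and ne: "fst \<omega> \<noteq> fst x" "snd \<omega> \<noteq> snd x" for \<omega>
  proof -
    let ?Y = "\<lambda>n. src (X n) \<omega>" and ?y = "src x \<omega>"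
    have Y: "src q \<omega> \<in> rect P" if "q \<in> rect P" for q
      using om that by (cases \<omega>; cases q) (auto simp: src_def rect_def)
    have Yl: "?Y \<longlonglongrightarrow> ?y" "(\<lambda>n. u1 (fst (?Y n))) \<longlonglongrightarrow> u1 (fst ?y)" "(\<lambda>n. u2 (snd (?Y n))) \<longlonglongrightarrow> u2 (snd ?y)"
      unfolding src_def using tendsto_fst[OF lim] tendsto_snd[OF lim] lim l1 l2 by (auto intro!: tendsto_intros)
    have zl: "(\<lambda>n. z (?Y n)) \<longlonglongrightarrow> z ?y"
      by (rule zc[unfolded state_continuous_def, rule_format]) (use Y X Yl in auto)
    define neg where "neg \<longleftrightarrow> fst \<omega> < 0 \<or> snd \<omega> < 0"
    \<comment> \<open>The value of \<open>u12\<close> may jump at the moving points \<open>src (X n) \<omega>\<close>, but there the kernel does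
      not see it; it is seen only where the source does not move.\<close>
    define V where "V q = (z (src q \<omega>), if neg then (u1 (fst (src q \<omega>)), u2 (snd (src q \<omega>)), c0) else ?U \<omega>)" for q
    have src: "src q \<omega> = \<omega>" if "\<not> neg" for q using that by (cases \<omega>) (auto simp: neg_def src_def)
    have kV: "?k q \<omega> = kern P (q, \<omega>) (V q)" and Vc: "snd (V q) \<in> controls P" if q: "q \<in> rect P" for q
    proof -
      show "snd (V q) \<in> controls P"
        using u[OF Y[OF q]] c0 ctrl_in_controls[OF mc Y[OF q]] src[of q] by (cases neg) (simp_all add: V_def controls_def)
      show "?k q \<omega> = kern P (q, \<omega>) (V q)"
        using kern_indep[OF ind _ u(3)[OF Y[OF q]] c0, of \<omega> q] Y[OF q] src[of q] by (cases neg) (simp_all add: V_def neg_def ctrl_def)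
    qed
    have Vl: "(\<lambda>n. V (X n)) \<longlonglongrightarrow> V x" unfolding V_def using zl Yl by (auto intro!: tendsto_intros)
    have "(\<lambda>n. kern P ((fst (X n), snd (X n)), (fst \<omega>, snd \<omega>)) (V (X n))) \<longlonglongrightarrow> kern P ((fst x, snd x), (fst \<omega>, snd \<omega>)) (V x)"
      by (rule kern_tendsto[OF reg]) (use X xr ne Vc Vl in \<open>auto intro!: tendsto_intros lim\<close>)
    then show ?thesis using kV X xr by simp
  qed
  show "(\<lambda>n. volterra P ?U z (X n)) \<longlonglongrightarrow> volterra P ?U z x"
    unfolding volterra_def
  proof (rule integral_dominated_convergence[where w="\<lambda>_. C"])
    show "?k x \<in> borel_measurable (plane P)" "\<And>n. ?k (X n) \<in> borel_measurable (plane P)"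
      using km by (simp_all add: measurable_cong_sets[OF sets_ext_plane refl])
    show "integrable (plane P) (\<lambda>_. C)" by (simp add: finite_measure.integrable_const)
    show "AE \<omega> in plane P. norm (?k (X n) \<omega>) \<le> C" for n
      by (intro AE_I2 C) (simp add: R0)
    have "AE \<omega> in plane P. \<omega> \<in> {-1..endA P} \<times> {-1..endB P} \<and> fst \<omega> \<noteq> fst x \<and> snd \<omega> \<noteq> snd x"
      by (rule AE_ext_planeI) (auto intro: AE_lborel_singleton)
    then show "AE \<omega> in plane P. (\<lambda>n. ?k (X n) \<omega>) \<longlonglongrightarrow> ?k x \<omega>"
      by (rule eventually_mono) (use pt in blast)
  qed
qed

lemma state_continuous_uniform_limit:
  assumes F: "\<And>n. state_continuous P u1 u2 (F n)" and lim: "uniform_limit UNIV F f sequentially"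
  shows "state_continuous P u1 u2 f"
  unfolding state_continuous_def
proof (intro allI impI)
  fix X x assume A: "\<forall>n. X n \<in> rect P" "X \<longlonglongrightarrow> x" "(\<lambda>n. u1 (fst (X n))) \<longlonglongrightarrow> u1 (fst x)"
    "(\<lambda>n. u2 (snd (X n))) \<longlonglongrightarrow> u2 (snd x)"
  show "(\<lambda>n. f (X n)) \<longlonglongrightarrow> f x"
  proof -
    have "(f \<longlongrightarrow> f x) (filtermap X sequentially)"
    proof (rule swap_uniform_limit'[OF _ _ lim])
      show "\<forall>\<^sub>F n in sequentially. (F n \<longlongrightarrow> F n x) (filtermap X sequentially)"
        using F A unfolding state_continuous_def filterlim_filtermap by (intro always_eventually) blast
      show "(\<lambda>n. F n x) \<longlonglongrightarrow> f x" by (rule tendsto_uniform_limitI[OF lim]) simp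
    qed auto
    then show ?thesis by (simp add: filterlim_filtermap)
  qed
qed

text \<open>
  The iteration started at 0 stays within the continuous functions in this sense, so there is a solution with the
  property, and by stability it is the only solution.
\<close>

lemma fixpoint_state_continuous:
  fixes P :: "('n::finite, 'a::euclidean_space, 'b::euclidean_space, 'c::euclidean_space) problem"
  assumes reg: "regular_problem P" and ind: "f0_f1_f2_indep_u12 P"
    and mc: "measurable_controls P u1 u2 u12" and z: "bounded_borel z"
    and fx: "volterra P (ctrl P u1 u2 u12) z = z"
  shows "state_continuous P u1 u2 z"
proof -
  note U = ctrl_measurable[OF mc]
  obtain z' where z': "bounded_borel z'" "state_continuous P u1 u2 z'" "volterra P (ctrl P u1 u2 u12) z' = z'"
  proof (rule volterra_fixpoint[OF reg U, of "state_continuous P u1 u2"])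
    show "state_continuous P u1 u2 (\<lambda>x. 0)" by (simp add: state_continuous_def)
    show "state_continuous P u1 u2 (volterra P (ctrl P u1 u2 u12) z)"
      if "bounded_borel z" "state_continuous P u1 u2 z" for z
      by (rule volterra_state_continuous[OF reg ind mc that])
    show "state_continuous P u1 u2 f"
      if "\<And>n. state_continuous P u1 u2 (F n)" "uniform_limit UNIV F f sequentially" for F f
      by (rule state_continuous_uniform_limit[OF that])
  qed
  obtain K where K: "K \<ge> 0" "\<And>U z z' c x. U \<in> borel_measurable borel \<Longrightarrow> bounded_borel z \<Longrightarrow> bounded_borel z' \<Longrightarrow> 0 \<le> c \<Longrightarrow>
      volterra P U z = z \<Longrightarrow> (\<And>x. norm (volterra P U z' x - z' x) \<le> c) \<Longrightarrow> norm (z x - z' x) \<le> K * c"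
    using volterra_stability[OF reg] by metis
  have "norm (z x - z' x) \<le> K * 0" for x
    by (rule K(2)[OF U z z'(1) _ fx]) (simp_all add: z'(3))
  then have "z = z'" by auto
  with z' show ?thesis by simp
qed

section \<open>The adjoint identity\<close>

lemma measurable_plane [simp]: "borel_measurable (ext_plane a b) = (borel_measurable borel :: (real \<times> real \<Rightarrow> 'e::topological_space) set)"
  by (rule measurable_cong_sets[OF sets_ext_plane refl])

lemma integrable_plane:
  fixes f :: "real \<times> real \<Rightarrow> 'e::euclidean_space"
  shows "bounded_borel f \<Longrightarrow> integrable (ext_plane a b) f"
  by (rule integrable_bounded_borel[OF finite_measure_ext_plane sets_ext_plane])

lemma bounded_borel_inner:
  fixes f g :: "'x::topological_space \<Rightarrow> 'e::euclidean_space"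
  assumes "bounded_borel f" "bounded_borel g"
  shows "bounded_borel (\<lambda>x. f x \<bullet> g x)"
proof -
  obtain C where C: "C \<ge> 0" "\<And>x. norm (f x) \<le> C" using bounded_borelE[OF assms(1)] by metis
  obtain D where D: "D \<ge> 0" "\<And>x. norm (g x) \<le> D" using bounded_borelE[OF assms(2)] by metis
  have "norm (f x \<bullet> g x) \<le> C * D" for x
    using Cauchy_Schwarz_ineq2[of "f x" "g x"] mult_mono[OF C(2)[of x] D(2)[of x] C(1) norm_ge_zero] by simp
  then show ?thesis
    using assms by (intro bounded_borelI) (auto simp: bounded_borel_def)
qed

lemma bounded_borel_add:
  fixes f g :: "'x::topological_space \<Rightarrow> 'e::euclidean_space"
  assumes "bounded_borel f" "bounded_borel g"
  shows "bounded_borel (\<lambda>x. f x + g x)" "bounded_borel (\<lambda>x. f x - g x)"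
proof -
  obtain C where C: "\<And>x. norm (f x) \<le> C" using bounded_borelE[OF assms(1)] by metis
  obtain D where D: "\<And>x. norm (g x) \<le> D" using bounded_borelE[OF assms(2)] by metis
  have 1: "norm (f x + g x) \<le> C + D" and 2: "norm (f x - g x) \<le> C + D" for x
    using norm_triangle_ineq[of "f x" "g x"] norm_triangle_ineq4[of "f x" "g x"] C[of x] D[of x] by simp_all
  have m: "f \<in> borel_measurable borel" "g \<in> borel_measurable borel" using assms by (auto simp: bounded_borel_def)
  show "bounded_borel (\<lambda>x. f x + g x)" by (rule bounded_borelI[OF _ 1]) (intro borel_measurable_add m)
  show "bounded_borel (\<lambda>x. f x - g x)" by (rule bounded_borelI[OF _ 2]) (intro borel_measurable_diff m)
qed

lemma bounded_borel_if:
  fixes f :: "'x::topological_space \<Rightarrow> 'e::euclidean_space"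
  assumes f: "bounded_borel f" and "Measurable.pred borel p"
  shows "bounded_borel (\<lambda>x. if p x then f x else 0)"
proof -
  obtain C where C: "C \<ge> 0" "\<And>x. norm (f x) \<le> C" using bounded_borelE[OF f] by metis
  have [measurable]: "f \<in> borel_measurable borel" "Measurable.pred borel p"
    using assms by (auto simp: bounded_borel_def)
  show ?thesis by (rule bounded_borelI[where C=C]) (measurable, use C in auto)
qed

text \<open>
  Fubini's theorem in the form in which it turns an integral of the linearized state over sources into an
  integral of the co-state over receivers: the first coordinate of the receiver and that of the source change
  places, and the second coordinate is common to both.
\<close>

lemma integral_swap_first:
  fixes H :: "(real \<times> real) \<times> real \<Rightarrow> real"
  assumes H: "bounded_borel H"
  shows "(\<integral>\<omega>. (\<integral>\<sigma>'. H (\<omega>, \<sigma>') \<partial>ext_lebesgue a) \<partial>ext_plane a b) =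
    (\<integral>\<omega>. (\<integral>\<sigma>. H ((\<sigma>, snd \<omega>), fst \<omega>) \<partial>ext_lebesgue a) \<partial>ext_plane a b)"
proof -
  have 1: "bounded_borel (\<lambda>\<omega>. \<integral>\<sigma>'. H (\<omega>, \<sigma>') \<partial>ext_lebesgue a)"
    by (rule bounded_borel_integral[OF H]) auto
  have m: "(\<lambda>p :: (real \<times> real) \<times> real. ((snd p, snd (fst p)), fst (fst p))) \<in> borel_measurable borel"
    by (intro borel_measurable_continuous_onI continuous_intros)
  have 2: "bounded_borel (\<lambda>\<omega>. \<integral>\<sigma>. H ((\<sigma>, snd \<omega>), fst \<omega>) \<partial>ext_lebesgue a)"
    using bounded_borel_integral[OF bounded_borel_compose[OF H m], of "ext_lebesgue a"] by simp
  have m: "(\<lambda>p :: real \<times> real. ((fst p, \<tau>), snd p)) \<in> borel_measurable borel" for \<tau>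
    by (intro borel_measurable_continuous_onI continuous_intros)
  have 3: "bounded_borel (\<lambda>p. H ((fst p, \<tau>), snd p))" for \<tau>
    by (rule bounded_borel_compose[OF H m])
  have 4: "(\<integral>\<sigma>. \<integral>\<sigma>'. H ((\<sigma>, \<tau>), \<sigma>') \<partial>ext_lebesgue a \<partial>ext_lebesgue a) =
      (\<integral>\<sigma>'. \<integral>\<sigma>. H ((\<sigma>, \<tau>), \<sigma>') \<partial>ext_lebesgue a \<partial>ext_lebesgue a)" for \<tau>
    using integral_ext_plane[OF 3[of \<tau>], of a a] integral_ext_plane'[OF 3[of \<tau>], of a a] by simp
  have "(\<integral>\<omega>. (\<integral>\<sigma>'. H (\<omega>, \<sigma>') \<partial>ext_lebesgue a) \<partial>ext_plane a b) =
    (\<integral>\<tau>. \<integral>\<sigma>. \<integral>\<sigma>'. H ((\<sigma>, \<tau>), \<sigma>') \<partial>ext_lebesgue a \<partial>ext_lebesgue a \<partial>ext_lebesgue b)"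
    by (rule integral_ext_plane'[OF 1])
  also have "\<dots> = (\<integral>\<tau>. \<integral>\<sigma>'. \<integral>\<sigma>. H ((\<sigma>, \<tau>), \<sigma>') \<partial>ext_lebesgue a \<partial>ext_lebesgue a \<partial>ext_lebesgue b)"
    unfolding 4 ..
  also have "\<dots> = (\<integral>\<omega>. (\<integral>\<sigma>. H ((\<sigma>, snd \<omega>), fst \<omega>) \<partial>ext_lebesgue a) \<partial>ext_plane a b)"
    using integral_ext_plane'[OF 2, of a b] by simp
  finally show ?thesis .
qed

lemma integral_swap_second:
  fixes H :: "(real \<times> real) \<times> real \<Rightarrow> real"
  assumes H: "bounded_borel H"
  shows "(\<integral>\<omega>. (\<integral>\<tau>'. H (\<omega>, \<tau>') \<partial>ext_lebesgue b) \<partial>ext_plane a b) =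
    (\<integral>\<omega>. (\<integral>\<tau>. H ((fst \<omega>, \<tau>), snd \<omega>) \<partial>ext_lebesgue b) \<partial>ext_plane a b)"
proof -
  have 1: "bounded_borel (\<lambda>\<omega>. \<integral>\<tau>'. H (\<omega>, \<tau>') \<partial>ext_lebesgue b)"
    by (rule bounded_borel_integral[OF H]) auto
  have m: "(\<lambda>p :: (real \<times> real) \<times> real. ((fst (fst p), snd p), snd (fst p))) \<in> borel_measurable borel"
    by (intro borel_measurable_continuous_onI continuous_intros)
  have 2: "bounded_borel (\<lambda>\<omega>. \<integral>\<tau>. H ((fst \<omega>, \<tau>), snd \<omega>) \<partial>ext_lebesgue b)"
    using bounded_borel_integral[OF bounded_borel_compose[OF H m], of "ext_lebesgue b"] by simp
  have m: "(\<lambda>p :: real \<times> real. ((\<sigma>, fst p), snd p)) \<in> borel_measurable borel" for \<sigma>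
    by (intro borel_measurable_continuous_onI continuous_intros)
  have 3: "bounded_borel (\<lambda>p. H ((\<sigma>, fst p), snd p))" for \<sigma>
    by (rule bounded_borel_compose[OF H m])
  have 4: "(\<integral>\<tau>. \<integral>\<tau>'. H ((\<sigma>, \<tau>), \<tau>') \<partial>ext_lebesgue b \<partial>ext_lebesgue b) =
      (\<integral>\<tau>'. \<integral>\<tau>. H ((\<sigma>, \<tau>), \<tau>') \<partial>ext_lebesgue b \<partial>ext_lebesgue b)" for \<sigma>
    using integral_ext_plane[OF 3[of \<sigma>], of b b] integral_ext_plane'[OF 3[of \<sigma>], of b b] by simp
  have "(\<integral>\<omega>. (\<integral>\<tau>'. H (\<omega>, \<tau>') \<partial>ext_lebesgue b) \<partial>ext_plane a b) =
    (\<integral>\<sigma>. \<integral>\<tau>. \<integral>\<tau>'. H ((\<sigma>, \<tau>), \<tau>') \<partial>ext_lebesgue b \<partial>ext_lebesgue b \<partial>ext_lebesgue a)"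
    by (rule integral_ext_plane[OF 1])
  also have "\<dots> = (\<integral>\<sigma>. \<integral>\<tau>'. \<integral>\<tau>. H ((\<sigma>, \<tau>), \<tau>') \<partial>ext_lebesgue b \<partial>ext_lebesgue b \<partial>ext_lebesgue a)"
    unfolding 4 ..
  also have "\<dots> = (\<integral>\<omega>. (\<integral>\<tau>. H ((fst \<omega>, \<tau>), snd \<omega>) \<partial>ext_lebesgue b) \<partial>ext_plane a b)"
    using integral_ext_plane[OF 2, of a b] by simp
  finally show ?thesis .
qed

lemma integral_swap_both:
  fixes H :: "(real \<times> real) \<times> (real \<times> real) \<Rightarrow> real"
  assumes H: "bounded_borel H"
  shows "(\<integral>\<omega>. (\<integral>\<omega>'. H (\<omega>, \<omega>') \<partial>ext_plane a b) \<partial>ext_plane a b) =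
    (\<integral>\<omega>'. (\<integral>\<omega>. H (\<omega>, \<omega>') \<partial>ext_plane a b) \<partial>ext_plane a b)"
proof -
  interpret pair_sigma_finite "ext_plane a b" "ext_plane a b"
    unfolding pair_sigma_finite_def by (simp add: finite_measure.axioms(1))
  have s: "sets (ext_plane a b \<Otimes>\<^sub>M ext_plane a b) = sets borel"
    by (subst borel_prod[symmetric], rule sets_pair_measure_cong) auto
  have f: "finite_measure (ext_plane a b \<Otimes>\<^sub>M ext_plane a b)"
    by (intro finite_measure_pair_measure) auto
  have "integrable (ext_plane a b \<Otimes>\<^sub>M ext_plane a b) (\<lambda>(\<omega>, \<omega>'). H (\<omega>, \<omega>'))"
    using integrable_bounded_borel[OF f s H] by simp
  from Fubini_integral[OF this] show ?thesis by simp
qed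

lemma pred_nonneg: "Measurable.pred borel (\<lambda>x::real. 0 \<le> x)"
  by measurable

text \<open>
  The three classes of sources, corresponding to the kernels \<open>f1\<close>, \<open>f2\<close> and \<open>f12\<close>.  They need different
  exchanges of the order of integration, so they are separated here.
\<close>

lemma integral_plane_classes:
  fixes f :: "real \<times> real \<Rightarrow> real"
  assumes f: "bounded_borel f" and a: "0 \<le> a" and b: "0 \<le> b"
    and 0: "\<And>\<sigma> \<tau>. \<sigma> < 0 \<Longrightarrow> \<tau> < 0 \<Longrightarrow> f (\<sigma>, \<tau>) = 0"
    and 1: "\<And>\<sigma> \<tau>. \<sigma> < 0 \<Longrightarrow> f (\<sigma>, \<tau>) = f (-1, \<tau>)"
    and 2: "\<And>\<sigma> \<tau>. \<tau> < 0 \<Longrightarrow> f (\<sigma>, \<tau>) = f (\<sigma>, -1)"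
  shows "(\<integral>\<omega>. f \<omega> \<partial>ext_plane a b) =
     (\<integral>\<sigma>. (if 0 \<le> \<sigma> then f (\<sigma>, -1) else 0) \<partial>ext_lebesgue a) +
     (\<integral>\<tau>. (if 0 \<le> \<tau> then f (-1, \<tau>) else 0) \<partial>ext_lebesgue b) +
     (\<integral>\<omega>. (if 0 \<le> fst \<omega> \<and> 0 \<le> snd \<omega> then f \<omega> else 0) \<partial>ext_plane a b)"
proof -
  let ?n = "\<lambda>\<sigma>::real. if \<sigma> < 0 then 1 else 0 :: real"
  have n: "bounded_borel ?n" by (rule bounded_borelI[where C=1]) auto
  have nint: "(\<integral>\<sigma>. ?n \<sigma> \<partial>ext_lebesgue a) = 1" if "0 \<le> a" for a
  proof -
    have "(\<integral>\<sigma>. ?n \<sigma> \<partial>ext_lebesgue a) = ?n (-1) + (LBINT \<sigma>:{0..a}. ?n \<sigma>)"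
      by (rule integral_ext_lebesgue[OF n _ that]) auto
    also have "(LBINT \<sigma>:{0..a}. ?n \<sigma>) = (LBINT \<sigma>:({} :: real set). 0::real)" by (rule set_integral_shrink) auto
    finally show ?thesis by simp
  qed
  let ?f1 = "\<lambda>\<sigma>. if 0 \<le> \<sigma> then f (\<sigma>, -1) else 0" and ?f2 = "\<lambda>\<tau>. if 0 \<le> \<tau> then f (-1, \<tau>) else 0"
  let ?f3 = "\<lambda>\<omega>. if 0 \<le> fst \<omega> \<and> 0 \<le> snd \<omega> then f \<omega> else 0"
  have b1: "bounded_borel ?f1" by (rule bounded_borel_if[OF bounded_borel_section1[OF f] pred_nonneg])
  have b2: "bounded_borel ?f2" by (rule bounded_borel_if[OF bounded_borel_section2[OF f] pred_nonneg])
  have [measurable]: "fst \<in> borel_measurable (borel :: (real \<times> real) measure)"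
    "snd \<in> borel_measurable (borel :: (real \<times> real) measure)"
    by (intro borel_measurable_continuous_onI continuous_intros)+
  have b3: "bounded_borel ?f3" by (rule bounded_borel_if[OF f]) measurable
  note p1 = integral_ext_plane_prod[OF b1 n] and p2 = integral_ext_plane_prod[OF n b2]
  have "f \<omega> = ?f1 (fst \<omega>) * ?n (snd \<omega>) + ?n (fst \<omega>) * ?f2 (snd \<omega>) + ?f3 \<omega>" for \<omega>
    using 0[of "fst \<omega>" "snd \<omega>"] 0[of "fst \<omega>" "-1"] 1[of "fst \<omega>" "snd \<omega>"] 2[of "snd \<omega>" "fst \<omega>"] by simp
  then have "(\<integral>\<omega>. f \<omega> \<partial>ext_plane a b) =
      (\<integral>\<omega>. ?f1 (fst \<omega>) * ?n (snd \<omega>) + ?n (fst \<omega>) * ?f2 (snd \<omega>) + ?f3 \<omega> \<partial>ext_plane a b)"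
    by (intro Bochner_Integration.integral_cong refl) blast
  also have "\<dots> = (\<integral>\<omega>. ?f1 (fst \<omega>) * ?n (snd \<omega>) \<partial>ext_plane a b)
       + (\<integral>\<omega>. ?n (fst \<omega>) * ?f2 (snd \<omega>) \<partial>ext_plane a b) + (\<integral>\<omega>. ?f3 \<omega> \<partial>ext_plane a b)"
    by (subst Bochner_Integration.integral_add[OF Bochner_Integration.integrable_add[OF
          integrable_plane[OF p1(2)] integrable_plane[OF p2(2)]] integrable_plane[OF b3]],
        subst Bochner_Integration.integral_add[OF integrable_plane[OF p1(2)] integrable_plane[OF p2(2)]]) simp
  finally show ?thesis unfolding p1(1) p2(1) nint[OF a] nint[OF b] by simp
qed

locale controlled_path =
  fixes P :: "('n::finite, 'a::euclidean_space, 'b::euclidean_space, 'c::euclidean_space) problem"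
    and u1 :: "real \<Rightarrow> 'a" and u2 :: "real \<Rightarrow> 'b" and u12 :: "real \<Rightarrow> real \<Rightarrow> 'c"
    and z :: "real \<times> real \<Rightarrow> real^'n"
  assumes reg: "regular_problem P" and ind: "f0_f1_f2_indep_u12 P"
    and mc: "measurable_controls P u1 u2 u12" and z: "bounded_borel z"
    and fx: "volterra P (ctrl P u1 u2 u12) z = z"
begin

abbreviation U where "U \<equiv> ctrl P u1 u2 u12"
abbreviation rho where "rho \<equiv> src (corner P)"

definition lin_kern :: "real \<times> real \<Rightarrow> real \<times> real \<Rightarrow> real^'n \<Rightarrow> real^'n" where
  "lin_kern x \<omega> = state_deriv (kern P (x, \<omega>)) (z (src x \<omega>), U (src x \<omega>))"

definition lin_cost :: "real \<times> real \<Rightarrow> real^'n \<Rightarrow> real" where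
  "lin_cost \<omega> = state_deriv (fcost P \<omega>) (z (rho \<omega>), U (rho \<omega>))"

lemma U: "U \<in> borel_measurable borel" by (rule ctrl_measurable[OF mc])

lemma AB: "endA P > 0" "endB P > 0" using reg by (auto simp: regular_problem_def)

text \<open>
  The co-state equations in weak form: at \<open>\<omega>\<close>, the derivative of the cost density plus what the
  receivers \<open>\<omega>'\<close> that depend on the source \<open>\<omega>\<close> through \<open>f1\<close>, \<open>f2\<close> and \<open>f12\<close> contribute.  A kernel with
  coordinate \<open>-1\<close> is one whose coordinate is not integrated.
\<close>

definition adjoint_rhs :: "(real \<times> real \<Rightarrow> real^'n) \<Rightarrow> real \<times> real \<Rightarrow> real^'n \<Rightarrow> real" where
  "adjoint_rhs \<Psi> \<omega> h = lin_cost \<omega> h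
     + (if 0 \<le> fst \<omega> then (\<integral>\<sigma>. \<Psi> (\<sigma>, snd \<omega>) \<bullet> lin_kern (rho (\<sigma>, snd \<omega>)) (fst \<omega>, -1) h \<partial>ext_lebesgue (endA P)) else 0)
     + (if 0 \<le> snd \<omega> then (\<integral>\<tau>. \<Psi> (fst \<omega>, \<tau>) \<bullet> lin_kern (rho (fst \<omega>, \<tau>)) (-1, snd \<omega>) h \<partial>ext_lebesgue (endB P)) else 0)
     + (if 0 \<le> fst \<omega> \<and> 0 \<le> snd \<omega> then (\<integral>\<omega>'. \<Psi> \<omega>' \<bullet> lin_kern (rho \<omega>') \<omega> h \<partial>plane P) else 0)"

definition adjoint :: "(real \<times> real \<Rightarrow> real^'n) \<Rightarrow> bool" where
  "adjoint \<Psi> \<longleftrightarrow> (AE \<omega> in plane P. \<forall>h. \<Psi> \<omega> \<bullet> h = adjoint_rhs \<Psi> \<omega> h)"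

lemma lin_kern_zero: "fst \<omega> < 0 \<Longrightarrow> snd \<omega> < 0 \<Longrightarrow> lin_kern x \<omega> h = 0"
proof -
  assume w: "fst \<omega> < 0" "snd \<omega> < 0"
  let ?v = "(z (src x \<omega>), U (src x \<omega>))"
  have "state_deriv (kern P (x, \<omega>)) ?v = state_deriv (\<lambda>v. kern P (x, \<omega>) (0, snd ?v)) ?v"
    by (intro state_deriv_eqI) (simp, rule kern_const_in_state[OF w])
  also have "\<dots> = (\<lambda>h. 0)" by (simp add: state_deriv_def frechet_derivative_const)
  finally show ?thesis by (simp add: lin_kern_def)
qed

lemma bounded_borel_lin_kern:
  assumes \<delta>: "bounded_borel \<delta>"
  shows "bounded_borel (\<lambda>(x, \<omega>). lin_kern x \<omega> (\<delta> (src x \<omega>)))"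
    and "bounded_borel (\<lambda>\<omega>. lin_cost \<omega> (\<delta> (rho \<omega>)))"
  using C1_family_compose(2)[OF C1_family_kern[OF reg] z U ident_borel src_measurable \<delta>]
    C1_family_compose(2)[OF C1_family_fcost[OF reg] z U ident_borel src_corner_measurable \<delta>]
  by (simp_all add: lin_kern_def lin_cost_def case_prod_unfold)

text \<open>
  For \<open>\<delta>\<close> the difference of two states, the bracket on the left is what remains of it after
  linearization.  Each of the three classes of sources yields, after its exchange of integrals, one of the
  three integral terms in \<open>adjoint_rhs\<close>.
\<close>

lemma adjoint_identity:
  assumes \<Psi>: "bounded_borel \<Psi>" "adjoint \<Psi>" and \<delta>: "bounded_borel \<delta>"
  shows "(\<integral>\<omega>. \<Psi> \<omega> \<bullet> (\<delta> (rho \<omega>) - (\<integral>\<omega>'. lin_kern (rho \<omega>) \<omega>' (\<delta> (src (rho \<omega>) \<omega>')) \<partial>plane P)) \<partial>plane P)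
    = (\<integral>\<omega>. lin_cost \<omega> (\<delta> (rho \<omega>)) \<partial>plane P)"
proof -
  let ?A = "endA P" and ?B = "endB P"
  define k where "k = (\<lambda>(\<omega>, \<omega>'). lin_kern (rho \<omega>) \<omega>' (\<delta> (src (rho \<omega>) \<omega>')))"
  define G where "G = (\<lambda>(\<omega>, \<omega>'). \<Psi> \<omega> \<bullet> k (\<omega>, \<omega>'))"
  have m: "fst \<in> borel_measurable (borel :: ((real \<times> real) \<times> (real \<times> real)) measure)"
    "snd \<in> borel_measurable (borel :: ((real \<times> real) \<times> (real \<times> real)) measure)"
    by (intro borel_measurable_continuous_onI continuous_intros)+
  have m2: "(\<lambda>p :: (real \<times> real) \<times> (real \<times> real). (rho (fst p), snd p)) \<in> borel_measurable borel"
    by (intro borel_measurable_Pair m measurable_compose[OF m(1) src_corner_measurable])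
  have k: "bounded_borel k"
    using bounded_borel_compose[OF bounded_borel_lin_kern(1)[OF \<delta>] m2] by (simp add: k_def case_prod_unfold)
  have G: "bounded_borel G"
    using bounded_borel_inner[OF bounded_borel_compose[OF \<Psi>(1) m(1)] k] by (simp add: G_def case_prod_unfold)
  have G0: "G (\<omega>, (\<sigma>, \<tau>)) = 0" if "\<sigma> < 0" "\<tau> < 0" for \<omega> \<sigma> \<tau>
    using that by (simp add: G_def k_def lin_kern_zero)
  have G1: "G (\<omega>, (\<sigma>, \<tau>)) = G (\<omega>, (-1, \<tau>))" if "\<sigma> < 0" for \<omega> \<sigma> \<tau>
  proof -
    have "kern P (rho \<omega>, \<sigma>, \<tau>) = kern P (rho \<omega>, -1, \<tau>)" using that by (auto simp: kern_def split: prod.splits)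
    then show ?thesis using that by (simp add: G_def k_def lin_kern_def src_def)
  qed
  have G2: "G (\<omega>, (\<sigma>, \<tau>)) = G (\<omega>, (\<sigma>, -1))" if "\<tau> < 0" for \<omega> \<sigma> \<tau>
  proof -
    have "kern P (rho \<omega>, \<sigma>, \<tau>) = kern P (rho \<omega>, \<sigma>, -1)" using that by (auto simp: kern_def split: prod.splits)
    then show ?thesis using that by (simp add: G_def k_def lin_kern_def src_def)
  qed
  have mfs: "fst \<in> borel_measurable (borel :: (real \<times> real) measure)"
    "snd \<in> borel_measurable (borel :: (real \<times> real) measure)"
    "(\<lambda>p::(real \<times> real) \<times> real. snd p) \<in> borel_measurable borel"
    "(\<lambda>p::(real \<times> real) \<times> (real \<times> real). fst (snd p)) \<in> borel_measurable borel"
    "(\<lambda>p::(real \<times> real) \<times> (real \<times> real). snd (snd p)) \<in> borel_measurable borel"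
    "(\<lambda>p::(real \<times> real) \<times> real. (fst p, (snd p, -1::real))) \<in> borel_measurable borel"
    "(\<lambda>p::(real \<times> real) \<times> real. (fst p, (-1::real, snd p))) \<in> borel_measurable borel"
    by (intro borel_measurable_continuous_onI continuous_intros)+
  define H1 where "H1 = (\<lambda>p. if 0 \<le> snd p then G (fst p, (snd p, -1)) else 0)"
  define H2 where "H2 = (\<lambda>p. if 0 \<le> snd p then G (fst p, (-1, snd p)) else 0)"
  define H3 where "H3 = (\<lambda>p. if 0 \<le> fst (snd p) \<and> 0 \<le> snd (snd p) then G p else 0)"
  have H1: "bounded_borel H1" unfolding H1_def
    by (rule bounded_borel_if[OF bounded_borel_compose[OF G mfs(6)] measurable_compose[OF mfs(3) pred_nonneg]])
  have H2: "bounded_borel H2" unfolding H2_def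
    by (rule bounded_borel_if[OF bounded_borel_compose[OF G mfs(7)] measurable_compose[OF mfs(3) pred_nonneg]])
  have H3: "bounded_borel H3" unfolding H3_def
    by (rule bounded_borel_if[OF G pred_intros_logic(3)[OF measurable_compose[OF mfs(4) pred_nonneg]
          measurable_compose[OF mfs(5) pred_nonneg]]])
  let ?N1 = "ext_lebesgue ?A" and ?N2 = "ext_lebesgue ?B"
  have split: "(\<integral>\<omega>'. G (\<omega>, \<omega>') \<partial>plane P) =
      (\<integral>\<sigma>'. H1 (\<omega>, \<sigma>') \<partial>?N1) + (\<integral>\<tau>'. H2 (\<omega>, \<tau>') \<partial>?N2) + (\<integral>\<omega>'. H3 (\<omega>, \<omega>') \<partial>plane P)" for \<omega>
    unfolding H1_def H2_def H3_def fst_conv snd_conv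
    by (rule integral_plane_classes[OF bounded_borel_section2[OF G] _ _ G0 G1 G2]) (use AB in simp_all)
  have m1: "(\<lambda>p :: (real \<times> real) \<times> real. ((snd p, snd (fst p)), fst (fst p))) \<in> borel_measurable borel"
     "(\<lambda>p :: (real \<times> real) \<times> real. ((fst (fst p), snd p), snd (fst p))) \<in> borel_measurable borel"
     "(\<lambda>p :: (real \<times> real) \<times> (real \<times> real). (snd p, fst p)) \<in> borel_measurable borel"
    by (intro borel_measurable_continuous_onI continuous_intros)+
  have bI: "bounded_borel (\<lambda>\<omega>. \<integral>\<sigma>'. H1 (\<omega>, \<sigma>') \<partial>?N1)" "bounded_borel (\<lambda>\<omega>. \<integral>\<tau>'. H2 (\<omega>, \<tau>') \<partial>?N2)"
    "bounded_borel (\<lambda>\<omega>. \<integral>\<omega>'. H3 (\<omega>, \<omega>') \<partial>plane P)"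
    by (rule bounded_borel_integral[OF H1] bounded_borel_integral[OF H2] bounded_borel_integral[OF H3]; simp)+
  let ?J1 = "\<lambda>\<omega>. \<integral>\<sigma>. H1 ((\<sigma>, snd \<omega>), fst \<omega>) \<partial>?N1" and ?J2 = "\<lambda>\<omega>. \<integral>\<tau>. H2 ((fst \<omega>, \<tau>), snd \<omega>) \<partial>?N2"
  let ?J3 = "\<lambda>\<omega>'. \<integral>\<omega>. H3 (\<omega>, \<omega>') \<partial>plane P"
  have bJ: "bounded_borel ?J1" "bounded_borel ?J2" "bounded_borel ?J3"
    using bounded_borel_integral[OF bounded_borel_compose[OF H1 m1(1)], of ?N1]
      bounded_borel_integral[OF bounded_borel_compose[OF H2 m1(2)], of ?N2]
      bounded_borel_integral[OF bounded_borel_compose[OF H3 m1(3)], of "plane P"] by simp_all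
  have b\<delta>: "bounded_borel (\<lambda>\<omega>. \<Psi> \<omega> \<bullet> \<delta> (rho \<omega>))"
    by (intro bounded_borel_inner \<Psi> bounded_borel_compose[OF \<delta>] src_corner_measurable)
  have bK: "bounded_borel (\<lambda>\<omega>. \<integral>\<omega>'. G (\<omega>, \<omega>') \<partial>plane P)" by (rule bounded_borel_integral[OF G]) auto
  have "(\<integral>\<omega>. \<integral>\<omega>'. G (\<omega>, \<omega>') \<partial>plane P \<partial>plane P) =
      (\<integral>\<omega>. \<integral>\<sigma>'. H1 (\<omega>, \<sigma>') \<partial>?N1 \<partial>plane P) + (\<integral>\<omega>. \<integral>\<tau>'. H2 (\<omega>, \<tau>') \<partial>?N2 \<partial>plane P)
      + (\<integral>\<omega>. \<integral>\<omega>'. H3 (\<omega>, \<omega>') \<partial>plane P \<partial>plane P)"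
    unfolding split using bI by (simp add: integrable_plane)
  also have "\<dots> = (\<integral>\<omega>. ?J1 \<omega> \<partial>plane P) + (\<integral>\<omega>. ?J2 \<omega> \<partial>plane P) + (\<integral>\<omega>. ?J3 \<omega> \<partial>plane P)"
    by (simp add: integral_swap_first[OF H1] integral_swap_second[OF H2] integral_swap_both[OF H3])
  also have "\<dots> = (\<integral>\<omega>. ?J1 \<omega> + ?J2 \<omega> + ?J3 \<omega> \<partial>plane P)"
    using bJ by (simp add: integrable_plane)
  finally have main: "(\<integral>\<omega>. \<integral>\<omega>'. G (\<omega>, \<omega>') \<partial>plane P \<partial>plane P) = (\<integral>\<omega>. ?J1 \<omega> + ?J2 \<omega> + ?J3 \<omega> \<partial>plane P)" .
  have J1: "?J1 \<omega> = (if 0 \<le> fst \<omega> then (\<integral>\<sigma>. \<Psi> (\<sigma>, snd \<omega>) \<bullet> lin_kern (rho (\<sigma>, snd \<omega>)) (fst \<omega>, -1) (\<delta> (rho \<omega>)) \<partial>?N1) else 0)" for \<omega>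
    by (auto simp: H1_def G_def k_def src_def)
  have J2: "?J2 \<omega> = (if 0 \<le> snd \<omega> then (\<integral>\<tau>. \<Psi> (fst \<omega>, \<tau>) \<bullet> lin_kern (rho (fst \<omega>, \<tau>)) (-1, snd \<omega>) (\<delta> (rho \<omega>)) \<partial>?N2) else 0)" for \<omega>
    by (auto simp: H2_def G_def k_def src_def)
  have J3: "?J3 \<omega> = (if 0 \<le> fst \<omega> \<and> 0 \<le> snd \<omega> then (\<integral>\<omega>'. \<Psi> \<omega>' \<bullet> lin_kern (rho \<omega>') \<omega> (\<delta> (rho \<omega>)) \<partial>plane P) else 0)" for \<omega>
    by (auto simp: H3_def G_def k_def src_def)
  have ae: "AE \<omega> in plane P. \<Psi> \<omega> \<bullet> \<delta> (rho \<omega>) - (?J1 \<omega> + ?J2 \<omega> + ?J3 \<omega>) = lin_cost \<omega> (\<delta> (rho \<omega>))"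
    using \<Psi>(2) unfolding adjoint_def
  proof (rule eventually_mono)
    fix \<omega> assume A: "\<forall>h. \<Psi> \<omega> \<bullet> h = adjoint_rhs \<Psi> \<omega> h"
    show "\<Psi> \<omega> \<bullet> \<delta> (rho \<omega>) - (?J1 \<omega> + ?J2 \<omega> + ?J3 \<omega>) = lin_cost \<omega> (\<delta> (rho \<omega>))"
      unfolding J1 J2 J3 A[rule_format, of "\<delta> (rho \<omega>)"] adjoint_rhs_def by simp
  qed
  have inner: "\<Psi> \<omega> \<bullet> (\<delta> (rho \<omega>) - (\<integral>\<omega>'. lin_kern (rho \<omega>) \<omega>' (\<delta> (src (rho \<omega>) \<omega>')) \<partial>plane P)) =
     \<Psi> \<omega> \<bullet> \<delta> (rho \<omega>) - (\<integral>\<omega>'. G (\<omega>, \<omega>') \<partial>plane P)" for \<omega>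
    using integrable_plane[OF bounded_borel_section2[OF k, of \<omega>], of ?A ?B]
    by (simp add: inner_diff_right G_def k_def)
  have "(\<integral>\<omega>. \<Psi> \<omega> \<bullet> (\<delta> (rho \<omega>) - (\<integral>\<omega>'. lin_kern (rho \<omega>) \<omega>' (\<delta> (src (rho \<omega>) \<omega>')) \<partial>plane P)) \<partial>plane P)
    = (\<integral>\<omega>. \<Psi> \<omega> \<bullet> \<delta> (rho \<omega>) \<partial>plane P) - (\<integral>\<omega>. \<integral>\<omega>'. G (\<omega>, \<omega>') \<partial>plane P \<partial>plane P)"
    unfolding inner by (rule Bochner_Integration.integral_diff[OF integrable_plane[OF b\<delta>] integrable_plane[OF bK]])
  also have "\<dots> = (\<integral>\<omega>. \<Psi> \<omega> \<bullet> \<delta> (rho \<omega>) - (?J1 \<omega> + ?J2 \<omega> + ?J3 \<omega>) \<partial>plane P)"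
    unfolding main
    by (rule Bochner_Integration.integral_diff[symmetric]) (intro integrable_plane b\<delta> bounded_borel_add bJ)+
  also have "\<dots> = (\<integral>\<omega>. lin_cost \<omega> (\<delta> (rho \<omega>)) \<partial>plane P)"
    using bounded_borel_measurable[OF bounded_borel_add(2)[OF b\<delta> bounded_borel_add(1)[OF bounded_borel_add(1)[OF bJ(1,2)] bJ(3)]]]
      bounded_borel_measurable[OF bounded_borel_lin_kern(2)[OF \<delta>]]
    by (intro integral_cong_AE ae) simp_all
  finally show ?thesis .
qed

end

section \<open>Needle variations\<close>

text \<open>
  Off \<open>Q\<close> both controls act in the same way, so the error is a first-order remainder and small relative
  to \<open>D\<close>.  On \<open>Q\<close> the derivative is taken along the wrong control; this costs a full multiple of \<open>D\<close>,
  but only over the measure of \<open>Q\<close>, so it is of second order when \<open>D\<close> itself is of the order of that measure.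
\<close>

lemma C1_family_variation:
  fixes \<Phi> :: "'i::euclidean_space \<Rightarrow> (real^'n::finite) \<times> 'u::euclidean_space \<Rightarrow> 'w::euclidean_space"
    and z z' :: "real \<times> real \<Rightarrow> real^'n" and U U' :: "real \<times> real \<Rightarrow> 'u"
    and i :: "real \<times> real \<Rightarrow> 'i" and \<pi> :: "real \<times> real \<Rightarrow> real \<times> real"
  assumes \<Phi>: "C1_family \<Phi>" and z: "bounded_borel z" "bounded_borel z'"
    and U: "U \<in> borel_measurable borel" "U' \<in> borel_measurable borel"
    and i: "i \<in> borel_measurable borel" and \<pi>: "\<pi> \<in> borel_measurable borel"
    and Q: "Q \<in> sets borel"
    and R: "\<And>x. norm (z x) \<le> R"
    and C: "0 \<le> C" "\<And>i v h. norm (fst v) \<le> R \<Longrightarrow> norm (state_deriv (\<Phi> i) v h) \<le> C * norm h"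
    and e: "0 \<le> e" "e \<le> 1"
    and rem: "\<And>i v h. norm (fst v) \<le> R \<Longrightarrow> norm h \<le> d \<Longrightarrow>
        norm (\<Phi> i (fst v + h, snd v) - \<Phi> i v - state_deriv (\<Phi> i) v h) \<le> e * norm h"
    and D: "\<And>x. norm (z' x - z x) \<le> D" "D \<le> d"
    and off: "\<And>\<omega> \<eta>. \<omega> \<notin> Q \<Longrightarrow> \<Phi> (i \<omega>) (\<eta>, U' (\<pi> \<omega>)) = \<Phi> (i \<omega>) (\<eta>, U (\<pi> \<omega>))"
  shows "norm ((\<integral>\<omega>. \<Phi> (i \<omega>) (z' (\<pi> \<omega>), U' (\<pi> \<omega>)) \<partial>ext_plane a b) - (\<integral>\<omega>. \<Phi> (i \<omega>) (z (\<pi> \<omega>), U (\<pi> \<omega>)) \<partial>ext_plane a b)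
      - (\<integral>\<omega>. state_deriv (\<Phi> (i \<omega>)) (z (\<pi> \<omega>), U (\<pi> \<omega>)) (z' (\<pi> \<omega>) - z (\<pi> \<omega>)) \<partial>ext_plane a b)
      - (\<integral>\<omega>. (if \<omega> \<in> Q then \<Phi> (i \<omega>) (z (\<pi> \<omega>), U' (\<pi> \<omega>)) - \<Phi> (i \<omega>) (z (\<pi> \<omega>), U (\<pi> \<omega>)) else 0) \<partial>ext_plane a b))
     \<le> e * D * measure (ext_plane a b) UNIV + (2 * C + 1) * D * measure (ext_plane a b) Q"
proof -
  let ?N = "ext_plane a b"
  interpret N: finite_measure ?N by simp
  let ?g' = "\<lambda>\<omega>. \<Phi> (i \<omega>) (z' (\<pi> \<omega>), U' (\<pi> \<omega>))" and ?g = "\<lambda>\<omega>. \<Phi> (i \<omega>) (z (\<pi> \<omega>), U (\<pi> \<omega>))"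
  let ?\<delta> = "\<lambda>x. z' x - z x"
  let ?k = "\<lambda>\<omega>. state_deriv (\<Phi> (i \<omega>)) (z (\<pi> \<omega>), U (\<pi> \<omega>)) (?\<delta> (\<pi> \<omega>))"
  let ?D = "\<lambda>\<omega>. if \<omega> \<in> Q then \<Phi> (i \<omega>) (z (\<pi> \<omega>), U' (\<pi> \<omega>)) - ?g \<omega> else 0"
  have \<delta>: "bounded_borel ?\<delta>" by (rule bounded_borel_add(2)[OF z(2,1)])
  have bg': "bounded_borel ?g'" by (rule C1_family_compose(1)[OF \<Phi> z(2) U(2) i \<pi>])
  have bg: "bounded_borel ?g" by (rule C1_family_compose(1)[OF \<Phi> z(1) U(1) i \<pi>])
  have bk: "bounded_borel ?k" by (rule C1_family_compose(2)[OF \<Phi> z(1) U(1) i \<pi> \<delta>])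
  have bD: "bounded_borel ?D"
    by (rule bounded_borel_if[OF bounded_borel_add(2)[OF C1_family_compose(1)[OF \<Phi> z(1) U(2) i \<pi>] bg]])
       (use Q in simp)
  have D0: "0 \<le> D" using D(1)[of undefined] norm_ge_zero order_trans by blast
  have pt: "norm (?g' \<omega> - ?g \<omega> - ?k \<omega> - ?D \<omega>) \<le> e * D + (2 * C + 1) * D * indicator Q \<omega>" for \<omega>
  proof -
    let ?v = "(z (\<pi> \<omega>), U (\<pi> \<omega>))" and ?v' = "(z (\<pi> \<omega>), U' (\<pi> \<omega>))" and ?h = "?\<delta> (\<pi> \<omega>)"
    have h: "norm ?h \<le> d" and hD: "norm ?h \<le> D" using D order_trans by blast+
    have eh: "e * norm ?h \<le> e * D" using hD e by (intro mult_left_mono)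
    show ?thesis
    proof (cases "\<omega> \<in> Q")
      case False
      have eq: "?g' \<omega> - ?g \<omega> - ?k \<omega> - ?D \<omega> = \<Phi> (i \<omega>) (fst ?v + ?h, snd ?v) - \<Phi> (i \<omega>) ?v - state_deriv (\<Phi> (i \<omega>)) ?v ?h"
        using False off[OF False] by simp
      have "norm (?g' \<omega> - ?g \<omega> - ?k \<omega> - ?D \<omega>) \<le> e * norm ?h" unfolding eq by (rule rem) (use R h in auto)
      then show ?thesis using eh False by simp
    next
      case True
      have eq: "?g' \<omega> - ?g \<omega> - ?k \<omega> - ?D \<omega> =
         (\<Phi> (i \<omega>) (fst ?v' + ?h, snd ?v') - \<Phi> (i \<omega>) ?v' - state_deriv (\<Phi> (i \<omega>)) ?v' ?h)
          + (state_deriv (\<Phi> (i \<omega>)) ?v' ?h - state_deriv (\<Phi> (i \<omega>)) ?v ?h)"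
        using True by simp
      have "norm (?g' \<omega> - ?g \<omega> - ?k \<omega> - ?D \<omega>) \<le> e * norm ?h + (C * norm ?h + C * norm ?h)"
        unfolding eq
      proof (rule order_trans[OF norm_triangle_ineq], rule add_mono)
        show "norm (\<Phi> (i \<omega>) (fst ?v' + ?h, snd ?v') - \<Phi> (i \<omega>) ?v' - state_deriv (\<Phi> (i \<omega>)) ?v' ?h) \<le> e * norm ?h"
          by (rule rem) (use R h in auto)
        show "norm (state_deriv (\<Phi> (i \<omega>)) ?v' ?h - state_deriv (\<Phi> (i \<omega>)) ?v ?h) \<le> C * norm ?h + C * norm ?h"
          by (rule order_trans[OF norm_triangle_ineq4], rule add_mono; rule C(2)) (use R in auto)
      qed
      also have "\<dots> \<le> 1 * D + (C * D + C * D)"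
        using e C(1) hD D0 by (intro add_mono mult_mono) auto
      also have "\<dots> = (2 * C + 1) * D" by (simp add: algebra_simps)
      finally show ?thesis using True e D0 by (simp add: add_increasing)
    qed
  qed
  have int: "integrable ?N (\<lambda>\<omega>. e * D + (2 * C + 1) * D * indicator Q \<omega>)"
    using Q by (intro Bochner_Integration.integrable_add integrable_mult_right N.integrable_const)
      (auto intro!: N.integrable_const_bound[where B=1] simp: indicator_def)
  have eq: "(\<integral>\<omega>. ?g' \<omega> \<partial>?N) - (\<integral>\<omega>. ?g \<omega> \<partial>?N) - (\<integral>\<omega>. ?k \<omega> \<partial>?N) - (\<integral>\<omega>. ?D \<omega> \<partial>?N) =
      (\<integral>\<omega>. ?g' \<omega> - ?g \<omega> - ?k \<omega> - ?D \<omega> \<partial>?N)"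
    using integrable_plane[OF bg'] integrable_plane[OF bg] integrable_plane[OF bk] integrable_plane[OF bD] by simp
  have "norm (\<integral>\<omega>. ?g' \<omega> - ?g \<omega> - ?k \<omega> - ?D \<omega> \<partial>?N) \<le> (\<integral>\<omega>. norm (?g' \<omega> - ?g \<omega> - ?k \<omega> - ?D \<omega>) \<partial>?N)" by (rule integral_norm_bound)
  also have "\<dots> \<le> (\<integral>\<omega>. e * D + (2 * C + 1) * D * indicator Q \<omega> \<partial>?N)"
    by (rule integral_mono[OF integrable_norm int pt])
       (intro integrable_plane bounded_borel_add(2) bg' bg bk bD)
  also have "\<dots> = e * D * measure ?N UNIV + (2 * C + 1) * D * measure ?N Q"
  proof -
    have "integrable ?N (indicator Q :: _ \<Rightarrow> real)"
      using Q by (intro N.integrable_const_bound[where B=1]) (auto simp: indicator_def)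
    moreover have "(\<integral>\<omega>. indicator Q \<omega> \<partial>?N) = measure ?N Q" using Q by simp
    ultimately show ?thesis
      by (subst Bochner_Integration.integral_add) (simp_all add: mult.commute)
  qed
  finally show ?thesis unfolding eq .
qed

context controlled_path
begin

text \<open>
  Having the value \<open>w\<close> on the whole rectangle, it makes the increment \<open>hvar\<close> a function that does not
  refer to \<open>Q\<close>.
\<close>

definition flat :: "'c \<Rightarrow> real \<times> real \<Rightarrow> 'a \<times> 'b \<times> 'c" where
  "flat w = ctrl P u1 u2 (\<lambda>_ _. w)"

definition needle :: "'c \<Rightarrow> (real \<times> real) set \<Rightarrow> real \<times> real \<Rightarrow> 'a \<times> 'b \<times> 'c" where
  "needle w Q x = (if x \<in> Q then flat w x else U x)"

lemma needle_eq_ctrl: "needle w Q = ctrl P u1 u2 (\<lambda>s t. if (s, t) \<in> Q then w else u12 s t)"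
  by (auto simp: needle_def flat_def ctrl_def fun_eq_iff)

lemma flat_measurable: "w \<in> U12 P \<Longrightarrow> flat w \<in> borel_measurable borel"
  unfolding flat_def using mc by (intro ctrl_measurable) (auto simp: measurable_controls_def)

lemma needle_measurable: "w \<in> U12 P \<Longrightarrow> Q \<in> sets borel \<Longrightarrow> needle w Q \<in> borel_measurable borel"
  unfolding needle_def[abs_def] using U flat_measurable by (intro measurable_If) auto

text \<open>
  The one place where independence of \<open>u12\<close> enters the size of the perturbation: if the source lies in \<open>Q\<close>
  but \<open>\<omega>\<close> does not, then a coordinate of \<open>\<omega>\<close> is negative and the kernel is \<open>f0\<close>, \<open>f1\<close> or \<open>f2\<close>.
\<close>

lemma needle_off_kern:
  assumes Q: "Q \<subseteq> {0..<endA P} \<times> {0..<endB P}" and w: "w \<in> U12 P" and "\<omega> \<notin> Q"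
  shows "kern P (x, \<omega>) (\<eta>, needle w Q (src x \<omega>)) = kern P (x, \<omega>) (\<eta>, U (src x \<omega>))"
proof (cases "src x \<omega> \<in> Q")
  case True
  then have neg: "fst \<omega> < 0 \<or> snd \<omega> < 0" using assms(3) by (cases \<omega>) (auto simp: src_def split: if_splits)
  obtain s t where st: "src x \<omega> = (s, t)" by (cases "src x \<omega>")
  have r: "(s, t) \<in> rect P" using True Q st by (auto simp: rect_def)
  then have "u12 s t \<in> U12 P" using mc by (auto simp: measurable_controls_def rect_def)
  from kern_indep[OF ind neg w this] show ?thesis using True r by (simp add: needle_def flat_def ctrl_def st)
qed (simp add: needle_def)

lemma needle_off_cost:
  assumes Q: "Q \<subseteq> {0..<endA P} \<times> {0..<endB P}" and "\<omega> \<notin> Q"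
  shows "needle w Q (rho \<omega>) = U (rho \<omega>)"
proof -
  have "rho \<omega> \<notin> Q" using assms by (cases \<omega>) (auto simp: src_def split: if_splits)
  then show ?thesis by (simp add: needle_def)
qed

text \<open>
  The increment of the Hamiltonian, without the terms that do not depend on \<open>u12\<close>.
\<close>

definition hvar :: "(real \<times> real \<Rightarrow> real^'n) \<Rightarrow> 'c \<Rightarrow> real \<times> real \<Rightarrow> real" where
  "hvar \<Psi> w x = fcost P x (z x, flat w x) - fcost P x (z x, U x)
     + (\<integral>\<omega>. \<Psi> \<omega> \<bullet> (kern P (rho \<omega>, x) (z x, flat w x) - kern P (rho \<omega>, x) (z x, U x)) \<partial>plane P)"

lemma needle_state_estimate:
  assumes w: "w \<in> U12 P"
  obtains C1 where "0 \<le> C1" "\<And>Q z' x. Q \<in> sets borel \<Longrightarrow> Q \<subseteq> {0..<endA P} \<times> {0..<endB P} \<Longrightarrow>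
    bounded_borel z' \<Longrightarrow> volterra P (needle w Q) z' = z' \<Longrightarrow> norm (z' x - z x) \<le> C1 * measure (plane P) Q"
proof -
  interpret N: finite_measure "plane P" by simp
  obtain R where R: "\<And>x. norm (z x) \<le> R" using bounded_borelE[OF z] by metis
  obtain C where C: "C \<ge> 0" "\<And>i v. norm (fst v) \<le> R \<Longrightarrow> norm (kern P i v) \<le> C"
    using C1_family_bounded[OF C1_family_kern[OF reg]] by metis
  obtain K where K: "K \<ge> 0" "\<And>U z z' c x. U \<in> borel_measurable borel \<Longrightarrow> bounded_borel z \<Longrightarrow> bounded_borel z' \<Longrightarrow> 0 \<le> c \<Longrightarrow>
      volterra P U z = z \<Longrightarrow> (\<And>x. norm (volterra P U z' x - z' x) \<le> c) \<Longrightarrow> norm (z x - z' x) \<le> K * c"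
    using volterra_stability[OF reg] by metis
  show thesis
  proof
    show "0 \<le> K * (2 * C)" using K C by simp
    fix Q z' x assume Q: "Q \<in> sets borel" "Q \<subseteq> {0..<endA P} \<times> {0..<endB P}"
      and z': "bounded_borel z'" "volterra P (needle w Q) z' = z'"
    note U' = needle_measurable[OF w Q(1)]
    have "norm (volterra P (needle w Q) z x - z x) \<le> 2 * C * measure (plane P) Q" for x
    proof -
      let ?k = "\<lambda>\<omega>. kern P (x, \<omega>) (z (src x \<omega>), U (src x \<omega>))"
      let ?k' = "\<lambda>\<omega>. kern P (x, \<omega>) (z (src x \<omega>), needle w Q (src x \<omega>))"
      have b: "bounded_borel ?k" "bounded_borel ?k'"
        by (rule bounded_borel_kern_section[OF reg z U] bounded_borel_kern_section[OF reg z U'])+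
      have pt: "norm (?k' \<omega> - ?k \<omega>) \<le> 2 * C * indicator Q \<omega>" for \<omega>
      proof (cases "\<omega> \<in> Q")
        case True
        have "norm (?k' \<omega> - ?k \<omega>) \<le> C + C"
          by (rule order_trans[OF norm_triangle_ineq4], rule add_mono; rule C(2)) (use R in auto)
        then show ?thesis using True by simp
      next
        case False
        then show ?thesis using needle_off_kern[OF Q(2) w False, of x "z (src x \<omega>)"] by simp
      qed
      have "volterra P (needle w Q) z x - z x = volterra P (needle w Q) z x - volterra P U z x" by (simp add: fx)
      also have "\<dots> = (\<integral>\<omega>. ?k' \<omega> - ?k \<omega> \<partial>plane P)"
        unfolding volterra_def using integrable_plane[OF b(1)] integrable_plane[OF b(2)] by simp
      finally have eq: "volterra P (needle w Q) z x - z x = (\<integral>\<omega>. ?k' \<omega> - ?k \<omega> \<partial>plane P)" .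
      have "norm (\<integral>\<omega>. ?k' \<omega> - ?k \<omega> \<partial>plane P) \<le> (\<integral>\<omega>. norm (?k' \<omega> - ?k \<omega>) \<partial>plane P)" by (rule integral_norm_bound)
      also have "\<dots> \<le> (\<integral>\<omega>. 2 * C * indicator Q \<omega> \<partial>plane P)"
      proof (rule integral_mono[OF _ _ pt])
        show "integrable (plane P) (\<lambda>\<omega>. norm (?k' \<omega> - ?k \<omega>))"
          by (intro integrable_norm integrable_plane bounded_borel_add(2) b)
        show "integrable (plane P) (\<lambda>\<omega>. 2 * C * indicator Q \<omega>)"
          using Q by (intro integrable_mult_right N.integrable_const_bound[where B=1]) (auto simp: indicator_def)
      qed
      also have "\<dots> = 2 * C * measure (plane P) Q" using Q by simp
      finally show ?thesis unfolding eq .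
    qed
    from K(2)[OF U' z'(1) z _ z'(2) this] show "norm (z' x - z x) \<le> K * (2 * C) * measure (plane P) Q"
      using C by (simp add: mult_ac)
  qed
qed

text \<open>
  With \<open>\<delta>\<close> of size \<open>C1 * m\<close>, \<open>C1_family_variation\<close> is used twice, for the state equation at every
  point and for the cost.  The linear term of the cost is replaced by means of \<open>adjoint_identity\<close>, and
  what remains of the state equation there is the direct effect of the needle plus an error of order \<open>o(m)\<close>.
\<close>

lemma cost_variation:
  assumes \<Psi>: "bounded_borel \<Psi>" "adjoint \<Psi>" and w: "w \<in> U12 P" and e: "e > 0"
  shows "\<exists>m0>0. \<forall>Q z'. Q \<in> sets borel \<longrightarrow> Q \<subseteq> {0..<endA P} \<times> {0..<endB P} \<longrightarrow>
    bounded_borel z' \<longrightarrow> volterra P (needle w Q) z' = z' \<longrightarrow> measure (plane P) Q \<le> m0 \<longrightarrow>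
    \<bar>path_cost P (needle w Q) z' - path_cost P U z
      - (\<integral>x. (if x \<in> Q then hvar \<Psi> w x else 0) \<partial>plane P)\<bar> \<le> e * measure (plane P) Q"
proof -
  interpret N: finite_measure "plane P" by simp
  let ?N = "measure (plane P) UNIV"
  obtain R where R: "\<And>x. norm (z x) \<le> R" using bounded_borelE[OF z] by metis
  obtain Cp where Cp: "Cp \<ge> 0" "\<And>x. norm (\<Psi> x) \<le> Cp" using bounded_borelE[OF \<Psi>(1)] by metis
  obtain C1 where C1: "0 \<le> C1" "\<And>Q z' x. Q \<in> sets borel \<Longrightarrow> Q \<subseteq> {0..<endA P} \<times> {0..<endB P} \<Longrightarrow>
    bounded_borel z' \<Longrightarrow> volterra P (needle w Q) z' = z' \<Longrightarrow> norm (z' x - z x) \<le> C1 * measure (plane P) Q"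
    using needle_state_estimate[OF w] by metis
  note kern = C1_family_kern[OF reg] and cst = C1_family_fcost[OF reg]
  obtain Ck where Ck: "Ck \<ge> 0" "\<And>i v h. norm (fst v) \<le> R \<Longrightarrow> norm (state_deriv (kern P i) v h) \<le> Ck * norm h"
    using C1_family_bounded[OF kern] by metis
  obtain Cf where Cf: "Cf \<ge> 0" "\<And>i v h. norm (fst v) \<le> R \<Longrightarrow> norm (state_deriv (fcost P i) v h) \<le> Cf * norm h"
    using C1_family_bounded[OF cst] by metis
  have N0: "0 \<le> ?N" by simp
  \<comment> \<open>The total error will be \<open>m * (e1 * \<alpha> + \<beta> * m)\<close>; first \<open>e1\<close> and then the bound \<open>m0\<close> for \<open>m\<close>
    are chosen so that each summand is at most \<open>e / 2\<close>.\<close>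
  define \<alpha> where "\<alpha> = C1 * ?N * (1 + Cp * ?N)"
  define \<beta> where "\<beta> = C1 * ((2 * Cf + 1) + Cp * ?N * (2 * Ck + 1))"
  have \<alpha>: "0 \<le> \<alpha>" and \<beta>: "0 \<le> \<beta>" unfolding \<alpha>_def \<beta>_def using C1(1) Cp(1) Ck(1) Cf(1) N0
    by (auto intro!: mult_nonneg_nonneg add_nonneg_nonneg)
  define e1 where "e1 = min 1 (e / (2 * (\<alpha> + 1)))"
  have e1: "0 < e1" "e1 \<le> 1" using e \<alpha> by (auto simp: e1_def)
  have e1\<alpha>: "e1 * \<alpha> \<le> e / 2"
  proof -
    have "e1 * \<alpha> \<le> e / (2 * (\<alpha> + 1)) * \<alpha>" using \<alpha> by (intro mult_right_mono) (auto simp: e1_def)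
    also have "\<dots> \<le> e / 2" using e \<alpha> by (simp add: field_simps)
    finally show ?thesis .
  qed
  obtain dk where dk: "dk > 0" "\<And>i v h. norm (fst v) \<le> R \<Longrightarrow> norm h \<le> dk \<Longrightarrow>
        norm (kern P i (fst v + h, snd v) - kern P i v - state_deriv (kern P i) v h) \<le> e1 * norm h"
    using C1_family_remainder[OF kern e1(1)] by metis
  obtain df where df: "df > 0" "\<And>i v h. norm (fst v) \<le> R \<Longrightarrow> norm h \<le> df \<Longrightarrow>
        norm (fcost P i (fst v + h, snd v) - fcost P i v - state_deriv (fcost P i) v h) \<le> e1 * norm h"
    using C1_family_remainder[OF cst e1(1)] by metis
  define m0 where "m0 = min (min (dk / (C1 + 1)) (df / (C1 + 1))) (e / (2 * (\<beta> + 1)))"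
  have m0: "m0 > 0" using dk df e C1 \<beta> by (auto simp: m0_def)
  show ?thesis
  proof (intro exI[of _ m0] conjI allI impI)
    show "m0 > 0" by fact
    fix Q z' assume Q: "Q \<in> sets borel" "Q \<subseteq> {0..<endA P} \<times> {0..<endB P}"
      and z': "bounded_borel z'" "volterra P (needle w Q) z' = z'" and m: "measure (plane P) Q \<le> m0"
    let ?m = "measure (plane P) Q" and ?U' = "needle w Q"
    note U' = needle_measurable[OF w Q(1)]
    define D where "D = C1 * ?m"
    have D: "norm (z' x - z x) \<le> D" for x unfolding D_def by (rule C1(2)[OF Q z'])
    have mm: "0 \<le> ?m" by simp
    have D0: "0 \<le> D" using C1 by (simp add: D_def)
    have Dd: "D \<le> d" if "?m \<le> d / (C1 + 1)" "d > 0" for d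
    proof -
      have "C1 * ?m \<le> C1 * (d / (C1 + 1))" using that C1 by (intro mult_left_mono)
      also have "\<dots> \<le> d" using that C1 by (simp add: field_simps)
      finally show ?thesis by (simp add: D_def)
    qed
    have Ddk: "D \<le> dk" and Ddf: "D \<le> df" using m by (auto intro!: Dd simp: m0_def dk df)
    have \<beta>m: "\<beta> * ?m \<le> e / 2"
    proof -
      have "\<beta> * ?m \<le> \<beta> * (e / (2 * (\<beta> + 1)))" using m \<beta> by (intro mult_left_mono) (auto simp: m0_def)
      also have "\<dots> \<le> e / 2" using e \<beta> by (simp add: field_simps)
      finally show ?thesis .
    qed
    define \<delta> where "\<delta> = (\<lambda>x. z' x - z x)"
    have \<delta>: "bounded_borel \<delta>" unfolding \<delta>_def by (rule bounded_borel_add(2)[OF z'(1) z])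
    have Qsrc: "src x \<omega> = \<omega>" if "\<omega> \<in> Q" for x \<omega>
      using that Q(2) by (cases \<omega>) (auto simp: src_def)
    define dk' where "dk' x \<omega> = (if \<omega> \<in> Q then kern P (x, \<omega>) (z \<omega>, flat w \<omega>) - kern P (x, \<omega>) (z \<omega>, U \<omega>) else 0)" for x \<omega>
    define L where "L x = (\<integral>\<omega>. lin_kern x \<omega> (\<delta> (src x \<omega>)) \<partial>plane P)" for x
    define g where "g x = (\<integral>\<omega>. dk' x \<omega> \<partial>plane P)" for x
    define B where "B = e1 * D * ?N + (2 * Ck + 1) * D * ?m"
    have state: "norm (\<delta> x - L x - g x) \<le> B" for x
    proof -
      have px: "Pair x \<in> borel_measurable borel"
        by (intro borel_measurable_continuous_onI continuous_intros)
      have "norm ((\<integral>\<omega>. kern P (x, \<omega>) (z' (src x \<omega>), ?U' (src x \<omega>)) \<partial>plane P) - (\<integral>\<omega>. kern P (x, \<omega>) (z (src x \<omega>), U (src x \<omega>)) \<partial>plane P)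
        - (\<integral>\<omega>. state_deriv (kern P (x, \<omega>)) (z (src x \<omega>), U (src x \<omega>)) (z' (src x \<omega>) - z (src x \<omega>)) \<partial>plane P)
        - (\<integral>\<omega>. (if \<omega> \<in> Q then kern P (x, \<omega>) (z (src x \<omega>), ?U' (src x \<omega>)) - kern P (x, \<omega>) (z (src x \<omega>), U (src x \<omega>)) else 0) \<partial>plane P))
        \<le> B" unfolding B_def
        by (rule C1_family_variation[OF kern z z'(1) U U' px src_corner_measurable Q(1) R Ck(1) Ck(2) _ e1(2) dk(2) D Ddk])
           (use e1 needle_off_kern[OF Q(2) w] in auto)
      moreover have "(\<integral>\<omega>. (if \<omega> \<in> Q then kern P (x, \<omega>) (z (src x \<omega>), ?U' (src x \<omega>)) - kern P (x, \<omega>) (z (src x \<omega>), U (src x \<omega>)) else 0) \<partial>plane P) = g x"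
        unfolding g_def dk'_def by (intro Bochner_Integration.integral_cong refl) (auto simp: Qsrc needle_def)
      moreover have "volterra P ?U' z' x - volterra P U z x = \<delta> x" by (simp add: z'(2) fx \<delta>_def)
      ultimately show ?thesis unfolding L_def lin_kern_def volterra_def \<delta>_def by simp
    qed
    define J' where "J' = path_cost P ?U' z'"
    define J where "J = path_cost P U z"
    define dF where "dF x = (if x \<in> Q then fcost P x (z x, flat w x) - fcost P x (z x, U x) else 0)" for x
    have cost: "\<bar>J' - J - (\<integral>\<omega>. lin_cost \<omega> (\<delta> (rho \<omega>)) \<partial>plane P) - (\<integral>\<omega>. dF \<omega> \<partial>plane P)\<bar> \<le> e1 * D * ?N + (2 * Cf + 1) * D * ?m"
    proof -
      have "norm (path_cost P ?U' z' - path_cost P U z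
        - (\<integral>\<omega>. state_deriv (fcost P \<omega>) (z (rho \<omega>), U (rho \<omega>)) (z' (rho \<omega>) - z (rho \<omega>)) \<partial>plane P)
        - (\<integral>\<omega>. (if \<omega> \<in> Q then fcost P \<omega> (z (rho \<omega>), ?U' (rho \<omega>)) - fcost P \<omega> (z (rho \<omega>), U (rho \<omega>)) else 0) \<partial>plane P))
        \<le> e1 * D * ?N + (2 * Cf + 1) * D * ?m"
        by (rule C1_family_variation[OF cst z z'(1) U U' ident_borel src_corner_measurable Q(1) R Cf(1) Cf(2) _ e1(2) df(2) D Ddf])
           (use e1 needle_off_cost[OF Q(2)] in auto)
      moreover have "(\<integral>\<omega>. (if \<omega> \<in> Q then fcost P \<omega> (z (rho \<omega>), ?U' (rho \<omega>)) - fcost P \<omega> (z (rho \<omega>), U (rho \<omega>)) else 0) \<partial>plane P) = (\<integral>\<omega>. dF \<omega> \<partial>plane P)"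
        unfolding dF_def by (intro Bochner_Integration.integral_cong refl) (auto simp: Qsrc needle_def)
      ultimately show ?thesis unfolding lin_cost_def J_def J'_def \<delta>_def by simp
    qed
    have m1: "fst \<in> borel_measurable (borel :: ((real \<times> real) \<times> (real \<times> real)) measure)"
      "snd \<in> borel_measurable (borel :: ((real \<times> real) \<times> (real \<times> real)) measure)"
      by (intro borel_measurable_continuous_onI continuous_intros)+
    have rm: "(\<lambda>p :: (real \<times> real) \<times> (real \<times> real). (rho (fst p), snd p)) \<in> borel_measurable borel"
      by (intro borel_measurable_Pair m1 measurable_compose[OF m1(1) src_corner_measurable])
    have pQ: "Measurable.pred borel (\<lambda>x. x \<in> Q)" using Q(1) by simp
    have bdk: "bounded_borel (\<lambda>p. dk' (rho (fst p)) (snd p))"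
      unfolding dk'_def
      using C1_family_compose(1)[OF kern z flat_measurable[OF w] rm m1(2)] C1_family_compose(1)[OF kern z U rm m1(2)]
      by (intro bounded_borel_if bounded_borel_add(2) measurable_compose[OF m1(2) pQ]) auto
    have bL: "bounded_borel (\<lambda>\<omega>. L (rho \<omega>))"
      using bounded_borel_integral[OF bounded_borel_compose[OF bounded_borel_lin_kern(1)[OF \<delta>] rm], of "plane P"]
      by (simp add: L_def)
    have bg: "bounded_borel (\<lambda>\<omega>. g (rho \<omega>))"
      using bounded_borel_integral[OF bdk, of "plane P"] by (simp add: g_def)
    have b\<delta>: "bounded_borel (\<lambda>\<omega>. \<delta> (rho \<omega>))" by (rule bounded_borel_compose[OF \<delta> src_corner_measurable])
    have bF: "bounded_borel dF" unfolding dF_def[abs_def]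
      using C1_family_compose(1)[OF cst z flat_measurable[OF w] ident_borel ident_borel] C1_family_compose(1)[OF cst z U ident_borel ident_borel]
      by (intro bounded_borel_if bounded_borel_add(2) pQ) auto
    have bH: "bounded_borel (\<lambda>p. \<Psi> (fst p) \<bullet> dk' (rho (fst p)) (snd p))"
      by (intro bounded_borel_inner bdk bounded_borel_compose[OF \<Psi>(1) m1(1)])
    let ?H = "\<lambda>x. \<integral>\<omega>. \<Psi> \<omega> \<bullet> dk' (rho \<omega>) x \<partial>plane P"
    have sw: "(\<lambda>p :: (real \<times> real) \<times> (real \<times> real). (snd p, fst p)) \<in> borel_measurable borel"
      by (intro borel_measurable_continuous_onI continuous_intros)
    have bH': "bounded_borel ?H"
      using bounded_borel_integral[OF bounded_borel_compose[OF bH sw], of "plane P"] by simp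
    have swap: "(\<integral>\<omega>. \<Psi> \<omega> \<bullet> g (rho \<omega>) \<partial>plane P) = (\<integral>x. ?H x \<partial>plane P)"
    proof -
      have "\<Psi> \<omega> \<bullet> g (rho \<omega>) = (\<integral>x. \<Psi> \<omega> \<bullet> dk' (rho \<omega>) x \<partial>plane P)" for \<omega>
        using integrable_plane[OF bounded_borel_section2[OF bdk, of \<omega>], of "endA P" "endB P"] by (simp add: g_def)
      then show ?thesis using integral_swap_both[OF bH] by simp
    qed
    have hv: "(\<integral>x. (if x \<in> Q then hvar \<Psi> w x else 0) \<partial>plane P) = (\<integral>x. dF x \<partial>plane P) + (\<integral>x. ?H x \<partial>plane P)"
    proof -
      have "(if x \<in> Q then hvar \<Psi> w x else 0) = dF x + ?H x" for x
        by (simp add: hvar_def dF_def dk'_def)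
      then show ?thesis using integrable_plane[OF bF] integrable_plane[OF bH'] by simp
    qed
    have adj: "(\<integral>\<omega>. lin_cost \<omega> (\<delta> (rho \<omega>)) \<partial>plane P) = (\<integral>\<omega>. \<Psi> \<omega> \<bullet> (\<delta> (rho \<omega>) - L (rho \<omega>)) \<partial>plane P)"
      using adjoint_identity[OF \<Psi> \<delta>] by (simp add: L_def)
    have eq: "(\<integral>\<omega>. \<Psi> \<omega> \<bullet> (\<delta> (rho \<omega>) - L (rho \<omega>)) \<partial>plane P) - (\<integral>\<omega>. \<Psi> \<omega> \<bullet> g (rho \<omega>) \<partial>plane P)
       = (\<integral>\<omega>. \<Psi> \<omega> \<bullet> (\<delta> (rho \<omega>) - L (rho \<omega>) - g (rho \<omega>)) \<partial>plane P)"
      by (subst Bochner_Integration.integral_diff[symmetric])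
         (simp_all add: integrable_plane bounded_borel_inner \<Psi> bounded_borel_add b\<delta> bL bg inner_diff_right)
    have "\<bar>\<integral>\<omega>. \<Psi> \<omega> \<bullet> (\<delta> (rho \<omega>) - L (rho \<omega>) - g (rho \<omega>)) \<partial>plane P\<bar> \<le> Cp * B * ?N"
    proof -
      have "norm (\<integral>\<omega>. \<Psi> \<omega> \<bullet> (\<delta> (rho \<omega>) - L (rho \<omega>) - g (rho \<omega>)) \<partial>plane P) \<le> Cp * B * measure (plane P) (space (plane P))"
      proof (rule norm_integral_le_const)
        have B0: "0 \<le> B" using order_trans[OF norm_ge_zero state] .
        show "0 \<le> Cp * B" using B0 Cp(1) by simp
        fix \<omega>
        show "norm (\<Psi> \<omega> \<bullet> (\<delta> (rho \<omega>) - L (rho \<omega>) - g (rho \<omega>))) \<le> Cp * B"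
          using Cauchy_Schwarz_ineq2[of "\<Psi> \<omega>" "\<delta> (rho \<omega>) - L (rho \<omega>) - g (rho \<omega>)"]
            mult_mono[OF Cp(2)[of \<omega>] state[of "rho \<omega>"] Cp(1) norm_ge_zero] by simp
      qed simp
      then show ?thesis by simp
    qed
    then have r2: "\<bar>(\<integral>\<omega>. lin_cost \<omega> (\<delta> (rho \<omega>)) \<partial>plane P) - (\<integral>x. ?H x \<partial>plane P)\<bar> \<le> Cp * B * ?N"
      unfolding adj swap[symmetric] eq .
    have "\<bar>J' - J - (\<integral>x. (if x \<in> Q then hvar \<Psi> w x else 0) \<partial>plane P)\<bar> \<le>
        (e1 * D * ?N + (2 * Cf + 1) * D * ?m) + Cp * B * ?N"
      using cost r2 unfolding hv by linarith
    also have "\<dots> = ?m * (e1 * \<alpha> + \<beta> * ?m)"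
      by (simp add: B_def D_def \<alpha>_def \<beta>_def algebra_simps)
    also have "\<dots> \<le> ?m * (e / 2 + e / 2)"
      using e1\<alpha> \<beta>m by (intro mult_left_mono add_mono) auto
    finally show "\<bar>path_cost P (needle w Q) z' - path_cost P U z
      - (\<integral>x. (if x \<in> Q then hvar \<Psi> w x else 0) \<partial>plane P)\<bar> \<le> e * ?m"
      unfolding J_def J'_def by (simp add: mult.commute)
  qed
qed

end

section \<open>The co-state and the Hamiltonian in unified form\<close>

lemma bounded_borel_If:
  fixes f :: "'x::topological_space \<Rightarrow> 'e::euclidean_space"
  assumes f: "bounded_borel f" and g: "bounded_borel g" and p: "Measurable.pred borel p"
  shows "bounded_borel (\<lambda>x. if p x then f x else g x)"
proof -
  have "bounded_borel (\<lambda>x. (if p x then f x else 0) + (if \<not> p x then g x else 0))"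
    using p by (intro bounded_borel_add bounded_borel_if f g pred_intros_logic)
  moreover have "(\<lambda>x. (if p x then f x else 0) + (if \<not> p x then g x else 0)) = (\<lambda>x. if p x then f x else g x)"
    by auto
  ultimately show ?thesis by simp
qed

lemma bounded_borel_const: "bounded_borel (\<lambda>x. c)"
  by (rule bounded_borelI[where C="norm c"]) auto

lemma bounded_borel_zero_extend:
  fixes f :: "'x::topological_space \<Rightarrow> 'e::euclidean_space"
  assumes f: "f \<in> borel_measurable (restrict_space borel X)" and b: "bounded (f ` X)" and X: "X \<in> sets borel"
  shows "bounded_borel (\<lambda>x. if x \<in> X then f x else 0)"
proof -
  obtain C where C: "\<And>x. x \<in> X \<Longrightarrow> norm (f x) \<le> C" using b by (auto simp: bounded_iff)
  have "norm (if x \<in> X then f x else 0) \<le> max 0 C" for x using C[of x] by auto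
  then show ?thesis by (intro bounded_borelI borel_measurable_zero_extend[OF f X])
qed

text \<open>
  The co-state equations integrate vectors, the adjoint identity scalars.  Integrability of \<open>f\<close>
  comes from its components, which agree with bounded Borel functions on the interval.
\<close>

lemma set_integral_inner_bounded:
  fixes f :: "real \<Rightarrow> 'e::euclidean_space" and g :: "'e \<Rightarrow> real \<Rightarrow> real"
  assumes g: "\<And>h. bounded_borel (g h)" and f: "\<And>h x. x \<in> {l..u} \<Longrightarrow> f x \<bullet> h = g h x"
  shows "(LBINT x:{l..u}. f x) \<bullet> h = (LBINT x:{l..u}. g h x)"
proof -
  have gi: "integrable lborel (\<lambda>x. indicator {l..u} x *\<^sub>R g h x)" for h
    using set_integrable_bounded_borel[OF g, of "{l..u}" l u] by (simp add: set_integrable_def)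
  have eq: "(indicator {l..u} x *\<^sub>R f x) \<bullet> h = indicator {l..u} x *\<^sub>R g h x" for x h
    using f[of x h] by (auto simp: indicator_def)
  have "integrable lborel (\<lambda>x. \<Sum>b\<in>Basis. (indicator {l..u} x *\<^sub>R g b x) *\<^sub>R (b :: 'e))"
    by (intro Bochner_Integration.integrable_sum integrable_scaleR_left gi)
  also have "(\<lambda>x. \<Sum>b\<in>Basis. (indicator {l..u} x *\<^sub>R g b x) *\<^sub>R (b :: 'e)) = (\<lambda>x. indicator {l..u} x *\<^sub>R f x)"
    unfolding eq[symmetric] euclidean_representation ..
  finally have "(LBINT x:{l..u}. f x) \<bullet> h = (\<integral>x. (indicator {l..u} x *\<^sub>R f x) \<bullet> h \<partial>lborel)"
    unfolding set_lebesgue_integral_def by (intro integral_inner_left[symmetric])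
  then show ?thesis unfolding eq set_lebesgue_integral_def .
qed

lemma set_integral_eq_ext:
  fixes f :: "real \<Rightarrow> 'e::euclidean_space"
  assumes f: "bounded_borel f" and "0 \<le> l" "0 \<le> b"
  shows "(LBINT x:{l..b}. f x) = (\<integral>x. (if x \<in> {l..b} then f x else 0) \<partial>ext_lebesgue b)"
proof -
  have "bounded_borel (\<lambda>x. if x \<in> {l..b} then f x else 0)" by (rule bounded_borel_if[OF f]) simp
  from integral_ext_lebesgue[OF this _ assms(3)] assms(2)
  have "(\<integral>x. (if x \<in> {l..b} then f x else 0) \<partial>ext_lebesgue b) = (LBINT x:{0..b}. if x \<in> {l..b} then f x else 0)"
    by simp
  also have "\<dots> = (LBINT x:{l..b}. f x)" using assms(2) by (intro set_integral_shrink) auto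
  finally show ?thesis by simp
qed

lemma bounded_borel_set_integral:
  fixes f :: "real \<times> real \<Rightarrow> 'e::euclidean_space"
  assumes f: "bounded_borel f" and "0 \<le> l" "0 \<le> b"
  shows "bounded_borel (\<lambda>\<sigma>. LBINT \<tau>:{l..b}. f (\<sigma>, \<tau>))"
proof -
  have m: "(\<lambda>p::real \<times> real. snd p) \<in> borel_measurable borel"
    by (intro borel_measurable_continuous_onI continuous_intros)
  have "bounded_borel (\<lambda>p. if snd p \<in> {l..b} then f p else 0)"
    by (rule bounded_borel_if[OF f measurable_compose[OF m]]) simp
  from bounded_borel_integral[OF this, of "ext_lebesgue b"]
  show ?thesis using set_integral_eq_ext[OF bounded_borel_section2[OF f] assms(2,3)] by simp
qed

lemma grad_y_inner:
  fixes g :: "(real^'n::finite) \<times> 'u \<Rightarrow> real"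
  assumes "linear (state_deriv g v)"
  shows "grad_y g v \<bullet> h = state_deriv g v h"
proof -
  have "state_deriv g v h = state_deriv g v (\<Sum>i\<in>UNIV. h $ i *\<^sub>R axis i 1)"
    using basis_expansion[of h] by (simp add: scalar_mult_eq_scaleR)
  also have "\<dots> = (\<Sum>i\<in>UNIV. h $ i *\<^sub>R state_deriv g v (axis i 1))"
    by (simp add: linear_sum[OF assms] linear_scale[OF assms])
  finally show ?thesis by (simp add: grad_y_def state_deriv_def inner_vec_def mult.commute)
qed

lemma vector_jac_y_inner:
  fixes g :: "(real^'n::finite) \<times> 'u \<Rightarrow> real^'m::finite"
  assumes "linear (state_deriv g v)"
  shows "(p v* jac_y g v) \<bullet> h = p \<bullet> state_deriv g v h"
proof -
  have "jac_y g v *v h = state_deriv g v h"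
    unfolding jac_y_def jacobian_def using assms by (simp add: state_deriv_def matrix_works)
  then show ?thesis by (simp add: dot_lmul_matrix)
qed

locale costate_path = controlled_path P u1 u2 u12 z
  for P :: "('n::finite, 'a::euclidean_space, 'b::euclidean_space, 'c::euclidean_space) problem"
    and u1 :: "real \<Rightarrow> 'a" and u2 :: "real \<Rightarrow> 'b" and u12 :: "real \<Rightarrow> real \<Rightarrow> 'c"
    and z :: "real \<times> real \<Rightarrow> real^'n" +
  fixes y :: "real \<Rightarrow> real \<Rightarrow> real^'n"
    and \<psi>0 :: "real^'n" and \<psi>1 \<psi>2 :: "real \<Rightarrow> real^'n" and \<psi>12 :: "real \<Rightarrow> real \<Rightarrow> real^'n"
  assumes y: "\<And>s t. (s, t) \<in> rect P \<Longrightarrow> z (s, t) = y s t"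
    and costate: "is_costate P u1 u2 u12 y \<psi>0 \<psi>1 \<psi>2 \<psi>12"
begin

text \<open>
  The four co-states as one function, extended by zero beyond the rectangle to be Borel on the plane.
\<close>

definition Psi :: "real \<times> real \<Rightarrow> real^'n" where
  "Psi x = (if fst x < 0 then if snd x < 0 then \<psi>0 else (if snd x \<in> {0..endB P} then \<psi>2 (snd x) else 0)
     else if snd x < 0 then (if fst x \<in> {0..endA P} then \<psi>1 (fst x) else 0)
     else (if x \<in> rect P then \<psi>12 (fst x) (snd x) else 0))"

lemma bounded_borel_Psi: "bounded_borel Psi"
proof -
  note C = costate[unfolded is_costate_def Let_def]
  have 1: "bounded_borel (\<lambda>s. if s \<in> {0..endA P} then \<psi>1 s else 0)"
    using C by (intro bounded_borel_zero_extend) auto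
  have 2: "bounded_borel (\<lambda>s. if s \<in> {0..endB P} then \<psi>2 s else 0)"
    using C by (intro bounded_borel_zero_extend) auto
  have 3: "bounded_borel (\<lambda>x. if x \<in> rect P then (\<lambda>(s, t). \<psi>12 s t) x else 0)"
    using C by (intro bounded_borel_zero_extend rect_borel) auto
  have m: "fst \<in> borel_measurable (borel :: (real \<times> real) measure)"
    "snd \<in> borel_measurable (borel :: (real \<times> real) measure)"
    by (intro borel_measurable_continuous_onI continuous_intros)+
  show ?thesis unfolding Psi_def[abs_def]
    by (rule bounded_borel_If[OF bounded_borel_If[OF bounded_borel_const bounded_borel_compose[OF 2 m(2)] pred_snd_less]
        bounded_borel_If[OF bounded_borel_compose[OF 1 m(1)] 3[unfolded case_prod_unfold] pred_snd_less] pred_fst_less])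
qed

text \<open>
  With \<open>\<kappa>\<close> the kernels themselves this is the pairing in the Hamiltonian, with \<open>\<kappa>\<close> their
  derivatives in a direction \<open>h\<close> it is the pairing in the equation for \<open>\<psi>12\<close>.
\<close>

lemma pairing_split:
  fixes \<kappa>1 \<kappa>2 :: "real \<Rightarrow> real^'n" and \<kappa>12 :: "real \<times> real \<Rightarrow> real^'n"
  assumes \<kappa>: "bounded_borel \<kappa>1" "bounded_borel \<kappa>2" "bounded_borel \<kappa>12"
    and a: "a \<in> {0..endA P}" and b: "b \<in> {0..endB P}"
    and 1: "\<And>\<sigma>. \<sigma> < a \<Longrightarrow> \<kappa>1 \<sigma> = 0" and 2: "\<And>\<tau>. \<tau> < b \<Longrightarrow> \<kappa>2 \<tau> = 0"
    and 12: "\<And>\<sigma> \<tau>. \<sigma> < a \<or> \<tau> < b \<Longrightarrow> \<kappa>12 (\<sigma>, \<tau>) = 0"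
  shows "(\<integral>\<sigma>. Psi (\<sigma>, b) \<bullet> \<kappa>1 (fst (rho (\<sigma>, b))) \<partial>ext_lebesgue (endA P))
      + (\<integral>\<tau>. Psi (a, \<tau>) \<bullet> \<kappa>2 (snd (rho (a, \<tau>))) \<partial>ext_lebesgue (endB P))
      + (\<integral>\<omega>. Psi \<omega> \<bullet> \<kappa>12 (rho \<omega>) \<partial>plane P)
    = \<psi>0 \<bullet> \<kappa>12 (corner P) + \<psi>1 a \<bullet> \<kappa>2 (endB P) + \<psi>2 b \<bullet> \<kappa>1 (endA P)
      + (LBINT \<sigma>:{a..endA P}. \<psi>12 \<sigma> b \<bullet> \<kappa>1 \<sigma> + \<psi>1 \<sigma> \<bullet> \<kappa>12 (\<sigma>, endB P))
      + (LBINT \<tau>:{b..endB P}. \<psi>12 a \<tau> \<bullet> \<kappa>2 \<tau> + \<psi>2 \<tau> \<bullet> \<kappa>12 (endA P, \<tau>))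
      + (LBINT \<sigma>:{a..endA P}. LBINT \<tau>:{b..endB P}. \<psi>12 \<sigma> \<tau> \<bullet> \<kappa>12 (\<sigma>, \<tau>))"
proof -
  let ?A = "endA P" and ?B = "endB P"
  note Pb = bounded_borel_Psi
  have m: "(\<lambda>\<sigma>. fst (rho (\<sigma>, b))) \<in> borel_measurable borel" "(\<lambda>\<tau>. snd (rho (a, \<tau>))) \<in> borel_measurable borel"
    by (auto simp: src_def intro!: measurable_If)
  have e1: "bounded_borel (\<lambda>\<sigma>. Psi (\<sigma>, b) \<bullet> \<kappa>1 (fst (rho (\<sigma>, b))))"
    by (intro bounded_borel_inner bounded_borel_section1[OF Pb] bounded_borel_compose[OF \<kappa>(1) m(1)])
  have e2: "bounded_borel (\<lambda>\<tau>. Psi (a, \<tau>) \<bullet> \<kappa>2 (snd (rho (a, \<tau>))))"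
    by (intro bounded_borel_inner bounded_borel_section2[OF Pb] bounded_borel_compose[OF \<kappa>(2) m(2)])
  have e3: "bounded_borel (\<lambda>\<omega>. Psi \<omega> \<bullet> \<kappa>12 (rho \<omega>))"
    by (intro bounded_borel_inner Pb bounded_borel_compose[OF \<kappa>(3) src_corner_measurable])
  have E1: "(\<integral>\<sigma>. Psi (\<sigma>, b) \<bullet> \<kappa>1 (fst (rho (\<sigma>, b))) \<partial>ext_lebesgue ?A) =
      \<psi>2 b \<bullet> \<kappa>1 ?A + (LBINT \<sigma>:{a..?A}. Psi (\<sigma>, b) \<bullet> \<kappa>1 \<sigma>)"
  proof -
    have "(\<integral>\<sigma>. Psi (\<sigma>, b) \<bullet> \<kappa>1 (fst (rho (\<sigma>, b))) \<partial>ext_lebesgue ?A) =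
        Psi (-1, b) \<bullet> \<kappa>1 (fst (rho (-1, b))) + (LBINT \<sigma>:{0..?A}. Psi (\<sigma>, b) \<bullet> \<kappa>1 (fst (rho (\<sigma>, b))))"
      by (rule integral_ext_lebesgue[OF e1]) (use AB in \<open>auto simp: Psi_def src_def\<close>)
    also have "(LBINT \<sigma>:{0..?A}. Psi (\<sigma>, b) \<bullet> \<kappa>1 (fst (rho (\<sigma>, b)))) = (LBINT \<sigma>:{a..?A}. Psi (\<sigma>, b) \<bullet> \<kappa>1 \<sigma>)"
      using a 1 by (intro set_integral_shrink) (auto simp: src_def)
    finally show ?thesis using b by (simp add: Psi_def src_def)
  qed
  have E2: "(\<integral>\<tau>. Psi (a, \<tau>) \<bullet> \<kappa>2 (snd (rho (a, \<tau>))) \<partial>ext_lebesgue ?B) =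
      \<psi>1 a \<bullet> \<kappa>2 ?B + (LBINT \<tau>:{b..?B}. Psi (a, \<tau>) \<bullet> \<kappa>2 \<tau>)"
  proof -
    have "(\<integral>\<tau>. Psi (a, \<tau>) \<bullet> \<kappa>2 (snd (rho (a, \<tau>))) \<partial>ext_lebesgue ?B) =
        Psi (a, -1) \<bullet> \<kappa>2 (snd (rho (a, -1))) + (LBINT \<tau>:{0..?B}. Psi (a, \<tau>) \<bullet> \<kappa>2 (snd (rho (a, \<tau>))))"
      by (rule integral_ext_lebesgue[OF e2]) (use AB in \<open>auto simp: Psi_def src_def\<close>)
    also have "(LBINT \<tau>:{0..?B}. Psi (a, \<tau>) \<bullet> \<kappa>2 (snd (rho (a, \<tau>)))) = (LBINT \<tau>:{b..?B}. Psi (a, \<tau>) \<bullet> \<kappa>2 \<tau>)"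
      using b 2 by (intro set_integral_shrink) (auto simp: src_def)
    finally show ?thesis using a by (simp add: Psi_def src_def)
  qed
  have E3: "(\<integral>\<omega>. Psi \<omega> \<bullet> \<kappa>12 (rho \<omega>) \<partial>plane P) =
      \<psi>0 \<bullet> \<kappa>12 (corner P) + (LBINT \<sigma>:{a..?A}. Psi (\<sigma>, -1) \<bullet> \<kappa>12 (\<sigma>, ?B))
      + (LBINT \<tau>:{b..?B}. Psi (-1, \<tau>) \<bullet> \<kappa>12 (?A, \<tau>))
      + (LBINT \<sigma>:{a..?A}. LBINT \<tau>:{b..?B}. \<psi>12 \<sigma> \<tau> \<bullet> \<kappa>12 (\<sigma>, \<tau>))"
  proof -
    have "(\<integral>\<omega>. Psi \<omega> \<bullet> \<kappa>12 (rho \<omega>) \<partial>plane P) = Psi (-1, -1) \<bullet> \<kappa>12 (rho (-1, -1))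
       + (LBINT \<sigma>:{0..?A}. Psi (\<sigma>, -1) \<bullet> \<kappa>12 (rho (\<sigma>, -1))) + (LBINT \<tau>:{0..?B}. Psi (-1, \<tau>) \<bullet> \<kappa>12 (rho (-1, \<tau>)))
       + (LBINT \<sigma>:{0..?A}. LBINT \<tau>:{0..?B}. Psi (\<sigma>, \<tau>) \<bullet> \<kappa>12 (rho (\<sigma>, \<tau>)))"
      by (rule integral_ext_plane_split[OF e3]) (use AB in \<open>auto simp: Psi_def src_def\<close>)
    also have "(LBINT \<sigma>:{0..?A}. Psi (\<sigma>, -1) \<bullet> \<kappa>12 (rho (\<sigma>, -1))) = (LBINT \<sigma>:{a..?A}. Psi (\<sigma>, -1) \<bullet> \<kappa>12 (\<sigma>, ?B))"
      using a 12 by (intro set_integral_shrink) (auto simp: src_def)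
    also have "(LBINT \<tau>:{0..?B}. Psi (-1, \<tau>) \<bullet> \<kappa>12 (rho (-1, \<tau>))) = (LBINT \<tau>:{b..?B}. Psi (-1, \<tau>) \<bullet> \<kappa>12 (?A, \<tau>))"
      using b 12 by (intro set_integral_shrink) (auto simp: src_def)
    also have "(LBINT \<sigma>:{0..?A}. LBINT \<tau>:{0..?B}. Psi (\<sigma>, \<tau>) \<bullet> \<kappa>12 (rho (\<sigma>, \<tau>))) =
       (LBINT \<sigma>:{a..?A}. LBINT \<tau>:{b..?B}. \<psi>12 \<sigma> \<tau> \<bullet> \<kappa>12 (\<sigma>, \<tau>))"
    proof (rule set_integral_shrink)
      fix \<sigma> assume \<sigma>: "\<sigma> \<in> {a..?A}"
      have "(LBINT \<tau>:{0..?B}. Psi (\<sigma>, \<tau>) \<bullet> \<kappa>12 (rho (\<sigma>, \<tau>))) = (LBINT \<tau>:{b..?B}. \<psi>12 \<sigma> \<tau> \<bullet> \<kappa>12 (\<sigma>, \<tau>))"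
        using b a 12 \<sigma> by (intro set_integral_shrink) (auto simp: src_def Psi_def rect_def)
      then show "\<sigma> \<in> {0..?A} \<and> (LBINT \<tau>:{0..?B}. Psi (\<sigma>, \<tau>) \<bullet> \<kappa>12 (rho (\<sigma>, \<tau>))) = (LBINT \<tau>:{b..?B}. \<psi>12 \<sigma> \<tau> \<bullet> \<kappa>12 (\<sigma>, \<tau>))"
        using \<sigma> a by auto
    next
      fix \<sigma> assume \<sigma>: "\<sigma> \<in> {0..?A} - {a..?A}"
      have "(LBINT \<tau>:{0..?B}. Psi (\<sigma>, \<tau>) \<bullet> \<kappa>12 (rho (\<sigma>, \<tau>))) = (LBINT \<tau>:({} :: real set). 0)"
        using 12 \<sigma> by (intro set_integral_shrink) (auto simp: src_def)
      then show "(LBINT \<tau>:{0..?B}. Psi (\<sigma>, \<tau>) \<bullet> \<kappa>12 (rho (\<sigma>, \<tau>))) = 0" by simp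
    qed
    finally show ?thesis by (simp add: Psi_def src_def)
  qed
  have S1: "(LBINT \<sigma>:{a..?A}. \<psi>12 \<sigma> b \<bullet> \<kappa>1 \<sigma> + \<psi>1 \<sigma> \<bullet> \<kappa>12 (\<sigma>, ?B)) =
      (LBINT \<sigma>:{a..?A}. Psi (\<sigma>, b) \<bullet> \<kappa>1 \<sigma>) + (LBINT \<sigma>:{a..?A}. Psi (\<sigma>, -1) \<bullet> \<kappa>12 (\<sigma>, ?B))"
  proof -
    have i: "bounded_borel (\<lambda>\<sigma>. Psi (\<sigma>, b) \<bullet> \<kappa>1 \<sigma>)" "bounded_borel (\<lambda>\<sigma>. Psi (\<sigma>, -1) \<bullet> \<kappa>12 (\<sigma>, ?B))"
      by (intro bounded_borel_inner \<kappa>(1) bounded_borel_section1[OF Pb] bounded_borel_section1[OF \<kappa>(3)])+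
    have "(LBINT \<sigma>:{a..?A}. \<psi>12 \<sigma> b \<bullet> \<kappa>1 \<sigma> + \<psi>1 \<sigma> \<bullet> \<kappa>12 (\<sigma>, ?B)) =
       (LBINT \<sigma>:{a..?A}. Psi (\<sigma>, b) \<bullet> \<kappa>1 \<sigma> + Psi (\<sigma>, -1) \<bullet> \<kappa>12 (\<sigma>, ?B))"
      using a b by (intro set_integral_shrink) (auto simp: Psi_def rect_def)
    also have "\<dots> = (LBINT \<sigma>:{a..?A}. Psi (\<sigma>, b) \<bullet> \<kappa>1 \<sigma>) + (LBINT \<sigma>:{a..?A}. Psi (\<sigma>, -1) \<bullet> \<kappa>12 (\<sigma>, ?B))"
      by (rule set_integral_add(2)[OF set_integrable_bounded_borel[OF i(1), where l=a and u="?A"]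
            set_integrable_bounded_borel[OF i(2), where l=a and u="?A"]]) auto
    finally show ?thesis .
  qed
  have S2: "(LBINT \<tau>:{b..?B}. \<psi>12 a \<tau> \<bullet> \<kappa>2 \<tau> + \<psi>2 \<tau> \<bullet> \<kappa>12 (?A, \<tau>)) =
      (LBINT \<tau>:{b..?B}. Psi (a, \<tau>) \<bullet> \<kappa>2 \<tau>) + (LBINT \<tau>:{b..?B}. Psi (-1, \<tau>) \<bullet> \<kappa>12 (?A, \<tau>))"
  proof -
    have i: "bounded_borel (\<lambda>\<tau>. Psi (a, \<tau>) \<bullet> \<kappa>2 \<tau>)" "bounded_borel (\<lambda>\<tau>. Psi (-1, \<tau>) \<bullet> \<kappa>12 (?A, \<tau>))"
      by (intro bounded_borel_inner \<kappa>(2) bounded_borel_section2[OF Pb] bounded_borel_section2[OF \<kappa>(3)])+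
    have "(LBINT \<tau>:{b..?B}. \<psi>12 a \<tau> \<bullet> \<kappa>2 \<tau> + \<psi>2 \<tau> \<bullet> \<kappa>12 (?A, \<tau>)) =
       (LBINT \<tau>:{b..?B}. Psi (a, \<tau>) \<bullet> \<kappa>2 \<tau> + Psi (-1, \<tau>) \<bullet> \<kappa>12 (?A, \<tau>))"
      using a b by (intro set_integral_shrink) (auto simp: Psi_def rect_def)
    also have "\<dots> = (LBINT \<tau>:{b..?B}. Psi (a, \<tau>) \<bullet> \<kappa>2 \<tau>) + (LBINT \<tau>:{b..?B}. Psi (-1, \<tau>) \<bullet> \<kappa>12 (?A, \<tau>))"
      by (rule set_integral_add(2)[OF set_integrable_bounded_borel[OF i(1), where l=b and u="?B"]
            set_integrable_bounded_borel[OF i(2), where l=b and u="?B"]]) auto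
    finally show ?thesis .
  qed
  show ?thesis unfolding E1 E2 E3 S1 S2 by simp
qed

end

context costate_path
begin

lemma bounded_borel_kern_fixed:
  assumes "\<phi> \<in> borel_measurable (borel :: 'p::euclidean_space measure)"
  shows "bounded_borel (\<lambda>p. kern P (\<phi> p) v)"
proof -
  have "(\<lambda>p::'p. p) \<in> borel_measurable borel" by simp
  from C1_family_compose(1)[OF C1_family_kern[OF reg] bounded_borel_const[of "fst v"] _ assms this, of "\<lambda>_. snd v"]
  show ?thesis by simp
qed

lemma h12_eq_pairing:
  assumes st: "(s, t) \<in> rect P" and v: "snd v \<in> controls P"
  shows "h12 P s t v \<psi>0 \<psi>1 \<psi>2 \<psi>12 = fcost P (s, t) v
     + ((\<integral>\<sigma>. Psi (\<sigma>, t) \<bullet> kern P (rho (\<sigma>, t), (s, -1)) v \<partial>ext_lebesgue (endA P))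
      + (\<integral>\<tau>. Psi (s, \<tau>) \<bullet> kern P (rho (s, \<tau>), (-1, t)) v \<partial>ext_lebesgue (endB P))
      + (\<integral>\<omega>. Psi \<omega> \<bullet> kern P (rho \<omega>, (s, t)) v \<partial>plane P))"
proof -
  let ?A = "endA P" and ?B = "endB P"
  define \<kappa>1 where "\<kappa>1 \<sigma> = kern P ((\<sigma>, t), (s, -1)) v" for \<sigma>
  define \<kappa>2 where "\<kappa>2 \<tau> = kern P ((s, \<tau>), (-1, t)) v" for \<tau>
  define \<kappa>12 where "\<kappa>12 x = kern P (x, (s, t)) v" for x
  have st': "0 \<le> s" "s \<le> ?A" "0 \<le> t" "t \<le> ?B" using st by (auto simp: rect_def)
  have b: "bounded_borel \<kappa>1" "bounded_borel \<kappa>2" "bounded_borel \<kappa>12"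
    unfolding \<kappa>1_def \<kappa>2_def \<kappa>12_def
    by (rule bounded_borel_kern_fixed, intro borel_measurable_continuous_onI continuous_intros)+
  have r: "kern P (rho (\<sigma>, t), (s, -1)) v = \<kappa>1 (fst (rho (\<sigma>, t)))" "kern P (rho (s, \<tau>), (-1, t)) v = \<kappa>2 (snd (rho (s, \<tau>)))" for \<sigma> \<tau>
    using st' by (auto simp: \<kappa>1_def \<kappa>2_def src_def)
  have z1: "\<kappa>1 \<sigma> = 0" if "\<sigma> < s" for \<sigma> using that st' by (auto simp: \<kappa>1_def kern_def dom1_def)
  have z2: "\<kappa>2 \<tau> = 0" if "\<tau> < t" for \<tau> using that st' by (auto simp: \<kappa>2_def kern_def dom2_def)
  have z12: "\<kappa>12 (\<sigma>, \<tau>) = 0" if "\<sigma> < s \<or> \<tau> < t" for \<sigma> \<tau>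
    using that st' by (auto simp: \<kappa>12_def kern_def dom12_def)
  have k1: "\<kappa>1 \<sigma> = f1 P \<sigma> t s v" if "\<sigma> \<in> {s..?A}" for \<sigma>
    using that st' v by (simp add: \<kappa>1_def kern_def dom1_def)
  have k2: "\<kappa>2 \<tau> = f2 P s \<tau> t v" if "\<tau> \<in> {t..?B}" for \<tau>
    using that st' v by (simp add: \<kappa>2_def kern_def dom2_def)
  have k12: "\<kappa>12 (\<sigma>, \<tau>) = f12 P \<sigma> \<tau> s t v" if "\<sigma> \<in> {s..?A}" "\<tau> \<in> {t..?B}" for \<sigma> \<tau>
    using that st' v by (simp add: \<kappa>12_def kern_def dom12_def)
  have c: "fcost P (s, t) v = F12 P s t v" using st st' v by (simp add: fcost_def)
  have S12: "(LBINT \<sigma>:{s..?A}. LBINT \<tau>:{t..?B}. \<psi>12 \<sigma> \<tau> \<bullet> f12 P \<sigma> \<tau> s t v) =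
      (LBINT \<sigma>:{s..?A}. LBINT \<tau>:{t..?B}. \<psi>12 \<sigma> \<tau> \<bullet> \<kappa>12 (\<sigma>, \<tau>))"
  proof (rule set_integral_shrink)
    fix \<sigma> assume \<sigma>: "\<sigma> \<in> {s..?A}"
    have "(LBINT \<tau>:{t..?B}. \<psi>12 \<sigma> \<tau> \<bullet> f12 P \<sigma> \<tau> s t v) = (LBINT \<tau>:{t..?B}. \<psi>12 \<sigma> \<tau> \<bullet> \<kappa>12 (\<sigma>, \<tau>))"
      by (rule set_integral_shrink) (use k12 \<sigma> in auto)
    then show "\<sigma> \<in> {s..?A} \<and> (LBINT \<tau>:{t..?B}. \<psi>12 \<sigma> \<tau> \<bullet> f12 P \<sigma> \<tau> s t v) = (LBINT \<tau>:{t..?B}. \<psi>12 \<sigma> \<tau> \<bullet> \<kappa>12 (\<sigma>, \<tau>))"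
      using \<sigma> by blast
  qed simp
  have S1: "(LBINT \<sigma>:{s..?A}. \<psi>12 \<sigma> t \<bullet> f1 P \<sigma> t s v + \<psi>1 \<sigma> \<bullet> f12 P \<sigma> ?B s t v) =
      (LBINT \<sigma>:{s..?A}. \<psi>12 \<sigma> t \<bullet> \<kappa>1 \<sigma> + \<psi>1 \<sigma> \<bullet> \<kappa>12 (\<sigma>, ?B))"
    by (rule set_integral_shrink) (use k1 k12 st' in auto)
  have S2: "(LBINT \<tau>:{t..?B}. \<psi>12 s \<tau> \<bullet> f2 P s \<tau> t v + \<psi>2 \<tau> \<bullet> f12 P ?A \<tau> s t v) =
      (LBINT \<tau>:{t..?B}. \<psi>12 s \<tau> \<bullet> \<kappa>2 \<tau> + \<psi>2 \<tau> \<bullet> \<kappa>12 (?A, \<tau>))"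
    by (rule set_integral_shrink) (use k2 k12 st' in auto)
  have "(\<integral>\<sigma>. Psi (\<sigma>, t) \<bullet> kern P (rho (\<sigma>, t), (s, -1)) v \<partial>ext_lebesgue ?A)
      + (\<integral>\<tau>. Psi (s, \<tau>) \<bullet> kern P (rho (s, \<tau>), (-1, t)) v \<partial>ext_lebesgue ?B)
      + (\<integral>\<omega>. Psi \<omega> \<bullet> kern P (rho \<omega>, (s, t)) v \<partial>plane P) =
      \<psi>0 \<bullet> \<kappa>12 (corner P) + \<psi>1 s \<bullet> \<kappa>2 ?B + \<psi>2 t \<bullet> \<kappa>1 ?A
      + (LBINT \<sigma>:{s..?A}. \<psi>12 \<sigma> t \<bullet> \<kappa>1 \<sigma> + \<psi>1 \<sigma> \<bullet> \<kappa>12 (\<sigma>, ?B))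
      + (LBINT \<tau>:{t..?B}. \<psi>12 s \<tau> \<bullet> \<kappa>2 \<tau> + \<psi>2 \<tau> \<bullet> \<kappa>12 (?A, \<tau>))
      + (LBINT \<sigma>:{s..?A}. LBINT \<tau>:{t..?B}. \<psi>12 \<sigma> \<tau> \<bullet> \<kappa>12 (\<sigma>, \<tau>))"
    unfolding r \<kappa>12_def[symmetric]
    by (rule pairing_split[OF b]) (use st' z1 z2 z12 in auto)
  then show ?thesis
    using k1[of ?A] k2[of ?B] k12[of ?A ?B] st' unfolding h12_def Let_def S1 S2 S12 c by simp
qed

text \<open>
  The single integrals in \<open>h12_eq_pairing\<close> contain only \<open>f1\<close> and \<open>f2\<close>, so they cancel in the difference.
\<close>

lemma hvar_eq_h12_diff:
  assumes st: "(s, t) \<in> rect P" and w: "w \<in> U12 P"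
  shows "hvar Psi w (s, t) = h12 P s t (y s t, u1 s, u2 t, w) \<psi>0 \<psi>1 \<psi>2 \<psi>12
     - h12 P s t (y s t, u1 s, u2 t, u12 s t) \<psi>0 \<psi>1 \<psi>2 \<psi>12"
proof -
  have st': "0 \<le> s" "s \<le> endA P" "0 \<le> t" "t \<le> endB P" using st by (auto simp: rect_def)
  have u: "u1 s \<in> U1 P" "u2 t \<in> U2 P" "u12 s t \<in> U12 P" using mc st' by (auto simp: measurable_controls_def)
  let ?v = "(y s t, u1 s, u2 t, w)" and ?v' = "(y s t, u1 s, u2 t, u12 s t)"
  have m: "(\<lambda>\<omega>. (rho \<omega>, (s, t))) \<in> borel_measurable borel"
    by (intro borel_measurable_Pair src_corner_measurable) auto
  have b: "bounded_borel (\<lambda>\<omega>. Psi \<omega> \<bullet> kern P (rho \<omega>, (s, t)) v)" for v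
    by (intro bounded_borel_inner bounded_borel_Psi bounded_borel_kern_fixed m)
  have k: "kern P (x, (s, -1)) ?v = kern P (x, (s, -1)) ?v'" "kern P (x, (-1, t)) ?v = kern P (x, (-1, t)) ?v'" for x
    by (rule kern_indep[OF ind _ w u(3)], simp)+
  have v: "snd ?v \<in> controls P" "snd ?v' \<in> controls P" using u w by (auto simp: controls_def)
  have "hvar Psi w (s, t) = fcost P (s, t) ?v - fcost P (s, t) ?v'
     + (\<integral>\<omega>. Psi \<omega> \<bullet> kern P (rho \<omega>, (s, t)) ?v - Psi \<omega> \<bullet> kern P (rho \<omega>, (s, t)) ?v' \<partial>plane P)"
    using st by (simp add: hvar_def flat_def ctrl_def y inner_diff_right)
  also have "\<dots> = fcost P (s, t) ?v - fcost P (s, t) ?v'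
     + ((\<integral>\<omega>. Psi \<omega> \<bullet> kern P (rho \<omega>, (s, t)) ?v \<partial>plane P) - (\<integral>\<omega>. Psi \<omega> \<bullet> kern P (rho \<omega>, (s, t)) ?v' \<partial>plane P))"
    by (subst Bochner_Integration.integral_diff[OF integrable_plane[OF b] integrable_plane[OF b]]) simp
  finally show ?thesis
    unfolding h12_eq_pairing[OF st v(1)] h12_eq_pairing[OF st v(2)] k by simp
qed

lemma ctrl_along:
  assumes "(\<sigma>, \<tau>) \<in> rect P"
  shows "(z (\<sigma>, \<tau>), U (\<sigma>, \<tau>)) = along y u1 u2 u12 \<sigma> \<tau>" "U (\<sigma>, \<tau>) \<in> controls P"
  using assms y ctrl_in_controls[OF mc assms] by (simp_all add: along_def ctrl_def)

lemma lin_kern_jac: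
  shows "(s, t, \<sigma>) \<in> dom1 P \<Longrightarrow> p \<bullet> lin_kern (s, t) (\<sigma>, -1) h = (p v* jac_y (f1 P s t \<sigma>) (along y u1 u2 u12 \<sigma> t)) \<bullet> h"
    and "(s, t, \<tau>) \<in> dom2 P \<Longrightarrow> p \<bullet> lin_kern (s, t) (-1, \<tau>) h = (p v* jac_y (f2 P s t \<tau>) (along y u1 u2 u12 s \<tau>)) \<bullet> h"
    and "(s, t, \<sigma>, \<tau>) \<in> dom12 P \<Longrightarrow> p \<bullet> lin_kern (s, t) (\<sigma>, \<tau>) h = (p v* jac_y (f12 P s t \<sigma> \<tau>) (along y u1 u2 u12 \<sigma> \<tau>)) \<bullet> h"
proof -
  have *: "p \<bullet> lin_kern (s, t) \<omega> h = (p v* jac_y f (along y u1 u2 u12 \<sigma> \<tau>)) \<bullet> h"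
    if "src (s, t) \<omega> = (\<sigma>, \<tau>)" "(\<sigma>, \<tau>) \<in> rect P"
      and f: "\<And>\<eta>. kern P ((s, t), \<omega>) (\<eta>, U (\<sigma>, \<tau>)) = f (\<eta>, U (\<sigma>, \<tau>))" for \<omega> \<sigma> \<tau> f
  proof -
    let ?v = "(z (\<sigma>, \<tau>), U (\<sigma>, \<tau>))"
    have eq: "state_deriv (kern P ((s, t), \<omega>)) ?v = state_deriv f ?v"
      using f by (intro state_deriv_eqI) simp
    have "linear (state_deriv f ?v)" using C1_family_linear[OF C1_family_kern[OF reg]] eq by metis
    from vector_jac_y_inner[OF this, of p h] show ?thesis
      using eq by (simp add: lin_kern_def that(1) ctrl_along(1)[OF that(2)])
  qed
  show "p \<bullet> lin_kern (s, t) (\<sigma>, -1) h = (p v* jac_y (f1 P s t \<sigma>) (along y u1 u2 u12 \<sigma> t)) \<bullet> h"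
    if d: "(s, t, \<sigma>) \<in> dom1 P"
  proof (rule *)
    show r: "(\<sigma>, t) \<in> rect P" using d by (auto simp: dom1_def rect_def)
    show "kern P ((s, t), (\<sigma>, -1)) (\<eta>, U (\<sigma>, t)) = f1 P s t \<sigma> (\<eta>, U (\<sigma>, t))" for \<eta>
      using d ctrl_along(2)[OF r] by (simp add: kern_def, auto simp: dom1_def)
  qed (use d in \<open>auto simp: src_def dom1_def\<close>)
  show "p \<bullet> lin_kern (s, t) (-1, \<tau>) h = (p v* jac_y (f2 P s t \<tau>) (along y u1 u2 u12 s \<tau>)) \<bullet> h"
    if d: "(s, t, \<tau>) \<in> dom2 P"
  proof (rule *)
    show r: "(s, \<tau>) \<in> rect P" using d by (auto simp: dom2_def rect_def)
    show "kern P ((s, t), (-1, \<tau>)) (\<eta>, U (s, \<tau>)) = f2 P s t \<tau> (\<eta>, U (s, \<tau>))" for \<eta>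
      using d ctrl_along(2)[OF r] by (simp add: kern_def, auto simp: dom2_def)
  qed (use d in \<open>auto simp: src_def dom2_def\<close>)
  show "p \<bullet> lin_kern (s, t) (\<sigma>, \<tau>) h = (p v* jac_y (f12 P s t \<sigma> \<tau>) (along y u1 u2 u12 \<sigma> \<tau>)) \<bullet> h"
    if d: "(s, t, \<sigma>, \<tau>) \<in> dom12 P"
  proof (rule *)
    show r: "(\<sigma>, \<tau>) \<in> rect P" using d by (auto simp: dom12_def rect_def)
    show "kern P ((s, t), (\<sigma>, \<tau>)) (\<eta>, U (\<sigma>, \<tau>)) = f12 P s t \<sigma> \<tau> (\<eta>, U (\<sigma>, \<tau>))" for \<eta>
      using d ctrl_along(2)[OF r] by (simp add: kern_def, auto simp: dom12_def)
  qed (use d in \<open>auto simp: src_def dom12_def\<close>)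
qed

lemma lin_cost_grad:
  assumes "rho \<omega> = (\<sigma>, \<tau>)" "(\<sigma>, \<tau>) \<in> rect P"
    and "\<And>\<eta>. fcost P \<omega> (\<eta>, U (\<sigma>, \<tau>)) = F (\<eta>, U (\<sigma>, \<tau>))"
  shows "lin_cost \<omega> h = grad_y F (along y u1 u2 u12 \<sigma> \<tau>) \<bullet> h"
proof -
  let ?v = "(z (\<sigma>, \<tau>), U (\<sigma>, \<tau>))"
  have eq: "state_deriv (fcost P \<omega>) ?v = state_deriv F ?v"
    using assms(3) by (intro state_deriv_eqI) simp
  have "linear (state_deriv F ?v)" using C1_family_linear[OF C1_family_fcost[OF reg]] eq by metis
  from grad_y_inner[OF this, of h] show ?thesis
    using eq by (simp add: lin_cost_def assms(1) ctrl_along(1)[OF assms(2)])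
qed

lemma bounded_borel_lin_kern_fixed:
  "bounded_borel (\<lambda>x. lin_kern x \<omega> h)"
  using bounded_borel_section1[OF bounded_borel_lin_kern(1)[OF bounded_borel_const[of h]], of \<omega>] by simp

lemma lin_kern_outside: "\<not> (fst \<omega> \<le> fst x \<and> snd \<omega> \<le> snd x) \<Longrightarrow> lin_kern x \<omega> h = 0"
proof -
  assume "\<not> (fst \<omega> \<le> fst x \<and> snd \<omega> \<le> snd x)"
  then have "kern P (x, \<omega>) v = 0" for v using kern_support(3,4)[of P x \<omega> v] by blast
  then have "kern P (x, \<omega>) = (\<lambda>v. 0)" by auto
  then show ?thesis by (simp add: lin_kern_def)
qed

text \<open>
  The four sign patterns of \<open>\<omega>\<close> are the equations for \<open>\<psi>0\<close>, \<open>\<psi>1\<close>, \<open>\<psi>2\<close> and \<open>\<psi>12\<close>, each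
  paired with an arbitrary direction \<open>h\<close>.
\<close>

lemma adjoint_Psi: "adjoint Psi"
  unfolding adjoint_def
proof -
  let ?A = "endA P" and ?B = "endB P"
  let ?v = "along y u1 u2 u12"
  note C = costate[unfolded is_costate_def Let_def]
  have e0: "\<psi>0 = grad_y (F0 P) (?v ?A ?B)" using C by blast
  have e1: "\<psi>1 s = grad_y (F1 P s) (?v s ?B) + \<psi>0 v* jac_y (f1 P ?A ?B s) (?v s ?B)
             + (LBINT \<sigma>:{s..?A}. \<psi>1 \<sigma> v* jac_y (f1 P \<sigma> ?B s) (?v s ?B))" if "s \<in> {0..?A}" for s
    using C that by blast
  have e2: "\<psi>2 t = grad_y (F2 P t) (?v ?A t) + \<psi>0 v* jac_y (f2 P ?A ?B t) (?v ?A t)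
             + (LBINT \<tau>:{t..?B}. \<psi>2 \<tau> v* jac_y (f2 P ?A \<tau> t) (?v ?A t))" if "t \<in> {0..?B}" for t
    using C that by blast
  have e12: "\<psi>12 s t = grad_y (F12 P s t) (?v s t)
             + \<psi>1 s v* jac_y (f2 P s ?B t) (?v s t)
             + \<psi>2 t v* jac_y (f1 P ?A t s) (?v s t)
             + \<psi>0 v* jac_y (f12 P ?A ?B s t) (?v s t)
             + (LBINT \<sigma>:{s..?A}. \<psi>12 \<sigma> t v* jac_y (f1 P \<sigma> t s) (?v s t)
                               + \<psi>1 \<sigma> v* jac_y (f12 P \<sigma> ?B s t) (?v s t))
             + (LBINT \<tau>:{t..?B}. \<psi>12 s \<tau> v* jac_y (f2 P s \<tau> t) (?v s t)
                               + \<psi>2 \<tau> v* jac_y (f12 P ?A \<tau> s t) (?v s t))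
             + (LBINT \<sigma>:{s..?A}. LBINT \<tau>:{t..?B}. \<psi>12 \<sigma> \<tau> v* jac_y (f12 P \<sigma> \<tau> s t) (?v s t))"
    if "s \<in> {0..?A}" "t \<in> {0..?B}" for s t
    using C that by blast
  note Pb = bounded_borel_Psi
  have main: "Psi (a, b) \<bullet> h = adjoint_rhs Psi (a, b) h"
    if ab: "a \<le> ?A" "b \<le> ?B" for a b h
  proof -
    consider "a < 0" "b < 0" | "0 \<le> a" "b < 0" | "a < 0" "0 \<le> b" | "0 \<le> a" "0 \<le> b" by linarith
    then show ?thesis
    proof cases
      case 1
      have r: "(?A, ?B) \<in> rect P" using AB by (simp add: rect_def)
      have "lin_cost (a, b) h = grad_y (F0 P) (?v ?A ?B) \<bullet> h"
        by (rule lin_cost_grad[OF _ r]) (use 1 ctrl_along(2)[OF r] in \<open>simp_all add: src_def fcost_def\<close>)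
      then have "lin_cost (a, b) h = \<psi>0 \<bullet> h" unfolding e0[symmetric] .
      then show ?thesis using 1 by (simp add: Psi_def adjoint_rhs_def)
    next
      case 2
      have r: "(a, ?B) \<in> rect P" using AB ab 2 by (simp add: rect_def)
      have c: "lin_cost (a, b) h = grad_y (F1 P a) (?v a ?B) \<bullet> h"
        by (rule lin_cost_grad[OF _ r]) (use 2 ab ctrl_along(2)[OF r] in \<open>simp_all add: src_def fcost_def\<close>)
      let ?g = "\<lambda>h \<sigma>. Psi (\<sigma>, -1) \<bullet> lin_kern (\<sigma>, ?B) (a, -1) h"
      have g: "bounded_borel (?g h)" for h
        by (intro bounded_borel_inner bounded_borel_section1[OF Pb] bounded_borel_section1[OF bounded_borel_lin_kern_fixed])
      have m: "(\<lambda>\<sigma>. rho (\<sigma>, b)) \<in> borel_measurable borel"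
        by (rule measurable_compose[OF _ src_corner_measurable]) (intro borel_measurable_continuous_onI continuous_intros)
      have f: "bounded_borel (\<lambda>\<sigma>. Psi (\<sigma>, b) \<bullet> lin_kern (rho (\<sigma>, b)) (a, -1) h)"
        by (intro bounded_borel_inner bounded_borel_section1[OF Pb] bounded_borel_compose[OF bounded_borel_lin_kern_fixed m])
      have "(\<integral>\<sigma>. Psi (\<sigma>, b) \<bullet> lin_kern (rho (\<sigma>, b)) (a, -1) h \<partial>ext_lebesgue ?A) =
          Psi (-1, b) \<bullet> lin_kern (rho (-1, b)) (a, -1) h + (LBINT \<sigma>:{0..?A}. Psi (\<sigma>, b) \<bullet> lin_kern (rho (\<sigma>, b)) (a, -1) h)"
        by (rule integral_ext_lebesgue[OF f]) (use AB 2 in \<open>auto simp: Psi_def src_def\<close>)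
      also have "(LBINT \<sigma>:{0..?A}. Psi (\<sigma>, b) \<bullet> lin_kern (rho (\<sigma>, b)) (a, -1) h) = (LBINT \<sigma>:{a..?A}. ?g h \<sigma>)"
        using 2 by (intro set_integral_shrink) (auto simp: Psi_def src_def lin_kern_outside)
      also have "\<dots> = (LBINT \<sigma>:{a..?A}. \<psi>1 \<sigma> v* jac_y (f1 P \<sigma> ?B a) (?v a ?B)) \<bullet> h"
        using 2 AB by (intro set_integral_inner_bounded[symmetric] g)
          (simp add: lin_kern_jac(1) dom1_def Psi_def)
      also have "Psi (-1, b) \<bullet> lin_kern (rho (-1, b)) (a, -1) h = (\<psi>0 v* jac_y (f1 P ?A ?B a) (?v a ?B)) \<bullet> h"
        using 2 AB ab by (simp add: Psi_def src_def lin_kern_jac(1) dom1_def)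
      finally show ?thesis using 2 ab c e1[of a] by (simp add: Psi_def adjoint_rhs_def inner_add_left)
    next
      case 3
      have r: "(?A, b) \<in> rect P" using AB ab 3 by (simp add: rect_def)
      have c: "lin_cost (a, b) h = grad_y (F2 P b) (?v ?A b) \<bullet> h"
        by (rule lin_cost_grad[OF _ r]) (use 3 ab ctrl_along(2)[OF r] in \<open>simp_all add: src_def fcost_def\<close>)
      let ?g = "\<lambda>h \<tau>. Psi (-1, \<tau>) \<bullet> lin_kern (?A, \<tau>) (-1, b) h"
      have g: "bounded_borel (?g h)" for h
        by (intro bounded_borel_inner bounded_borel_section2[OF Pb] bounded_borel_section2[OF bounded_borel_lin_kern_fixed])
      have m: "(\<lambda>\<tau>. rho (a, \<tau>)) \<in> borel_measurable borel"
        by (rule measurable_compose[OF _ src_corner_measurable]) (intro borel_measurable_continuous_onI continuous_intros)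
      have f: "bounded_borel (\<lambda>\<tau>. Psi (a, \<tau>) \<bullet> lin_kern (rho (a, \<tau>)) (-1, b) h)"
        by (intro bounded_borel_inner bounded_borel_section2[OF Pb] bounded_borel_compose[OF bounded_borel_lin_kern_fixed m])
      have "(\<integral>\<tau>. Psi (a, \<tau>) \<bullet> lin_kern (rho (a, \<tau>)) (-1, b) h \<partial>ext_lebesgue ?B) =
          Psi (a, -1) \<bullet> lin_kern (rho (a, -1)) (-1, b) h + (LBINT \<tau>:{0..?B}. Psi (a, \<tau>) \<bullet> lin_kern (rho (a, \<tau>)) (-1, b) h)"
        by (rule integral_ext_lebesgue[OF f]) (use AB 3 in \<open>auto simp: Psi_def src_def\<close>)
      also have "(LBINT \<tau>:{0..?B}. Psi (a, \<tau>) \<bullet> lin_kern (rho (a, \<tau>)) (-1, b) h) = (LBINT \<tau>:{b..?B}. ?g h \<tau>)"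
        using 3 by (intro set_integral_shrink) (auto simp: Psi_def src_def lin_kern_outside)
      also have "\<dots> = (LBINT \<tau>:{b..?B}. \<psi>2 \<tau> v* jac_y (f2 P ?A \<tau> b) (?v ?A b)) \<bullet> h"
        using 3 AB by (intro set_integral_inner_bounded[symmetric] g)
          (simp add: lin_kern_jac(2) dom2_def Psi_def)
      also have "Psi (a, -1) \<bullet> lin_kern (rho (a, -1)) (-1, b) h = (\<psi>0 v* jac_y (f2 P ?A ?B b) (?v ?A b)) \<bullet> h"
        using 3 AB ab by (simp add: Psi_def src_def lin_kern_jac(2) dom2_def)
      finally show ?thesis using 3 ab c e2[of b] by (simp add: Psi_def adjoint_rhs_def inner_add_left)
    next
      case 4
      have r: "(a, b) \<in> rect P" using ab 4 by (simp add: rect_def)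
      have c: "lin_cost (a, b) h = grad_y (F12 P a b) (?v a b) \<bullet> h"
        by (rule lin_cost_grad[OF _ r]) (use 4 r ctrl_along(2)[OF r] in \<open>simp_all add: src_def fcost_def\<close>)
      define \<kappa>1 where "\<kappa>1 h \<sigma> = lin_kern (\<sigma>, b) (a, -1) h" for h \<sigma>
      define \<kappa>2 where "\<kappa>2 h \<tau> = lin_kern (a, \<tau>) (-1, b) h" for h \<tau>
      define \<kappa>12 where "\<kappa>12 h x = lin_kern x (a, b) h" for h x
      have bb: "bounded_borel (\<kappa>1 h)" "bounded_borel (\<kappa>2 h)" "bounded_borel (\<kappa>12 h)" for h
        unfolding \<kappa>1_def \<kappa>2_def \<kappa>12_def
        by (rule bounded_borel_section1[OF bounded_borel_lin_kern_fixed] bounded_borel_section2[OF bounded_borel_lin_kern_fixed]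
            bounded_borel_lin_kern_fixed)+
      have rr: "lin_kern (rho (\<sigma>, b)) (a, -1) h = \<kappa>1 h (fst (rho (\<sigma>, b)))" "lin_kern (rho (a, \<tau>)) (-1, b) h = \<kappa>2 h (snd (rho (a, \<tau>)))" for \<sigma> \<tau>
        using 4 by (auto simp: \<kappa>1_def \<kappa>2_def src_def)
      have E: "(\<integral>\<sigma>. Psi (\<sigma>, b) \<bullet> lin_kern (rho (\<sigma>, b)) (a, -1) h \<partial>ext_lebesgue ?A)
          + (\<integral>\<tau>. Psi (a, \<tau>) \<bullet> lin_kern (rho (a, \<tau>)) (-1, b) h \<partial>ext_lebesgue ?B)
          + (\<integral>\<omega>'. Psi \<omega>' \<bullet> lin_kern (rho \<omega>') (a, b) h \<partial>plane P)
          = \<psi>0 \<bullet> \<kappa>12 h (corner P) + \<psi>1 a \<bullet> \<kappa>2 h ?B + \<psi>2 b \<bullet> \<kappa>1 h ?A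
          + (LBINT \<sigma>:{a..?A}. \<psi>12 \<sigma> b \<bullet> \<kappa>1 h \<sigma> + \<psi>1 \<sigma> \<bullet> \<kappa>12 h (\<sigma>, ?B))
          + (LBINT \<tau>:{b..?B}. \<psi>12 a \<tau> \<bullet> \<kappa>2 h \<tau> + \<psi>2 \<tau> \<bullet> \<kappa>12 h (?A, \<tau>))
          + (LBINT \<sigma>:{a..?A}. LBINT \<tau>:{b..?B}. \<psi>12 \<sigma> \<tau> \<bullet> \<kappa>12 h (\<sigma>, \<tau>))"
        unfolding rr \<kappa>12_def[symmetric]
        by (rule pairing_split[OF bb]) (use 4 ab in \<open>auto simp: \<kappa>1_def \<kappa>2_def \<kappa>12_def lin_kern_outside\<close>)
      let ?g1 = "\<lambda>h \<sigma>. Psi (\<sigma>, b) \<bullet> \<kappa>1 h \<sigma> + Psi (\<sigma>, -1) \<bullet> \<kappa>12 h (\<sigma>, ?B)"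
      let ?g2 = "\<lambda>h \<tau>. Psi (a, \<tau>) \<bullet> \<kappa>2 h \<tau> + Psi (-1, \<tau>) \<bullet> \<kappa>12 h (?A, \<tau>)"
      let ?g12 = "\<lambda>h x. Psi x \<bullet> \<kappa>12 h x"
      have g: "bounded_borel (?g1 h)" "bounded_borel (?g2 h)" "bounded_borel (?g12 h)" for h
        by (intro bounded_borel_add(1) bounded_borel_inner bb bounded_borel_section1[OF Pb] bounded_borel_section2[OF Pb] Pb
            bounded_borel_section1[OF bb(3)] bounded_borel_section2[OF bb(3)])+
      have j: "\<psi>0 \<bullet> \<kappa>12 h (corner P) = (\<psi>0 v* jac_y (f12 P ?A ?B a b) (?v a b)) \<bullet> h"
        "\<psi>1 a \<bullet> \<kappa>2 h ?B = (\<psi>1 a v* jac_y (f2 P a ?B b) (?v a b)) \<bullet> h"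
        "\<psi>2 b \<bullet> \<kappa>1 h ?A = (\<psi>2 b v* jac_y (f1 P ?A b a) (?v a b)) \<bullet> h"
        unfolding \<kappa>1_def \<kappa>2_def \<kappa>12_def
        by (rule lin_kern_jac; use 4 ab in \<open>simp add: dom1_def dom2_def dom12_def\<close>)+
      have S1: "(LBINT \<sigma>:{a..?A}. \<psi>12 \<sigma> b \<bullet> \<kappa>1 h \<sigma> + \<psi>1 \<sigma> \<bullet> \<kappa>12 h (\<sigma>, ?B)) =
          (LBINT \<sigma>:{a..?A}. \<psi>12 \<sigma> b v* jac_y (f1 P \<sigma> b a) (?v a b) + \<psi>1 \<sigma> v* jac_y (f12 P \<sigma> ?B a b) (?v a b)) \<bullet> h"
      proof -
        have "(LBINT \<sigma>:{a..?A}. \<psi>12 \<sigma> b \<bullet> \<kappa>1 h \<sigma> + \<psi>1 \<sigma> \<bullet> \<kappa>12 h (\<sigma>, ?B)) = (LBINT \<sigma>:{a..?A}. ?g1 h \<sigma>)"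
          using 4 ab by (intro set_integral_shrink) (auto simp: Psi_def rect_def)
        also have "\<dots> = (LBINT \<sigma>:{a..?A}. \<psi>12 \<sigma> b v* jac_y (f1 P \<sigma> b a) (?v a b) + \<psi>1 \<sigma> v* jac_y (f12 P \<sigma> ?B a b) (?v a b)) \<bullet> h"
          using 4 ab by (intro set_integral_inner_bounded[symmetric] g)
            (simp add: \<kappa>1_def \<kappa>12_def lin_kern_jac dom1_def dom12_def Psi_def rect_def inner_add_left)
        finally show ?thesis .
      qed
      have S2: "(LBINT \<tau>:{b..?B}. \<psi>12 a \<tau> \<bullet> \<kappa>2 h \<tau> + \<psi>2 \<tau> \<bullet> \<kappa>12 h (?A, \<tau>)) =
          (LBINT \<tau>:{b..?B}. \<psi>12 a \<tau> v* jac_y (f2 P a \<tau> b) (?v a b) + \<psi>2 \<tau> v* jac_y (f12 P ?A \<tau> a b) (?v a b)) \<bullet> h"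
      proof -
        have "(LBINT \<tau>:{b..?B}. \<psi>12 a \<tau> \<bullet> \<kappa>2 h \<tau> + \<psi>2 \<tau> \<bullet> \<kappa>12 h (?A, \<tau>)) = (LBINT \<tau>:{b..?B}. ?g2 h \<tau>)"
          using 4 ab by (intro set_integral_shrink) (auto simp: Psi_def rect_def)
        also have "\<dots> = (LBINT \<tau>:{b..?B}. \<psi>12 a \<tau> v* jac_y (f2 P a \<tau> b) (?v a b) + \<psi>2 \<tau> v* jac_y (f12 P ?A \<tau> a b) (?v a b)) \<bullet> h"
          using 4 ab by (intro set_integral_inner_bounded[symmetric] g)
            (simp add: \<kappa>2_def \<kappa>12_def lin_kern_jac dom2_def dom12_def Psi_def rect_def inner_add_left)
        finally show ?thesis .
      qed
      have S12: "(LBINT \<sigma>:{a..?A}. LBINT \<tau>:{b..?B}. \<psi>12 \<sigma> \<tau> \<bullet> \<kappa>12 h (\<sigma>, \<tau>)) =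
          (LBINT \<sigma>:{a..?A}. LBINT \<tau>:{b..?B}. \<psi>12 \<sigma> \<tau> v* jac_y (f12 P \<sigma> \<tau> a b) (?v a b)) \<bullet> h"
      proof -
        have inner: "(LBINT \<tau>:{b..?B}. \<psi>12 \<sigma> \<tau> v* jac_y (f12 P \<sigma> \<tau> a b) (?v a b)) \<bullet> h = (LBINT \<tau>:{b..?B}. ?g12 h (\<sigma>, \<tau>))"
          if "\<sigma> \<in> {a..?A}" for \<sigma> h
          using 4 ab that by (intro set_integral_inner_bounded bounded_borel_section2[OF g(3)])
            (simp add: \<kappa>12_def lin_kern_jac dom12_def Psi_def rect_def)
        have "(LBINT \<sigma>:{a..?A}. LBINT \<tau>:{b..?B}. \<psi>12 \<sigma> \<tau> \<bullet> \<kappa>12 h (\<sigma>, \<tau>)) = (LBINT \<sigma>:{a..?A}. LBINT \<tau>:{b..?B}. ?g12 h (\<sigma>, \<tau>))"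
        proof (rule set_integral_shrink)
          fix \<sigma> assume \<sigma>: "\<sigma> \<in> {a..?A}"
          have "(LBINT \<tau>:{b..?B}. \<psi>12 \<sigma> \<tau> \<bullet> \<kappa>12 h (\<sigma>, \<tau>)) = (LBINT \<tau>:{b..?B}. ?g12 h (\<sigma>, \<tau>))"
            using 4 ab \<sigma> by (intro set_integral_shrink) (auto simp: Psi_def rect_def)
          then show "\<sigma> \<in> {a..?A} \<and> (LBINT \<tau>:{b..?B}. \<psi>12 \<sigma> \<tau> \<bullet> \<kappa>12 h (\<sigma>, \<tau>)) = (LBINT \<tau>:{b..?B}. ?g12 h (\<sigma>, \<tau>))"
            using \<sigma> by blast
        qed simp
        also have "\<dots> = (LBINT \<sigma>:{a..?A}. LBINT \<tau>:{b..?B}. \<psi>12 \<sigma> \<tau> v* jac_y (f12 P \<sigma> \<tau> a b) (?v a b)) \<bullet> h"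
          using 4 AB inner by (intro set_integral_inner_bounded[symmetric] bounded_borel_set_integral g) auto
        finally show ?thesis .
      qed
      have "Psi (a, b) \<bullet> h = \<psi>12 a b \<bullet> h" using 4 r by (simp add: Psi_def)
      also have "\<dots> = lin_cost (a, b) h + (\<psi>0 \<bullet> \<kappa>12 h (corner P) + \<psi>1 a \<bullet> \<kappa>2 h ?B + \<psi>2 b \<bullet> \<kappa>1 h ?A
          + (LBINT \<sigma>:{a..?A}. \<psi>12 \<sigma> b \<bullet> \<kappa>1 h \<sigma> + \<psi>1 \<sigma> \<bullet> \<kappa>12 h (\<sigma>, ?B))
          + (LBINT \<tau>:{b..?B}. \<psi>12 a \<tau> \<bullet> \<kappa>2 h \<tau> + \<psi>2 \<tau> \<bullet> \<kappa>12 h (?A, \<tau>))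
          + (LBINT \<sigma>:{a..?A}. LBINT \<tau>:{b..?B}. \<psi>12 \<sigma> \<tau> \<bullet> \<kappa>12 h (\<sigma>, \<tau>)))"
        unfolding S1 S2 S12 j c using 4 ab by (subst e12) (simp_all add: inner_add_left)
      finally show ?thesis unfolding E[symmetric] using 4 by (simp add: adjoint_rhs_def)
    qed
  qed
  have "AE \<omega> in plane P. \<omega> \<in> {-1..?A} \<times> {-1..?B} \<and> True \<and> True"
    by (rule AE_ext_planeI) auto
  then show "AE \<omega> in plane P. \<forall>h. Psi \<omega> \<bullet> h = adjoint_rhs Psi \<omega> h"
  proof (rule eventually_mono)
    fix \<omega> assume "\<omega> \<in> {-1..?A} \<times> {-1..?B} \<and> True \<and> True"
    then have "fst \<omega> \<le> ?A" "snd \<omega> \<le> ?B" by auto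
    from main[OF this] show "\<forall>h. Psi \<omega> \<bullet> h = adjoint_rhs Psi \<omega> h"
      unfolding prod.collapse by blast
  qed
qed

end

section \<open>The increment of the Hamiltonian is nonnegative\<close>

lemma measure_ext_lebesgue_Icc:
  assumes "0 \<le> l" "l \<le> u" "u \<le> a"
  shows "emeasure (ext_lebesgue a) {l..u} = ennreal (u - l)"
proof -
  have "{l..u} \<inter> {-1..a} = {l..u}" using assms by auto
  then show ?thesis using assms by (simp add: emeasure_ext_lebesgue)
qed

lemma measure_ext_plane_box:
  assumes "0 \<le> s1" "s1 \<le> s2" "s2 \<le> a" "0 \<le> t1" "t1 \<le> t2" "t2 \<le> b"
  shows "measure (ext_plane a b) ({s1..s2} \<times> {t1..t2}) = (s2 - s1) * (t2 - t1)"
proof -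
  interpret b: sigma_finite_measure "ext_lebesgue b" by (simp add: finite_measure.axioms(1))
  have "emeasure (ext_plane a b) ({s1..s2} \<times> {t1..t2}) = ennreal (s2 - s1) * ennreal (t2 - t1)"
    unfolding ext_plane_def using assms
    by (subst b.emeasure_pair_measure_Times) (simp_all add: measure_ext_lebesgue_Icc)
  also have "\<dots> = ennreal ((s2 - s1) * (t2 - t1))" using assms by (simp add: ennreal_mult)
  finally show ?thesis using assms by (simp add: measure_def)
qed

context controlled_path
begin

lemma bounded_borel_hvar:
  assumes \<Psi>: "bounded_borel \<Psi>" and w: "w \<in> U12 P"
  shows "bounded_borel (hvar \<Psi> w)"
proof -
  note kern = C1_family_kern[OF reg] and cst = C1_family_fcost[OF reg]
  have m1: "fst \<in> borel_measurable (borel :: ((real \<times> real) \<times> (real \<times> real)) measure)"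
    "snd \<in> borel_measurable (borel :: ((real \<times> real) \<times> (real \<times> real)) measure)"
    by (intro borel_measurable_continuous_onI continuous_intros)+
  have rm: "(\<lambda>p :: (real \<times> real) \<times> (real \<times> real). (rho (snd p), fst p)) \<in> borel_measurable borel"
    by (intro borel_measurable_Pair m1 measurable_compose[OF m1(2) src_corner_measurable])
  have "bounded_borel (\<lambda>p. \<Psi> (snd p) \<bullet> (kern P (rho (snd p), fst p) (z (fst p), flat w (fst p)) - kern P (rho (snd p), fst p) (z (fst p), U (fst p))))"
    by (intro bounded_borel_inner bounded_borel_add(2) bounded_borel_compose[OF \<Psi> m1(2)]
        C1_family_compose(1)[OF kern z flat_measurable[OF w] rm m1(1)] C1_family_compose(1)[OF kern z U rm m1(1)])
  from bounded_borel_integral[OF this finite_measure_ext_plane sets_ext_plane]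
  show ?thesis unfolding hvar_def[abs_def]
    by (intro bounded_borel_add C1_family_compose(1)[OF cst z flat_measurable[OF w] ident_borel ident_borel]
        C1_family_compose(1)[OF cst z U ident_borel ident_borel]) simp
qed

text \<open>
  Dominated convergence, with the co-state as a bounded factor.  As \<open>(s, t)\<close> is an interior point,
  the kernel is discontinuous at most for \<open>fst \<omega> = s\<close> or \<open>snd \<omega> = t\<close>, which is a null set.
\<close>

lemma hvar_tendsto:
  assumes \<Psi>: "bounded_borel \<Psi>" and w: "w \<in> U12 P"
    and X: "\<And>n. (S n, T n) \<in> rect P" and s: "0 < s" "s < endA P" and t: "0 < t" "t < endB P"
    and ls: "S \<longlonglongrightarrow> s" and lt: "T \<longlonglongrightarrow> t"
    and l1: "(\<lambda>n. u1 (S n)) \<longlonglongrightarrow> u1 s" and l2: "(\<lambda>n. u2 (T n)) \<longlonglongrightarrow> u2 t"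
    and l12: "(\<lambda>n. u12 (S n) (T n)) \<longlonglongrightarrow> u12 s t"
  shows "(\<lambda>n. hvar \<Psi> w (S n, T n)) \<longlonglongrightarrow> hvar \<Psi> w (s, t)"
proof -
  let ?x = "(s, t)" and ?X = "\<lambda>n. (S n, T n)"
  note R = reg[unfolded regular_problem_def C1_in_def]
  have xr: "?x \<in> rect P" using s t by (simp add: rect_def)
  have ST: "0 \<le> S n" "S n \<le> endA P" "0 \<le> T n" "T n \<le> endB P" for n
    using X[of n] by (auto simp: rect_def)
  have zl: "(\<lambda>n. z (?X n)) \<longlonglongrightarrow> z ?x"
    using fixpoint_state_continuous[OF reg ind mc z fx] X l1 l2 tendsto_Pair[OF ls lt]
    unfolding state_continuous_def by (auto dest!: spec[of _ ?X] spec[of _ ?x])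
  have fl: "(\<lambda>n. (z (?X n), flat w (?X n))) \<longlonglongrightarrow> (z ?x, flat w ?x)"
    using X xr by (simp add: flat_def ctrl_def) (intro tendsto_intros zl l1 l2)
  have Ul: "(\<lambda>n. (z (?X n), U (?X n))) \<longlonglongrightarrow> (z ?x, U ?x)"
    using X xr by (simp add: ctrl_def) (intro tendsto_intros zl l1 l2 l12)
  have inU: "U x \<in> controls P" and inF: "flat w x \<in> controls P" if "x \<in> rect P" for x
  proof -
    show "U x \<in> controls P" using that by (rule ctrl_in_controls[OF mc])
    show "flat w x \<in> controls P" unfolding flat_def
      using mc w that by (intro ctrl_in_controls) (auto simp: measurable_controls_def)
  qed
  have cost: "(\<lambda>n. fcost P (?X n) (v n)) \<longlonglongrightarrow> fcost P ?x v'"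
    if v: "v \<longlonglongrightarrow> v'" "\<And>n. snd (v n) \<in> controls P" "snd v' \<in> controls P" for v v'
  proof -
    have "(\<lambda>n. (\<lambda>(p, v). (\<lambda>(s, t). F12 P s t) p v) (?X n, v n)) \<longlonglongrightarrow> (\<lambda>(p, v). (\<lambda>(s, t). F12 P s t) p v) (?x, v')"
      by (rule continuous_on_tendsto_compose[where s="rect P \<times> (UNIV \<times> controls P)"])
         (use R X xr v in \<open>auto intro!: tendsto_intros ls lt simp: mem_Times_iff\<close>)
    moreover have "fcost P (?X n) (v n) = F12 P (S n) (T n) (v n)" for n
      using X[of n] ST[of n] v(2)[of n] by (simp add: fcost_def)
    moreover have "fcost P ?x v' = F12 P s t v'" using xr s t v(3) by (simp add: fcost_def)
    ultimately show ?thesis by simp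
  qed
  have kern: "(\<lambda>n. kern P (rho \<omega>, ?X n) (v n)) \<longlonglongrightarrow> kern P (rho \<omega>, ?x) v'"
    if v: "v \<longlonglongrightarrow> v'" "\<And>n. snd (v n) \<in> controls P" "snd v' \<in> controls P"
      and om: "\<omega> \<in> {-1..endA P} \<times> {-1..endB P}" "fst \<omega> \<noteq> s" "snd \<omega> \<noteq> t" for v v' \<omega>
  proof -
    have r: "rho \<omega> \<in> rect P" "fst (rho \<omega>) \<noteq> s" "snd (rho \<omega>) \<noteq> t"
      using om s t by (cases \<omega>; auto simp: src_def rect_def)+
    have "(\<lambda>n. kern P ((fst (rho \<omega>), snd (rho \<omega>)), (S n, T n)) (v n)) \<longlonglongrightarrow> kern P ((fst (rho \<omega>), snd (rho \<omega>)), (s, t)) v'"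
      by (rule kern_tendsto[OF reg]) (use r ST s t v ls lt in \<open>auto simp: not_less[symmetric]\<close>)
    then show ?thesis by simp
  qed
  obtain R0 where R0: "\<And>x. norm (z x) \<le> R0" using bounded_borelE[OF z] by metis
  obtain C where C: "C \<ge> 0" "\<And>i v. norm (fst v) \<le> R0 \<Longrightarrow> norm (kern P i v) \<le> C"
    using C1_family_bounded[OF C1_family_kern[OF reg]] by metis
  obtain Cp where Cp: "Cp \<ge> 0" "\<And>x. norm (\<Psi> x) \<le> Cp" using bounded_borelE[OF \<Psi>] by metis
  have rm: "(\<lambda>\<omega>. (rho \<omega>, x)) \<in> borel_measurable borel" for x :: "real \<times> real"
    by (intro borel_measurable_Pair src_corner_measurable) auto
  have cm: "(\<lambda>\<omega>. x) \<in> borel_measurable (borel :: (real \<times> real) measure)" for x :: "real \<times> real" by simp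
  let ?G = "\<lambda>x \<omega>. \<Psi> \<omega> \<bullet> (kern P (rho \<omega>, x) (z x, flat w x) - kern P (rho \<omega>, x) (z x, U x))"
  have bG: "bounded_borel (?G x)" for x
    by (intro bounded_borel_inner \<Psi> bounded_borel_add(2)
        C1_family_compose(1)[OF C1_family_kern[OF reg] z flat_measurable[OF w] rm cm]
        C1_family_compose(1)[OF C1_family_kern[OF reg] z U rm cm])
  have int: "(\<lambda>n. \<integral>\<omega>. ?G (?X n) \<omega> \<partial>plane P) \<longlonglongrightarrow> (\<integral>\<omega>. ?G ?x \<omega> \<partial>plane P)"
  proof (rule integral_dominated_convergence[where w="\<lambda>_. Cp * (C + C)"])
    show "?G ?x \<in> borel_measurable (plane P)" "\<And>n. ?G (?X n) \<in> borel_measurable (plane P)"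
      using bounded_borel_measurable[OF bG] by simp_all
    show "integrable (plane P) (\<lambda>_. Cp * (C + C))" by (simp add: finite_measure.integrable_const)
    show "AE \<omega> in plane P. norm (?G (?X n) \<omega>) \<le> Cp * (C + C)" for n
    proof (rule AE_I2)
      fix \<omega>
      let ?d = "kern P (rho \<omega>, ?X n) (z (?X n), flat w (?X n)) - kern P (rho \<omega>, ?X n) (z (?X n), U (?X n))"
      have "norm ?d \<le> C + C"
        by (rule order_trans[OF norm_triangle_ineq4], rule add_mono; rule C(2)) (use R0 in auto)
      then have "norm (\<Psi> \<omega>) * norm ?d \<le> Cp * (C + C)" using Cp by (intro mult_mono) auto
      then show "norm (?G (?X n) \<omega>) \<le> Cp * (C + C)"
        using Cauchy_Schwarz_ineq2[of "\<Psi> \<omega>" ?d] by simp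
    qed
    have "AE \<omega> in plane P. \<omega> \<in> {-1..endA P} \<times> {-1..endB P} \<and> fst \<omega> \<noteq> s \<and> snd \<omega> \<noteq> t"
      by (rule AE_ext_planeI) (auto intro: AE_lborel_singleton)
    then show "AE \<omega> in plane P. (\<lambda>n. ?G (?X n) \<omega>) \<longlonglongrightarrow> ?G ?x \<omega>"
    proof (rule eventually_mono)
      fix \<omega> assume "\<omega> \<in> {-1..endA P} \<times> {-1..endB P} \<and> fst \<omega> \<noteq> s \<and> snd \<omega> \<noteq> t"
      then have om: "\<omega> \<in> {-1..endA P} \<times> {-1..endB P}" "fst \<omega> \<noteq> s" "snd \<omega> \<noteq> t" by auto
      have k1: "(\<lambda>n. kern P (rho \<omega>, ?X n) (z (?X n), flat w (?X n))) \<longlonglongrightarrow> kern P (rho \<omega>, ?x) (z ?x, flat w ?x)"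
        by (rule kern[OF fl _ _ om]) (simp_all add: inF X xr)
      have k2: "(\<lambda>n. kern P (rho \<omega>, ?X n) (z (?X n), U (?X n))) \<longlonglongrightarrow> kern P (rho \<omega>, ?x) (z ?x, U ?x)"
        by (rule kern[OF Ul _ _ om]) (simp_all add: inU X xr)
      show "(\<lambda>n. ?G (?X n) \<omega>) \<longlonglongrightarrow> ?G ?x \<omega>" by (intro tendsto_intros k1 k2)
    qed
  qed
  have c1: "(\<lambda>n. fcost P (?X n) (z (?X n), flat w (?X n))) \<longlonglongrightarrow> fcost P ?x (z ?x, flat w ?x)"
    by (rule cost[OF fl]) (simp_all add: inF X xr)
  have c2: "(\<lambda>n. fcost P (?X n) (z (?X n), U (?X n))) \<longlonglongrightarrow> fcost P ?x (z ?x, U ?x)"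
    by (rule cost[OF Ul]) (simp_all add: inU X xr)
  show ?thesis unfolding hvar_def by (intro tendsto_add tendsto_diff c1 c2 int)
qed

lemma hvar_nonneg:
  assumes \<Psi>: "bounded_borel \<Psi>" "adjoint \<Psi>" and w: "w \<in> U12 P"
    and s: "0 < s" "s < endA P" and t: "0 < t" "t < endB P"
    and cont: "isCont u1 s" "isCont u2 t" "isCont (\<lambda>(\<sigma>, \<tau>). u12 \<sigma> \<tau>) (s, t)"
    and opt: "\<And>s1 s2 t1 t2 z'. 0 < s1 \<Longrightarrow> s1 < s2 \<Longrightarrow> s2 < endA P \<Longrightarrow> 0 < t1 \<Longrightarrow> t1 < t2 \<Longrightarrow> t2 < endB P \<Longrightarrow>
      bounded_borel z' \<Longrightarrow> volterra P (needle w ({s1..s2} \<times> {t1..t2})) z' = z' \<Longrightarrow>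
      path_cost P U z \<le>
      path_cost P (needle w ({s1..s2} \<times> {t1..t2})) z'"
  shows "0 \<le> hvar \<Psi> w (s, t)"
proof (rule ccontr)
  interpret N: finite_measure "plane P" by simp
  assume "\<not> 0 \<le> hvar \<Psi> w (s, t)"
  define c where "c = - hvar \<Psi> w (s, t) / 2"
  have c: "c > 0" and hc: "hvar \<Psi> w (s, t) < - c" using \<open>\<not> 0 \<le> hvar \<Psi> w (s, t)\<close> by (auto simp: c_def)
  \<comment> \<open>Half the distance to the boundary, so that all squares lie in the open rectangle.\<close>
  define r0 where "r0 = min (min s (endA P - s)) (min t (endB P - t)) / 2"
  have r0: "r0 > 0" "r0 < s" "r0 < endA P - s" "r0 < t" "r0 < endB P - t"
    using s t by (auto simp: r0_def min_def)
  define r where "r n = r0 / real (Suc n)" for n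
  have r: "0 < r n" "r n \<le> r0" for n using r0(1) by (auto simp: r_def field_simps)
  have rlim: "r \<longlonglongrightarrow> 0" unfolding r_def[abs_def] by (rule LIMSEQ_Suc[OF lim_const_over_n])
  define Q where "Q n = {s - r n..s + r n} \<times> {t - r n..t + r n}" for n
  have Qrect: "Q n \<subseteq> {0..<endA P} \<times> {0..<endB P}" for n
    using r[of n] r0 by (auto simp: Q_def)
  have Qborel: "Q n \<in> sets borel" for n unfolding Q_def by (intro borel_closed closed_Times) auto
  have Qm: "measure (plane P) (Q n) = 4 * (r n)\<^sup>2" for n
    unfolding Q_def using r[of n] r0 by (subst measure_ext_plane_box) (auto simp: power2_eq_square)
  have near: "\<forall>\<^sub>F n in sequentially. \<forall>x\<in>Q n. hvar \<Psi> w x \<le> - c"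
  proof (rule ccontr)
    assume "\<not> (\<forall>\<^sub>F n in sequentially. \<forall>x\<in>Q n. hvar \<Psi> w x \<le> - c)"
    then have "\<exists>\<^sub>F n in sequentially. \<exists>x\<in>Q n. - c < hvar \<Psi> w x"
      by (simp add: frequently_def not_less)
    have "\<exists>x. x \<in> Q n \<and> ((\<exists>x\<in>Q n. - c < hvar \<Psi> w x) \<longrightarrow> - c < hvar \<Psi> w x)" for n
    proof (cases "\<exists>x\<in>Q n. - c < hvar \<Psi> w x")
      case False
      have "(s, t) \<in> Q n" using r[of n] by (simp add: Q_def)
      then show ?thesis using False by blast
    qed blast
    then obtain X where X: "\<And>n. X n \<in> Q n" "\<And>n. (\<exists>x\<in>Q n. - c < hvar \<Psi> w x) \<Longrightarrow> - c < hvar \<Psi> w (X n)"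
      by metis
    define S T where "S n = fst (X n)" and "T n = snd (X n)" for n
    have XST: "X n = (S n, T n)" for n by (simp add: S_def T_def)
    have bd: "\<bar>S n - s\<bar> \<le> r n" "\<bar>T n - t\<bar> \<le> r n" for n
      using X(1)[of n] by (auto simp: XST Q_def abs_le_iff)
    have ls: "S \<longlonglongrightarrow> s" and lt: "T \<longlonglongrightarrow> t"
      by (rule LIM_zero_cancel, rule tendsto_rabs_zero_cancel, rule tendsto_sandwich[OF _ _ tendsto_const rlim]; use bd in simp)+
    have l12: "(\<lambda>n. (\<lambda>(\<sigma>, \<tau>). u12 \<sigma> \<tau>) (S n, T n)) \<longlonglongrightarrow> (\<lambda>(\<sigma>, \<tau>). u12 \<sigma> \<tau>) (s, t)"
      by (rule isCont_tendsto_compose[OF cont(3) tendsto_Pair[OF ls lt]])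
    have "(\<lambda>n. hvar \<Psi> w (S n, T n)) \<longlonglongrightarrow> hvar \<Psi> w (s, t)"
    proof (rule hvar_tendsto[OF \<Psi>(1) w _ s t ls lt])
      show "(S n, T n) \<in> rect P" for n
        using X(1)[of n] Qrect[of n] by (auto simp: XST rect_def)
      show "(\<lambda>n. u1 (S n)) \<longlonglongrightarrow> u1 s" by (rule isCont_tendsto_compose[OF cont(1) ls])
      show "(\<lambda>n. u2 (T n)) \<longlonglongrightarrow> u2 t" by (rule isCont_tendsto_compose[OF cont(2) lt])
      show "(\<lambda>n. u12 (S n) (T n)) \<longlonglongrightarrow> u12 s t" using l12 by simp
    qed
    from order_tendstoD(2)[OF this hc] have "\<forall>\<^sub>F n in sequentially. hvar \<Psi> w (X n) < - c"
      unfolding XST .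
    then have "\<forall>\<^sub>F n in sequentially. \<not> (\<exists>x\<in>Q n. - c < hvar \<Psi> w x)"
      by (rule eventually_mono) (use X(2) in fastforce)
    then show False using \<open>\<exists>\<^sub>F n in sequentially. \<exists>x\<in>Q n. - c < hvar \<Psi> w x\<close>
      by (simp add: frequently_def)
  qed
  have c2: "c / 2 > 0" using c by simp
  obtain m0 where m0': "0 < m0 \<and> (\<forall>Q z'. Q \<in> sets borel \<longrightarrow> Q \<subseteq> {0..<endA P} \<times> {0..<endB P} \<longrightarrow>
    bounded_borel z' \<longrightarrow> volterra P (needle w Q) z' = z' \<longrightarrow> measure (plane P) Q \<le> m0 \<longrightarrow>
    \<bar>path_cost P (needle w Q) z' - path_cost P U z
      - (\<integral>x. (if x \<in> Q then hvar \<Psi> w x else 0) \<partial>plane P)\<bar> \<le> c / 2 * measure (plane P) Q)"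
    using cost_variation[OF \<Psi> w c2] by (rule exE)
  note m0 = m0'[THEN conjunct1] m0'[THEN conjunct2, rule_format]
  have "(\<lambda>n. 4 * (r n)\<^sup>2) \<longlonglongrightarrow> 4 * 0\<^sup>2" by (intro tendsto_intros rlim)
  then have "(\<lambda>n. measure (plane P) (Q n)) \<longlonglongrightarrow> 0" by (simp add: Qm)
  then have "\<forall>\<^sub>F n in sequentially. measure (plane P) (Q n) < m0" by (rule order_tendstoD(2)) (rule m0)
  with near have "\<forall>\<^sub>F n in sequentially. (\<forall>x\<in>Q n. hvar \<Psi> w x \<le> - c) \<and> measure (plane P) (Q n) < m0"
    by (rule eventually_conj)
  then obtain n where n: "\<And>x. x \<in> Q n \<Longrightarrow> hvar \<Psi> w x \<le> - c" "measure (plane P) (Q n) < m0"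
    by (auto simp: eventually_sequentially)
  let ?m = "measure (plane P) (Q n)"
  obtain z' where z': "bounded_borel z'" "volterra P (needle w (Q n)) z' = z'"
    by (rule volterra_fixpoint[OF reg needle_measurable[OF w Qborel[of n]], of "\<lambda>_. True"]) auto
  have "(\<integral>x. (if x \<in> Q n then hvar \<Psi> w x else 0) \<partial>plane P) \<le> (\<integral>x. - c * indicator (Q n) x \<partial>plane P)"
  proof (rule integral_mono)
    show "integrable (plane P) (\<lambda>x. if x \<in> Q n then hvar \<Psi> w x else 0)"
      by (rule integrable_plane, rule bounded_borel_if[OF bounded_borel_hvar[OF \<Psi>(1) w]]) (use Qborel in simp)
    show "integrable (plane P) (\<lambda>x. - c * indicator (Q n) x)"
      using Qborel by (intro integrable_mult_right N.integrable_const_bound[where B=1]) (auto simp: indicator_def)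
  qed (use n(1) in auto)
  also have "\<dots> = - c * ?m" using Qborel[of n] by simp
  finally have 1: "(\<integral>x. (if x \<in> Q n then hvar \<Psi> w x else 0) \<partial>plane P) \<le> - c * ?m" .
  have 2: "\<bar>path_cost P (needle w (Q n)) z' - path_cost P U z
      - (\<integral>x. (if x \<in> Q n then hvar \<Psi> w x else 0) \<partial>plane P)\<bar> \<le> c / 2 * ?m"
    by (rule m0(2)[OF Qborel Qrect z']) (use n(2) in simp)
  have 3: "path_cost P U z \<le>
      path_cost P (needle w (Q n)) z'"
    using z' r[of n] r0 unfolding Q_def by (intro opt) auto
  have "0 < ?m" using r(1)[of n] by (simp add: Qm)
  then have "c / 2 * ?m < c * ?m" using c by simp
  then show False using 1 2 3 by linarith
qed

end

section \<open>Needle controls are admissible\<close>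

lemma mem_closed_segment_axis:
  fixes a l u x :: real
  assumes "l \<le> x" "x \<le> u"
  shows "(a, x) \<in> closed_segment (a, l) (a, u)" "(x, a) \<in> closed_segment (l, a) (u, a)"
proof -
  have "x \<in> closed_segment l u" using assms by (auto simp: closed_segment_eq_real_ivl)
  then obtain v where v: "0 \<le> v" "v \<le> 1" "x = (1 - v) *\<^sub>R l + v *\<^sub>R u" by (auto simp: in_segment)
  then show "(a, x) \<in> closed_segment (a, l) (a, u)" "(x, a) \<in> closed_segment (l, a) (u, a)"
    by (auto simp: in_segment algebra_simps intro!: exI[of _ v])
qed

text \<open>
  The four edges of the square are added to the dividing curves.  A component of what remains is
  connected and avoids the edges, so it lies in the open square or outside the closed one, and outside it lies
  in a component for the old curves, whose continuous extension it inherits.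
\<close>

lemma needle_piecewise_continuous:
  fixes u :: "real \<Rightarrow> real \<Rightarrow> 'c::euclidean_space"
  assumes pc: "piecewise_continuous_2d A B u"
    and s: "0 < s1" "s1 < s2" "s2 < A" and t: "0 < t1" "t1 < t2" "t2 < B"
  shows "piecewise_continuous_2d A B (\<lambda>s t. if (s, t) \<in> {s1..s2} \<times> {t1..t2} then w else u s t)"
    (is "piecewise_continuous_2d A B ?u")
proof -
  let ?Q = "{s1..s2} \<times> {t1..t2}" and ?I = "{s1<..<s2} \<times> {t1<..<t2}" and ?R = "{0<..<A} \<times> {0<..<B}"
  obtain C where C': "finite C \<and> (\<forall>\<gamma>\<in>C. valid_path \<gamma> \<and> path_image \<gamma> \<subseteq> {0..A} \<times> {0..B}) \<and>
    (\<forall>G\<in>components (?R - (\<Union>\<gamma>\<in>C. path_image \<gamma>)). continuous_on G (\<lambda>(s, t). u s t) \<and>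
       (\<exists>g. continuous_on (closure G) g \<and> (\<forall>(s, t)\<in>G. g (s, t) = u s t)))"
    using pc unfolding piecewise_continuous_2d_def by (rule exE)
  note C = C'[THEN conjunct1] C'[THEN conjunct2, THEN conjunct1, rule_format]
    C'[THEN conjunct2, THEN conjunct2, rule_format]
  define E where "E = {linepath (s1, t1) (s1, t2), linepath (s2, t1) (s2, t2),
     linepath (s1, t1) (s2, t1), linepath (s1, t2) (s2, t2)}"
  have E: "valid_path \<gamma> \<and> path_image \<gamma> \<subseteq> {0..A} \<times> {0..B}" if "\<gamma> \<in> E" for \<gamma>
  proof -
    have conv: "convex ({0..A} \<times> {0..B})" by (intro convex_Times convex_real_interval)
    have seg: "closed_segment p q \<subseteq> {0..A} \<times> {0..B}" if "p \<in> {0..A} \<times> {0..B}" "q \<in> {0..A} \<times> {0..B}" for p q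
      by (rule closed_segment_subset[OF that conv])
    have "(s1, t1) \<in> {0..A} \<times> {0..B}" "(s1, t2) \<in> {0..A} \<times> {0..B}"
      "(s2, t1) \<in> {0..A} \<times> {0..B}" "(s2, t2) \<in> {0..A} \<times> {0..B}"
      using s t by auto
    note e = seg[OF this(1,2)] seg[OF this(3,4)] seg[OF this(1,3)] seg[OF this(2,4)]
    from that show ?thesis unfolding E_def
      by (elim insertE emptyE) (simp_all only: path_image_linepath valid_path_linepath e simp_thms)
  qed
  have bd: "x \<in> (\<Union>\<gamma>\<in>E. path_image \<gamma>)" if "x \<in> ?Q" "x \<notin> ?I" for x
  proof -
    obtain p q where x: "x = (p, q)" by (cases x)
    from that have "p = s1 \<or> p = s2 \<or> q = t1 \<or> q = t2" "s1 \<le> p" "p \<le> s2" "t1 \<le> q" "q \<le> t2" by (auto simp: x)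
    then show ?thesis unfolding x E_def using mem_closed_segment_axis[of t1 q t2] mem_closed_segment_axis[of s1 p s2]
      by auto
  qed
  show ?thesis unfolding piecewise_continuous_2d_def
  proof (intro exI[of _ "C \<union> E"] conjI ballI)
    show "finite (C \<union> E)" using C(1) by (simp add: E_def)
    show "valid_path \<gamma>" "path_image \<gamma> \<subseteq> {0..A} \<times> {0..B}" if "\<gamma> \<in> C \<union> E" for \<gamma> using that C(2) E by auto
    fix G assume G: "G \<in> components (?R - (\<Union>\<gamma>\<in>C \<union> E. path_image \<gamma>))"
    have Gs: "G \<subseteq> ?R - (\<Union>\<gamma>\<in>C. path_image \<gamma>)" and GE: "G \<inter> (\<Union>\<gamma>\<in>E. path_image \<gamma>) = {}"
      using in_components_subset[OF G] by auto
    have conn: "connected G" by (rule in_components_connected[OF G])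
    have "?R - (\<Union>\<gamma>\<in>C. path_image \<gamma>) \<noteq> {}" using Gs in_components_nonempty[OF G] by blast
    then obtain H where H: "H \<in> components (?R - (\<Union>\<gamma>\<in>C. path_image \<gamma>))" "G \<subseteq> H"
      using exists_component_superset[OF Gs _ conn] by blast
    have "open ?I" by (intro open_Times) auto
    moreover have "open (- ?Q)" by (intro open_Compl closed_Times) auto
    moreover have "G \<subseteq> ?I \<union> - ?Q" using bd GE by blast
    moreover have "?I \<inter> - ?Q \<inter> G = {}" by auto
    ultimately have "?I \<inter> G = {} \<or> - ?Q \<inter> G = {}" using conn unfolding connected_def by blast
    then have "G \<subseteq> - ?Q \<or> G \<subseteq> ?Q" using bd GE by blast
    then have "continuous_on G (\<lambda>(s, t). ?u s t) \<and> (\<exists>g. continuous_on (closure G) g \<and> (\<forall>(s, t)\<in>G. g (s, t) = ?u s t))"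
    proof
      assume out: "G \<subseteq> - ?Q"
      then have eq: "(\<lambda>(s, t). ?u s t) x = (\<lambda>(s, t). u s t) x" if "x \<in> G" for x
        using subsetD[OF out that] by (cases x) auto
      obtain g where g: "continuous_on (closure H) g" "\<forall>(s, t)\<in>H. g (s, t) = u s t" using C(3)[OF H(1)] by blast
      have "continuous_on G (\<lambda>(s, t). u s t)" using C(3)[OF H(1)] H(2) continuous_on_subset by blast
      then have "continuous_on G (\<lambda>(s, t). ?u s t)" using eq by (simp cong: continuous_on_cong)
      moreover have "continuous_on (closure G) g" using g(1) closure_mono[OF H(2)] continuous_on_subset by blast
      moreover have "\<forall>(s, t)\<in>G. g (s, t) = ?u s t" using g(2) H(2) out by fastforce
      ultimately show ?thesis by blast
    next
      assume ins: "G \<subseteq> ?Q"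
      then have eq: "(\<lambda>(s, t). ?u s t) x = w" if "x \<in> G" for x
        using subsetD[OF ins that] by (cases x) auto
      have "continuous_on G (\<lambda>(s, t). ?u s t)" using eq by (simp cong: continuous_on_cong)
      moreover have "continuous_on (closure G) (\<lambda>x. w)" by simp
      moreover have "\<forall>(s, t)\<in>G. w = ?u s t" using ins by auto
      ultimately show ?thesis by (intro conjI exI[of _ "\<lambda>x. w"])
    qed
    then show "continuous_on G (\<lambda>(s, t). ?u s t)" "\<exists>g. continuous_on (closure G) g \<and> (\<forall>(s, t)\<in>G. g (s, t) = ?u s t)"
      by blast+
  qed
qed

lemma admissible_measurable: "admissible cls P u1 u2 u12 \<Longrightarrow> measurable_controls P u1 u2 u12"
  by (cases cls) (auto simp: admissible_Linf_def admissible_pc_def)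

text \<open>
  The square keeps away from the edges \<open>s = A\<close> and \<open>t = B\<close>, so all the limits are taken where
  the control is unchanged.
\<close>

lemma needle_admissible:
  fixes P :: "('n::finite, 'a::euclidean_space, 'b::euclidean_space, 'c::euclidean_space) problem"
  assumes adm: "admissible cls P u1 u2 u12" and w: "w \<in> U12 P"
    and s: "0 < s1" "s1 < s2" "s2 < endA P" and t: "0 < t1" "t1 < t2" "t2 < endB P"
  shows "admissible cls P u1 u2 (\<lambda>s t. if (s, t) \<in> {s1..s2} \<times> {t1..t2} then w else u12 s t)"
    (is "admissible cls P u1 u2 ?u")
proof -
  let ?A = "endA P" and ?B = "endB P" and ?Q = "{s1..s2} \<times> {t1..t2}"
  have mc: "measurable_controls P u1 u2 u12" by (rule admissible_measurable[OF adm])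
  have meas: "measurable_controls P u1 u2 ?u"
  proof -
    have "?Q \<in> sets borel" by (intro borel_closed closed_Times) auto
    then have "?Q \<inter> space (restrict_space borel (rect P)) \<in> sets (restrict_space borel (rect P))"
      using rect_borel[of P] by (subst sets_restrict_space_iff) auto
    moreover have "(\<lambda>x. u12 (fst x) (snd x)) \<in> borel_measurable (restrict_space borel (rect P))"
      using mc by (auto simp: measurable_controls_def case_prod_unfold)
    ultimately have "(\<lambda>x. if x \<in> ?Q then w else u12 (fst x) (snd x)) \<in> borel_measurable (restrict_space borel (rect P))"
      by (intro measurable_If_set) auto
    then have "(\<lambda>(s, t). ?u s t) \<in> borel_measurable (restrict_space borel (rect P))"
      by (simp only: case_prod_unfold prod.collapse)
    then show ?thesis using mc w unfolding measurable_controls_def by simp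
  qed
  have row: "?u \<sigma> = u12 \<sigma>" if "s2 < \<sigma>" for \<sigma> using that by auto
  have col: "(\<lambda>\<sigma>. ?u \<sigma> \<tau>) = (\<lambda>\<sigma>. u12 \<sigma> \<tau>)" if "t2 < \<tau>" for \<tau> using that by auto
  have evA: "\<forall>\<^sub>F \<sigma> in at_left ?A. s2 < \<sigma>" using eventually_at_left_real[OF s(3)] by (rule eventually_mono) simp
  have evB: "\<forall>\<^sub>F \<tau> in at_left ?B. t2 < \<tau>" using eventually_at_left_real[OF t(3)] by (rule eventually_mono) simp
  have uA: "?u ?A = u12 ?A" by (rule row[OF s(3)])
  have uB: "(\<lambda>\<sigma>. ?u \<sigma> ?B) = (\<lambda>\<sigma>. u12 \<sigma> ?B)" by (rule col[OF t(3)])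
  have corner: "corner_limits ?A ?B ?u" if c: "corner_limits ?A ?B u12"
  proof -
    have ev: "\<forall>\<^sub>F x in at (?A, ?B) within {0..<?A} \<times> {0..<?B}. (\<lambda>(s, t). u12 s t) x = (\<lambda>(s, t). ?u s t) x"
      unfolding eventually_at_topological
      by (rule exI[of _ "{s2<..} \<times> UNIV"]) (use s in \<open>auto intro!: open_Times\<close>)
    have "((\<lambda>(s, t). ?u s t) \<longlongrightarrow> u12 ?A ?B) (at (?A, ?B) within {0..<?A} \<times> {0..<?B})"
      using c unfolding corner_limits_def by (intro Lim_transform_eventually[OF _ ev]) blast
    then show ?thesis using c uA uB s(3) unfolding corner_limits_def by simp
  qed
  show ?thesis
  proof (cases cls)
    case Linf_Limits
    have a: "admissible_Linf P u1 u2 u12" using adm Linf_Limits by simp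
    have 1: "Linf_tendsto ?B (\<lambda>s t. ?u s t) (\<lambda>t. ?u ?A t) (at_left ?A)"
    proof -
      have "\<forall>\<^sub>F \<sigma> in at_left ?A. esssup (lebesgue_on {0..?B}) (\<lambda>x. ereal (norm (u12 \<sigma> x - u12 ?A x))) =
          esssup (lebesgue_on {0..?B}) (\<lambda>x. ereal (norm (?u \<sigma> x - ?u ?A x)))"
        using evA by (rule eventually_mono) (use s in simp)
      with a show ?thesis unfolding admissible_Linf_def Linf_tendsto_def
        by (elim conjE) (rule Lim_transform_eventually)
    qed
    have 2: "Linf_tendsto ?A (\<lambda>t s. ?u s t) (\<lambda>s. ?u s ?B) (at_left ?B)"
    proof -
      have "\<forall>\<^sub>F \<tau> in at_left ?B. esssup (lebesgue_on {0..?A}) (\<lambda>x. ereal (norm (u12 x \<tau> - u12 x ?B))) =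
          esssup (lebesgue_on {0..?A}) (\<lambda>x. ereal (norm (?u x \<tau> - ?u x ?B)))"
        using evB by (rule eventually_mono) (use t in simp)
      with a show ?thesis unfolding admissible_Linf_def Linf_tendsto_def
        by (elim conjE) (rule Lim_transform_eventually)
    qed
    show ?thesis using a 1 2 meas corner Linf_Limits by (simp add: admissible_Linf_def)
  next
    case Piecewise_Cont
    have a: "admissible_pc P u1 u2 u12" using adm Piecewise_Cont by simp
    have 1: "uniform_limit X (\<lambda>s t. ?u s t) (\<lambda>t. ?u ?A t) (at_left ?A)"
      if "uniform_limit X (\<lambda>s t. u12 s t) (\<lambda>t. u12 ?A t) (at_left ?A)" for X
    proof -
      have "\<forall>\<^sub>F \<sigma> in at_left ?A. \<forall>x\<in>X. u12 \<sigma> x = ?u \<sigma> x" using evA by (rule eventually_mono) simp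
      from uniform_limit_cong[OF this, of "u12 ?A" "?u ?A"] show ?thesis using that s by simp
    qed
    have 2: "uniform_limit X (\<lambda>t s. ?u s t) (\<lambda>s. ?u s ?B) (at_left ?B)"
      if "uniform_limit X (\<lambda>t s. u12 s t) (\<lambda>s. u12 s ?B) (at_left ?B)" for X
    proof -
      have "\<forall>\<^sub>F \<tau> in at_left ?B. \<forall>x\<in>X. u12 x \<tau> = ?u x \<tau>" using evB by (rule eventually_mono) simp
      from uniform_limit_cong[OF this, of "\<lambda>s. u12 s ?B" "\<lambda>s. ?u s ?B"] show ?thesis using that t by simp
    qed
    have pc: "piecewise_continuous_2d ?A ?B ?u"
      using a by (intro needle_piecewise_continuous s t) (simp add: admissible_pc_def)
    have pA: "piecewise_continuous 0 ?B (\<lambda>t. ?u ?A t)" using a s by (simp add: admissible_pc_def)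
    have pB: "piecewise_continuous 0 ?A (\<lambda>s. ?u s ?B)" using a t by (simp add: admissible_pc_def)
    from a have cor: "corner_limits ?A ?B u12" by (simp add: admissible_pc_def)
    obtain X where X: "finite X" "uniform_limit ({0..?B} - X) (\<lambda>s t. u12 s t) (\<lambda>t. u12 ?A t) (at_left ?A)"
      using a unfolding admissible_pc_def by (elim conjE exE)
    obtain Y where Y: "finite Y" "uniform_limit ({0..?A} - Y) (\<lambda>t s. u12 s t) (\<lambda>s. u12 s ?B) (at_left ?B)"
      using a unfolding admissible_pc_def by (elim conjE exE)
    from a have rest: "piecewise_continuous 0 ?A u1" "piecewise_continuous 0 ?B u2"
      "(u1 \<longlongrightarrow> u1 ?A) (at_left ?A)" "(u2 \<longlongrightarrow> u2 ?B) (at_left ?B)"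
      by (simp_all add: admissible_pc_def)
    show ?thesis unfolding Piecewise_Cont admissible.simps admissible_pc_def
      by (intro conjI meas pc pA pB corner[OF cor] rest exI[of _ X] exI[of _ Y] X(1) Y(1) 1[OF X(2)] 2[OF Y(2)])
  qed
qed

section \<open>The minimum principle\<close>

theorem mainTheorem1:
  fixes P :: "('n::finite, 'a::euclidean_space, 'b::euclidean_space, 'c::euclidean_space) problem"
    and cls :: control_class
    and u1 :: "real \<Rightarrow> 'a" and u2 :: "real \<Rightarrow> 'b" and u12 :: "real \<Rightarrow> real \<Rightarrow> 'c"
    and y :: "real \<Rightarrow> real \<Rightarrow> real^'n"
    and \<psi>0 :: "real^'n" and \<psi>1 \<psi>2 :: "real \<Rightarrow> real^'n" and \<psi>12 :: "real \<Rightarrow> real \<Rightarrow> real^'n"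
    and s t :: real
  assumes "regular_problem P"
    and "f0_f1_f2_indep_u12 P"
    and "optimal_control cls P u1 u2 u12"
    and "is_state P u1 u2 u12 y"
    and "is_costate P u1 u2 u12 y \<psi>0 \<psi>1 \<psi>2 \<psi>12"
    and "s \<in> {0<..<endA P}" and "t \<in> {0<..<endB P}"
    and "isCont u1 s" and "isCont u2 t" and "isCont (\<lambda>(\<sigma>, \<tau>). u12 \<sigma> \<tau>) (s, t)"
  shows "is_arg_min (\<lambda>w. h12 P s t (y s t, u1 s, u2 t, w) \<psi>0 \<psi>1 \<psi>2 \<psi>12)
           (\<lambda>w. w \<in> U12 P) (u12 s t)"
proof -
  have adm: "admissible cls P u1 u2 u12" using assms(3) by (simp add: optimal_control_def)
  note mc = admissible_measurable[OF adm]
  define z where "z x = (if x \<in> rect P then y (fst x) (snd x) else 0)" for x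
  have z: "bounded_borel z" "volterra P (ctrl P u1 u2 u12) z = z"
    using state_imp_fixpoint[OF assms(1) mc assms(4)] by (simp_all add: z_def[abs_def])
  interpret costate_path P u1 u2 u12 z y \<psi>0 \<psi>1 \<psi>2 \<psi>12
    by unfold_locales (use assms mc z in \<open>auto simp: z_def\<close>)
  have st: "0 < s" "s < endA P" "0 < t" "t < endB P" "(s, t) \<in> rect P"
    using assms(6,7) by (auto simp: rect_def)
  have "h12 P s t (y s t, u1 s, u2 t, u12 s t) \<psi>0 \<psi>1 \<psi>2 \<psi>12 \<le> h12 P s t (y s t, u1 s, u2 t, w) \<psi>0 \<psi>1 \<psi>2 \<psi>12"
    if w: "w \<in> U12 P" for w
  proof -
    have "0 \<le> hvar Psi w (s, t)"
    proof (rule hvar_nonneg[OF bounded_borel_Psi adjoint_Psi w st(1-4) assms(8-10)])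
      fix s1 s2 t1 t2 z'
      assume box: "0 < s1" "s1 < s2" "s2 < endA P" "0 < t1" "t1 < t2" "t2 < endB P"
        and z': "bounded_borel z'" "volterra P (needle w ({s1..s2} \<times> {t1..t2})) z' = z'"
      let ?u = "\<lambda>s t. if (s, t) \<in> {s1..s2} \<times> {t1..t2} then w else u12 s t"
      have adm': "admissible cls P u1 u2 ?u" by (rule needle_admissible[OF adm w box])
      note mc' = admissible_measurable[OF adm']
      have "is_state P u1 u2 ?u (\<lambda>s t. z' (s, t))"
        by (rule fixpoint_imp_state[OF reg mc' z'(1)]) (use z'(2) in \<open>simp only: needle_eq_ctrl\<close>)
      then have "cost P u1 u2 u12 y \<le> cost P u1 u2 ?u (\<lambda>s t. z' (s, t))"
        using assms(3,4) adm' unfolding optimal_control_def by blast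
      moreover have "cost P u1 u2 u12 y = path_cost P U z"
        by (rule cost_eq_integral[OF assms(1) mc z(1)]) (rule y)
      moreover have "cost P u1 u2 ?u (\<lambda>s t. z' (s, t)) =
          path_cost P (ctrl P u1 u2 ?u) z'"
        by (rule cost_eq_integral[OF assms(1) mc' z'(1) refl])
      ultimately show "path_cost P U z \<le>
          path_cost P (needle w ({s1..s2} \<times> {t1..t2})) z'"
        unfolding needle_eq_ctrl by simp
    qed
    then show ?thesis unfolding hvar_eq_h12_diff[OF st(5) w] by simp
  qed
  moreover have "u12 s t \<in> U12 P" using mc st by (auto simp: measurable_controls_def)
  ultimately show ?thesis unfolding is_arg_min_def by (auto simp: not_less)
qed

end
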